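(* Let $n\ge 2$ and let $G\subset\mathbb{R}^n$ be a bounded domain which satisfies a $\beta$-quasihyperbolic boundary condition for some $\beta\in(0,1]$. Suppose that $\dim_{\mathcal{M}}(\partial G)\le\lambda$, where $\lambda\in[n-1,n)$. If $1\le q<p<\infty$ are real numbers such that $$p>\frac{q(n-\lambda b)}{q+b(n-\lambda)},\qquad b=\frac{2\beta}{1+\beta},$$ then $G$ supports the $(q,p)$-Poincaré inequality; that is, there is a finite constant $c$ such that $$\left(\int_G|u(x)-u_G|^q\,dx\right)^{1/q}\le c\left(\int_G|\nabla u(x)|^p\,dx\right)^{1/p}$$ for all $u\in W^{1,p}(G)$.
   Context: A domain is an open connected set. $u_G$ denotes the integral average of $u$ over $G$, and $W^{1,p}(G)$ is the Sobolev space. Quasihyperbolic distance: for $x,y\in G$, $k_G(x,y)=\inf_\gamma\int_\gamma\frac{ds}{\operatorname{dist}(z,\partial G)}$, the infimum being over all rectifiable curves $\gamma$ joining $x$ to $y$ in $G$. A bounded domain $G$ satisfies a $\beta$-quasihyperbolic boundary condition, $\beta\in(0,1]$, if there exist a point $x_0\in G$ and a constant $c<\infty$ such that $k_G(x,x_0)\le\frac1\beta\log\frac{1}{\operatorname{dist}(x,\partial G)}+c$ for every $x\in G$. Upper Minkowski dimension of $E\subset\mathbb{R}^n$: $\dim_{\mathcal{M}}(E)=\sup\{\lambda\ge0:\limsup_{r\to0+}\mathcal{M}_\lambda(E,r)=\infty\}$, where $\mathcal{M}_\lambda(E,r)=\left|\bigcup_{x\in E}B^n(x,r)\right|/r^{n-\lambda}$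 and $|\cdot|$ is Lebesgue $n$-measure. *)

theory Defs
  imports "HOL-Analysis.Analysis"
begin

section \<open>Arc length and the quasihyperbolic distance\<close>

definition curve_length :: "(real \<Rightarrow> 'a::metric_space) \<Rightarrow> real \<Rightarrow> real \<Rightarrow> ennreal" where
  "curve_length g a b =
     (SUP ts \<in> {ts. sorted ts \<and> set ts \<subseteq> {a..b}}.
        ennreal (\<Sum>i<length ts - 1. dist (g (ts ! i)) (g (ts ! Suc i))))"

definition rectifiable_path :: "(real \<Rightarrow> 'a::metric_space) \<Rightarrow> bool" where
  "rectifiable_path g \<longleftrightarrow> path g \<and> curve_length g 0 1 < \<infinity>"

text \<open>The parametrization by arc length of a rectifiable path. The path is constant on each
  level set of its arc length function, so the value does not depend on the choice of \<open>t\<close>.\<close>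

definition arc_length_param :: "(real \<Rightarrow> 'a::metric_space) \<Rightarrow> real \<Rightarrow> 'a" where
  "arc_length_param g s = g (SOME t. t \<in> {0..1} \<and> curve_length g 0 t = ennreal s)"

definition arc_length_integral ::
    "(real \<Rightarrow> 'a::metric_space) \<Rightarrow> ('a \<Rightarrow> ennreal) \<Rightarrow> ennreal" where
  "arc_length_integral g \<rho> =
     (\<integral>\<^sup>+s\<in>{0..enn2real (curve_length g 0 1)}. \<rho> (arc_length_param g s) \<partial>lborel)"

definition quasihyperbolic_dist :: "'a::metric_space set \<Rightarrow> 'a \<Rightarrow> 'a \<Rightarrow> ennreal" where
  "quasihyperbolic_dist G x y =
     (INF g \<in> {g. rectifiable_path g \<and> path_image g \<subseteq> G \<and> pathstart g = x \<and> pathfinish g = y}.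
        arc_length_integral g (\<lambda>z. ennreal (1 / infdist z (frontier G))))"

text \<open>The comparison takes place in \<^typ>\<open>ereal\<close> because the right-hand side may be negative,
  and \<^const>\<open>ennreal\<close> would truncate it.\<close>

definition quasihyperbolic_boundary_condition :: "real \<Rightarrow> 'a::metric_space set \<Rightarrow> bool" where
  "quasihyperbolic_boundary_condition \<beta> G \<longleftrightarrow>
     (\<exists>x0\<in>G. \<exists>c::real. \<forall>x\<in>G.
        enn2ereal (quasihyperbolic_dist G x x0)
          \<le> ereal (1 / \<beta> * ln (1 / infdist x (frontier G)) + c))"


section \<open>Upper Minkowski dimension\<close>

definition minkowski_content_at :: "real \<Rightarrow> 'a::euclidean_space set \<Rightarrow> real \<Rightarrow> ennreal" where
  "minkowski_content_at lam E r =
     emeasure lebesgue (\<Union>x\<in>E. ball x r) / ennreal (r powr (real (DIM('a)) - lam))"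

text \<open>The supremum is taken in \<^typ>\<open>ennreal\<close>, so the supremum of the empty set is 0.\<close>

definition upper_minkowski_dim :: "'a::euclidean_space set \<Rightarrow> ennreal" where
  "upper_minkowski_dim E =
     Sup (ennreal ` {lam. 0 \<le> lam \<and> Limsup (at_right 0) (minkowski_content_at lam E) = \<infinity>})"


section \<open>Sobolev functions and the Poincare inequality\<close>

primrec C_k :: "nat \<Rightarrow> ('a::euclidean_space \<Rightarrow> real) \<Rightarrow> bool" where
  "C_k 0 f \<longleftrightarrow> continuous_on UNIV f"
| "C_k (Suc k) f \<longleftrightarrow>
     f differentiable_on UNIV \<and> (\<forall>b\<in>Basis. C_k k (\<lambda>x. frechet_derivative f (at x) b))"

definition test_function :: "'a::euclidean_space set \<Rightarrow> ('a \<Rightarrow> real) \<Rightarrow> bool" where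
  "test_function G \<phi> \<longleftrightarrow>
     (\<forall>k. C_k k \<phi>) \<and> compact (closure {x. \<phi> x \<noteq> 0}) \<and> closure {x. \<phi> x \<noteq> 0} \<subseteq> G"

definition locally_integrable_on ::
    "('a::euclidean_space \<Rightarrow> 'b::euclidean_space) \<Rightarrow> 'a set \<Rightarrow> bool" where
  "locally_integrable_on f G \<longleftrightarrow> (\<forall>K. compact K \<and> K \<subseteq> G \<longrightarrow> set_integrable lebesgue K f)"

definition weak_gradient_on ::
    "'a::euclidean_space set \<Rightarrow> ('a \<Rightarrow> real) \<Rightarrow> ('a \<Rightarrow> 'a) \<Rightarrow> bool" where
  "weak_gradient_on G u v \<longleftrightarrow>
     locally_integrable_on u G \<and> locally_integrable_on v G \<and>
     (\<forall>\<phi>. test_function G \<phi> \<longrightarrow> (\<forall>b\<in>Basis.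
        (LINT x:G|lebesgue. u x * frechet_derivative \<phi> (at x) b)
          = - (LINT x:G|lebesgue. (v x \<bullet> b) * \<phi> x)))"

text \<open>Elements of the spaces below are functions on the whole type of which only the values
  on \<open>G\<close> matter; functions that agree almost everywhere are not identified.\<close>

definition Lp_on ::
    "real \<Rightarrow> 'a::euclidean_space set \<Rightarrow> ('a \<Rightarrow> 'b::euclidean_space) set" where
  "Lp_on p G = {f. set_borel_measurable lebesgue G f \<and>
                   set_integrable lebesgue G (\<lambda>x. norm (f x) powr p)}"

definition sobolev_W1 :: "real \<Rightarrow> 'a::euclidean_space set \<Rightarrow> ('a \<Rightarrow> real) set" where
  "sobolev_W1 p G = {u \<in> Lp_on p G. \<exists>v \<in> Lp_on p G. weak_gradient_on G u v}"

definition integral_average :: "'a::euclidean_space set \<Rightarrow> ('a \<Rightarrow> real) \<Rightarrow> real" where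
  "integral_average G u = (LINT x:G|lebesgue. u x) / measure lebesgue G"

text \<open>Weak gradients are unique up to null sets, so \<open>v\<close> ranges over the representatives
  of the gradient of \<open>u\<close>. For \<open>1 \<le> q \<le> p\<close> and bounded \<open>G\<close> both integrands are integrable.\<close>

definition supports_Poincare :: "real \<Rightarrow> real \<Rightarrow> 'a::euclidean_space set \<Rightarrow> bool" where
  "supports_Poincare q p G \<longleftrightarrow>
     (\<exists>c::real. \<forall>u \<in> sobolev_W1 p G. \<forall>v \<in> Lp_on p G. weak_gradient_on G u v \<longrightarrow>
        (LINT x:G|lebesgue. \<bar>u x - integral_average G u\<bar> powr q) powr (1 / q)
          \<le> c * (LINT x:G|lebesgue. norm (v x) powr p) powr (1 / p))"

end

theory Submission
  imports Defs "HOL-Real_Asymp.Real_Asymp"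
begin

text \<open>Write \<open>d x\<close> for the distance of \<open>x\<close> to the boundary. A shortest chain of steps of relative
  length \<open>\<kappa>\<close> from \<open>x\<close> to the base point visits points whose boundary distance decays
  geometrically, and the chain stays within \<open>C * d y powr b\<close> of \<open>x\<close> after having passed through \<open>y\<close>,
  for every \<open>b < 2 * \<beta> / (1 + \<beta>)\<close> once \<open>\<kappa>\<close> is small. Telescoping averages over balls along the
  chain bounds the oscillation of \<open>u\<close> by a kernel integral of the gradient. Jensen's inequality,
  with a weight that is summable along chains, brings the exponent \<open>q\<close> inside; Young's inequality
  splits the result into the energy \<open>\<integral> \<bar>\<nabla>u\<bar>^p\<close> and a constant. The first part is
  controlled by the volume of the shadow of \<open>y\<close>, the second by \<open>\<integral> d powr (- s)\<close> with
  \<open>s < n - lam\<close>, which is finite by the dimension hypothesis; the strict inequality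
  on \<open>p\<close> leaves room for the small losses in \<open>b\<close> and \<open>s\<close>. Scaling \<open>u\<close> makes the additive
  estimate homogeneous.\<close>

section \<open>Smooth bump functions\<close>

text \<open>The boundary condition supplies, for each point separately, an almost minimal curve to
  the base point, and says nothing about the tails of that curve. A chain with the fewest steps
  repairs this: its tail from any visited point is as short as any chain from there, so the boundary
  condition becomes effective at every point visited, and the chain balls overlap at most twice.
  Chains of different points need no compatibility; only the volume of the shadow of
  \<open>y\<close>, the set of points whose chain comes near \<open>y\<close>, enters. The bound on
  \<open>p\<close> is bookkeeping of powers of \<open>d\<close>. A shadow has volume of order
  \<open>d powr (b * n)\<close>, which fixes the weight of the gradient term in Young's inequality.
  The other term then carries the power \<open>E = (b * n * q + (q - n) * p) / (p - q)\<close>, up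
  to small losses, and is summable along chains against \<open>d powr (- s)\<close> when
  \<open>E + n + b * s > 0\<close>. For \<open>s = n - lam\<close> this reads
  \<open>p * (q + b * (n - lam)) > q * (n - lam * b)\<close>.\<close>

lemma C_k_SucD: "C_k (Suc k) f \<Longrightarrow> C_k k f"
proof (induction k arbitrary: f)
  case 0
  then show ?case by (simp add: differentiable_imp_continuous_on)
next
  case (Suc k)
  then show ?case by (metis C_k.simps(2))
qed

lemma C_k_SucI:
  assumes "\<And>x. (f has_derivative f' x) (at x)" "\<And>b. b \<in> Basis \<Longrightarrow> C_k k (\<lambda>x. f' x b)"
  shows "C_k (Suc k) f"
proof -
  have "frechet_derivative f (at x) = f' x" for x
    using assms(1) by (metis frechet_derivative_at)
  then show ?thesis
    using assms by (auto simp: differentiable_on_def differentiable_def)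
qed

lemma C_k_SucE:
  assumes "C_k (Suc k) f"
  shows "(f has_derivative frechet_derivative f (at x)) (at x)"
  using assms by (auto simp: differentiable_on_def frechet_derivative_works)

lemma C_k_const: "C_k k (\<lambda>x. c)"
proof (induction k arbitrary: c)
  case (Suc k)
  show ?case by (rule C_k_SucI[where f' = "\<lambda>x h. 0"]) (auto simp: Suc)
qed auto

lemma C_k_add: "C_k k f \<Longrightarrow> C_k k g \<Longrightarrow> C_k k (\<lambda>x. f x + g x)"
proof (induction k arbitrary: f g)
  case (Suc k)
  show ?case
    by (rule C_k_SucI[OF has_derivative_add[OF C_k_SucE[OF Suc.prems(1)] C_k_SucE[OF Suc.prems(2)]]])
       (use Suc in auto)
qed (auto intro: continuous_intros)

lemma C_k_mult: "C_k k f \<Longrightarrow> C_k k g \<Longrightarrow> C_k k (\<lambda>x. f x * g x)"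
proof (induction k arbitrary: f g)
  case (Suc k)
  show ?case
  proof (rule C_k_SucI[OF has_derivative_mult[OF C_k_SucE[OF Suc.prems(1)] C_k_SucE[OF Suc.prems(2)]]])
    fix b :: 'a assume "b \<in> Basis"
    then show "C_k k (\<lambda>x. f x * frechet_derivative g (at x) b + frechet_derivative f (at x) b * g x)"
      using Suc.prems by (intro C_k_add Suc.IH C_k_SucD[of k f] C_k_SucD[of k g]) auto
  qed
qed (auto intro: continuous_intros)

lemma C_k_prod: "finite I \<Longrightarrow> (\<And>i. i \<in> I \<Longrightarrow> C_k k (f i)) \<Longrightarrow> C_k k (\<lambda>x. \<Prod>i\<in>I. f i x)"
  by (induction I rule: finite_induct) (auto intro: C_k_const C_k_mult)

text \<open>For \<open>t > 0\<close> the derivative of \<open>exp (- 1 / t) / t ^ j\<close> is a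
  combination of the members with index \<open>Suc j\<close> and \<open>Suc (Suc j)\<close>. The
  family is thus closed under differentiation, and smoothness of all orders follows by one induction
  with \<open>j\<close> arbitrary.\<close>

definition smooth_step :: "nat \<Rightarrow> real \<Rightarrow> real" where
  "smooth_step j t = (if t \<le> 0 then 0 else exp (- inverse t) * inverse t ^ j)"

lemma smooth_step_tendsto_0: "(smooth_step j \<longlongrightarrow> 0) (at 0)"
proof (rule filterlim_split_at)
  show "(smooth_step j \<longlongrightarrow> 0) (at_left 0)"
    by (intro tendsto_eventually eventually_at_leftI[of "-1"]) (auto simp: smooth_step_def)
  have "((\<lambda>t. inverse t ^ j / exp (inverse t)) \<longlongrightarrow> 0) (at_right (0::real))"
    by (rule filterlim_compose[OF tendsto_power_div_exp_0 filterlim_inverse_at_top_right])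
  moreover have "(smooth_step j \<longlongrightarrow> 0) (at_right 0) \<longleftrightarrow>
      ((\<lambda>t. inverse t ^ j / exp (inverse t)) \<longlongrightarrow> 0) (at_right (0::real))"
    by (intro filterlim_cong refl eventually_at_rightI[of _ 1])
       (auto simp: smooth_step_def exp_minus field_simps)
  ultimately show "(smooth_step j \<longlongrightarrow> 0) (at_right 0)" by simp
qed

lemma smooth_step_DERIV:
  "(smooth_step j has_real_derivative smooth_step (Suc (Suc j)) t - real j * smooth_step (Suc j) t) (at t)"
proof -
  consider "t < 0" | "t = 0" | "t > 0" by linarith
  then show ?thesis
  proof cases
    case 1
    have "((\<lambda>t. 0) has_real_derivative 0) (at t)" by simp
    then have "(smooth_step j has_real_derivative 0) (at t)"
      by (rule has_field_derivative_transform_within_open[where S = "{..<0}"])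
         (use 1 in \<open>auto simp: smooth_step_def\<close>)
    then show ?thesis using 1 by (simp add: smooth_step_def)
  next
    case 2
    \<comment> \<open>At 0 the difference quotient of index \<open>j\<close> is the function of
      index \<open>Suc j\<close>, which tends to 0.\<close>
    have "((\<lambda>h. (smooth_step j (0 + h) - smooth_step j 0) / h) \<longlongrightarrow> 0) (at 0)"
    proof (rule Lim_transform_eventually[OF smooth_step_tendsto_0[of "Suc j"]])
      show "\<forall>\<^sub>F h in at 0. smooth_step (Suc j) h = (smooth_step j (0 + h) - smooth_step j 0) / h"
        by (auto simp: eventually_at_filter smooth_step_def field_simps)
    qed
    then show ?thesis using 2 by (simp add: DERIV_def smooth_step_def)
  next
    case 3
    have "((\<lambda>t. exp (- inverse t) * inverse t ^ j) has_real_derivative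
         exp (- inverse t) * inverse t ^ Suc (Suc j) - real j * (exp (- inverse t) * inverse t ^ Suc j)) (at t)"
    proof -
      have "((\<lambda>t. exp (- inverse t)) has_real_derivative exp (- inverse t) * (inverse t)\<^sup>2) (at t)"
        using 3 by (auto intro!: derivative_eq_intros simp: power2_eq_square)
      moreover have "((\<lambda>t. inverse t ^ j) has_real_derivative - (real j * inverse t ^ Suc j)) (at t)"
        using 3 by (intro DERIV_cong[OF DERIV_power[OF DERIV_inverse]]) (cases j; simp)+
      ultimately show ?thesis
        by (rule DERIV_cong[OF DERIV_mult]) (simp add: algebra_simps power2_eq_square)
    qed
    then have "(smooth_step j has_real_derivative 
         exp (- inverse t) * inverse t ^ Suc (Suc j) - real j * (exp (- inverse t) * inverse t ^ Suc j)) (at t)"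
      by (rule has_field_derivative_transform_within_open[where S = "{0<..}"])
         (use 3 in \<open>auto simp: smooth_step_def\<close>)
    then show ?thesis using 3 by (simp add: smooth_step_def)
  qed
qed

lemma C_k_smooth_step: "C_k k (\<lambda>x. smooth_step j (c * (x \<bullet> i) + e))"
proof (induction k arbitrary: j)
  case 0
  have "continuous_on UNIV (smooth_step j)"
    using smooth_step_DERIV by (intro DERIV_continuous_on) (auto intro: has_field_derivative_at_within)
  then show ?case
    by (auto intro!: continuous_on_compose2[of UNIV "smooth_step j"] continuous_intros)
next
  case (Suc k)
  show ?case
  proof (rule C_k_SucI)
    fix x :: 'a
    have "((\<lambda>x. c * (x \<bullet> i) + e) has_derivative (\<lambda>h. c * (h \<bullet> i))) (at x)"
      by (auto intro!: derivative_eq_intros)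
    from has_derivative_compose[OF this smooth_step_DERIV[unfolded has_field_derivative_def]]
    show "((\<lambda>x. smooth_step j (c * (x \<bullet> i) + e)) has_derivative
      (\<lambda>h. (smooth_step (Suc (Suc j)) (c * (x \<bullet> i) + e) + (- real j) * smooth_step (Suc j) (c * (x \<bullet> i) + e)) * (c * (h \<bullet> i)))) (at x)"
      by simp
  next
    fix b :: 'a
    show "C_k k (\<lambda>x. (smooth_step (Suc (Suc j)) (c * (x \<bullet> i) + e) + (- real j) * smooth_step (Suc j) (c * (x \<bullet> i) + e)) * (c * (b \<bullet> i)))"
      by (intro C_k_mult C_k_add C_k_const Suc.IH)
  qed
qed

text \<open>\<open>m\<close> sharpens the bump: for \<open>t > 0\<close> the factor
  \<open>exp (- 1 / (m * t))\<close> increases to 1 as \<open>m\<close> grows, so the bumps converge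
  boundedly to the indicator of the open box while their supports stay in the closed box. Box
  indicators thus become limits of test functions.\<close>

definition box_bump :: "real \<Rightarrow> 'a::euclidean_space \<Rightarrow> 'a \<Rightarrow> 'a \<Rightarrow> real" where
  "box_bump m a b x = (\<Prod>i\<in>Basis. smooth_step 0 (m * ((x - a) \<bullet> i)) * smooth_step 0 (m * ((b - x) \<bullet> i)))"

lemma C_k_box_bump: "C_k k (box_bump m a b)"
proof -
  have e: "box_bump m a b = (\<lambda>x. \<Prod>i\<in>Basis. smooth_step 0 (m * (x \<bullet> i) + (- m * (a \<bullet> i))) * smooth_step 0 ((-m) * (x \<bullet> i) + m * (b \<bullet> i)))"
    by (auto simp: fun_eq_iff box_bump_def algebra_simps)
  show ?thesis unfolding e by (intro C_k_prod C_k_mult C_k_smooth_step) auto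
qed

lemma smooth_step_0_bounds: "0 \<le> smooth_step 0 t" "smooth_step 0 t \<le> 1"
  by (auto simp: smooth_step_def)

lemma box_bump_bounds: "0 \<le> box_bump m a b x" "box_bump m a b x \<le> 1"
  unfolding box_bump_def
  by (auto intro!: prod_nonneg prod_le_1 mult_nonneg_nonneg mult_le_one smooth_step_0_bounds)

lemma box_bump_eq_0: 
  assumes "m > 0" "x \<notin> box a b"
  shows "box_bump m a b x = 0"
proof -
  obtain i where i: "i \<in> Basis" "\<not> (a \<bullet> i < x \<bullet> i \<and> x \<bullet> i < b \<bullet> i)"
    using assms by (auto simp: mem_box)
  then have "smooth_step 0 (m * ((x - a) \<bullet> i)) * smooth_step 0 (m * ((b - x) \<bullet> i)) = 0"
    using assms by (auto simp: smooth_step_def algebra_simps)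
  then show ?thesis unfolding box_bump_def using i by (metis finite_Basis prod_zero)
qed

lemma box_bump_tendsto: "(\<lambda>k. box_bump (real (Suc k)) a b x) \<longlonglongrightarrow> indicator (box a b) x"
proof (cases "x \<in> box a b")
  case True
  have s: "(\<lambda>k. smooth_step 0 (real (Suc k) * t)) \<longlonglongrightarrow> 1" if "t > 0" for t
  proof -
    have "(\<lambda>k. exp (- (inverse (real (Suc k)) * inverse t))) \<longlonglongrightarrow> exp (- (0 * inverse t))"
      by (intro tendsto_intros LIMSEQ_inverse_real_of_nat)
    then show ?thesis using that by (simp add: smooth_step_def mult_le_0_iff)
  qed
  have "(\<lambda>k. box_bump (real (Suc k)) a b x) \<longlonglongrightarrow> (\<Prod>i\<in>(Basis::'a set). 1 * 1)"
    unfolding box_bump_def using True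
    by (intro tendsto_prod tendsto_mult s) (auto simp: mem_box algebra_simps)
  then show ?thesis using True by simp
next
  case False
  then show ?thesis by (simp add: box_bump_eq_0)
qed

lemma test_function_box_bump:
  assumes "m > 0" "cbox a b \<subseteq> G"
  shows "test_function G (box_bump m a b)"
proof -
  have "{x. box_bump m a b x \<noteq> 0} \<subseteq> box a b"
    using box_bump_eq_0[OF assms(1)] by blast
  then have "closure {x. box_bump m a b x \<noteq> 0} \<subseteq> cbox a b"
    using box_subset_cbox by (intro closure_minimal) auto
  then show ?thesis
    using assms by (auto simp: test_function_def C_k_box_bump compact_eq_bounded_closed intro: bounded_subset[OF bounded_cbox])
qed

lemma box_bump_translate: "box_bump m (a + c) (b + c) x = box_bump m a b (x - c)"
  by (simp add: box_bump_def algebra_simps)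

definition box_bump_deriv :: "real \<Rightarrow> 'a::euclidean_space \<Rightarrow> 'a \<Rightarrow> 'a \<Rightarrow> 'a \<Rightarrow> real" where
  "box_bump_deriv m a b h x = frechet_derivative (box_bump m a b) (at x) h"

lemma has_derivative_box_bump: "(box_bump m a b has_derivative (\<lambda>h. box_bump_deriv m a b h x)) (at x)"
  unfolding box_bump_deriv_def using C_k_SucE[OF C_k_box_bump[of "Suc 0"]] .

lemma box_bump_deriv_sum:
  "box_bump_deriv m a b h x = (\<Sum>i\<in>Basis. (h \<bullet> i) * box_bump_deriv m a b i x)"
proof -
  have "linear (\<lambda>h. box_bump_deriv m a b h x)"
    using has_derivative_box_bump by (rule has_derivative_linear)
  then have "box_bump_deriv m a b (\<Sum>i\<in>Basis. (h \<bullet> i) *\<^sub>R i) x = (\<Sum>i\<in>Basis. (h \<bullet> i) * box_bump_deriv m a b i x)"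
    by (simp add: linear_sum[where f = "\<lambda>h. box_bump_deriv m a b h x"] linear_cmul[where f = "\<lambda>h. box_bump_deriv m a b h x"])
  then show ?thesis by (simp add: euclidean_representation)
qed

lemma continuous_box_bump_deriv: "continuous_on UNIV (box_bump_deriv m a b h)"
proof -
  have "continuous_on UNIV (box_bump_deriv m a b i)" if "i \<in> Basis" for i
    using C_k_box_bump[of "Suc 0" m a b] that by (simp add: box_bump_deriv_def)
  then have "continuous_on UNIV (\<lambda>x. \<Sum>i\<in>Basis. (h \<bullet> i) * box_bump_deriv m a b i x)"
    by (intro continuous_intros)
  then show ?thesis unfolding box_bump_deriv_sum[symmetric] .
qed

lemma box_bump_deriv_translate: "box_bump_deriv m (a + c) (b + c) h x = box_bump_deriv m a b h (x - c)"
proof -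
  have "((\<lambda>x. x - c) has_derivative (\<lambda>h. h)) (at x)" by (auto intro!: derivative_eq_intros)
  from has_derivative_compose[OF this has_derivative_box_bump]
  have "(box_bump m (a + c) (b + c) has_derivative (\<lambda>h. box_bump_deriv m a b h (x - c))) (at x)"
    unfolding box_bump_translate[abs_def] .
  with has_derivative_box_bump[of m "a + c" "b + c" x] show ?thesis
    by (metis has_derivative_unique)
qed

lemma box_bump_deriv_bounded:
  assumes "m > 0"
  obtains B where "B \<ge> 0" "\<And>x. \<bar>box_bump_deriv m a b h x\<bar> \<le> B"
proof -
  have z: "box_bump_deriv m a b h x = 0" if "x \<notin> cbox a b" for x
  proof -
    have "((\<lambda>x. 0) has_derivative (\<lambda>h. 0)) (at x)" by simp
    then have "(box_bump m a b has_derivative (\<lambda>h. 0)) (at x)"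
      by (rule has_derivative_transform_within_open[where s = "- cbox a b"])
         (use that box_bump_eq_0[OF assms, of _ a b] box_subset_cbox[of a b] in \<open>auto simp: open_Compl closed_cbox\<close>)
    with has_derivative_box_bump[of m a b x] show ?thesis by (metis has_derivative_unique)
  qed
  have "bounded (box_bump_deriv m a b h ` cbox a b)"
    by (intro compact_imp_bounded compact_continuous_image continuous_on_subset[OF continuous_box_bump_deriv]) auto
  then obtain B where B: "B > 0" "\<forall>x\<in>cbox a b. \<bar>box_bump_deriv m a b h x\<bar> \<le> B"
    unfolding bounded_pos by auto
  show thesis
  proof (rule that[of B])
    show "\<bar>box_bump_deriv m a b h x\<bar> \<le> B" for x using B z by (cases "x \<in> cbox a b") auto
  qed (use B in auto)
qed

text \<open>Fundamental theorem of calculus on the segment from \<open>x\<close> to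
  \<open>x - h\<close>. The shift is by \<open>- h\<close> because a shift of \<open>u\<close> by
  \<open>h\<close> turns into this shift of the bump after a change of variables.\<close>

lemma box_bump_line_integral:
  "box_bump m a b (x - h) - box_bump m a b x =
     (\<integral>t. indicator {0..1} t * (- box_bump_deriv m a b h (x - t *\<^sub>R h)) \<partial>lborel)"
proof -
  have "((\<lambda>t. box_bump m a b (x - t *\<^sub>R h)) has_real_derivative - box_bump_deriv m a b h (x - t *\<^sub>R h)) (at t)" for t
  proof -
    have "((\<lambda>t. x - t *\<^sub>R h) has_derivative (\<lambda>s. - (s *\<^sub>R h))) (at t)"
      by (auto intro!: derivative_eq_intros)
    from has_derivative_compose[OF this has_derivative_box_bump]
    have "((\<lambda>t. box_bump m a b (x - t *\<^sub>R h)) has_derivative (\<lambda>s. box_bump_deriv m a b (- (s *\<^sub>R h)) (x - t *\<^sub>R h))) (at t)" .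
    moreover have "box_bump_deriv m a b (- (s *\<^sub>R h)) y = (- box_bump_deriv m a b h y) * s" for s y
      by (subst (1 2) box_bump_deriv_sum) (simp add: sum_distrib_left sum_distrib_right sum_negf mult_ac)
    ultimately have "((\<lambda>t. box_bump m a b (x - t *\<^sub>R h)) has_derivative (\<lambda>s. (- box_bump_deriv m a b h (x - t *\<^sub>R h)) * s)) (at t)"
      by (simp only:)
    then show ?thesis unfolding has_field_derivative_def .
  qed
  then have "(\<integral>t. (- box_bump_deriv m a b h (x - t *\<^sub>R h)) * indicator {0..1} t \<partial>lborel) =
     box_bump m a b (x - 1 *\<^sub>R h) - box_bump m a b (x - 0 *\<^sub>R h)"
  proof (intro integral_FTC_Icc_real)
    fix t
    have "continuous_on UNIV (\<lambda>t. - box_bump_deriv m a b h (x - t *\<^sub>R h))"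
      by (intro continuous_intros continuous_on_compose2[OF continuous_box_bump_deriv]) auto
    then show "isCont (\<lambda>t. - box_bump_deriv m a b h (x - t *\<^sub>R h)) t"
      by (simp add: continuous_on_eq_continuous_at)
  qed auto
  then show ?thesis by (simp add: mult.commute)
qed

section \<open>Differences of weakly differentiable functions\<close>

text \<open>Covers the non-integrable case, where the integral is 0 by convention.\<close>

lemma norm_integral_le_nn_integral:
  fixes f :: "'a \<Rightarrow> 'b::{banach, second_countable_topology}"
  shows "ennreal (norm (integral\<^sup>L M f)) \<le> (\<integral>\<^sup>+x. ennreal (norm (f x)) \<partial>M)"
  by (cases "integrable M f") (auto simp: integral_norm_bound_ennreal not_integrable_integral_eq)

lemma nn_integral_lborel_translate:
  fixes f :: "'a::euclidean_space \<Rightarrow> ennreal"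
  assumes "f \<in> borel_measurable borel"
  shows "(\<integral>\<^sup>+x. f (x + c) \<partial>lborel) = (\<integral>\<^sup>+x. f x \<partial>lborel)"
proof -
  have "(\<integral>\<^sup>+x. f x \<partial>lborel) = (\<integral>\<^sup>+x. f x \<partial>distr lborel borel ((+) c))"
    by (simp add: lborel_distr_plus)
  also have "\<dots> = (\<integral>\<^sup>+x. f (c + x) \<partial>lborel)"
    using assms by (intro nn_integral_distr) auto
  finally show ?thesis by (simp add: add.commute)
qed

lemma lborel_integral_translate:
  fixes f :: "'a::euclidean_space \<Rightarrow> 'b::euclidean_space"
  assumes "f \<in> borel_measurable borel"
  shows "(\<integral>x. f (x + c) \<partial>lborel) = (\<integral>x. f x \<partial>lborel)"
proof -
  have "(\<integral>x. f x \<partial>lborel) = (\<integral>x. f x \<partial>distr lborel borel ((+) c))"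
    by (simp add: lborel_distr_plus)
  also have "\<dots> = (\<integral>x. f (c + x) \<partial>lborel)"
    using assms by (intro integral_distr) auto
  finally show ?thesis by (simp add: add.commute)
qed

lemma lborel_integrable_translate:
  fixes f :: "'a::euclidean_space \<Rightarrow> 'b::euclidean_space"
  assumes "integrable lborel f"
  shows "integrable lborel (\<lambda>x. f (x + c))"
proof -
  have "integrable (distr lborel borel ((+) c)) f" using assms by (simp add: lborel_distr_plus)
  then have "integrable lborel (\<lambda>x. f (c + x))"
    using assms by (subst (asm) integrable_distr_eq) auto
  then show ?thesis by (simp add: add.commute)
qed

text \<open>Boxes are closed under intersection and generate the Borel sets. On a fixed closed box
  inside \<open>U\<close> the positive and negative parts of \<open>F\<close> therefore define the
  same measure, and densities are unique almost everywhere. Countably many closed boxes exhaust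
  \<open>U\<close>.\<close>

lemma AE_eq_0_of_box_integrals:
  fixes F :: "'a::euclidean_space \<Rightarrow> real"
  assumes F: "integrable lborel F" and "open U"
    and box: "\<And>a b. cbox a b \<subseteq> U \<Longrightarrow> (\<integral>x. indicator (box a b) x * F x \<partial>lborel) = 0"
  shows "AE x in lborel. x \<in> U \<longrightarrow> F x = 0"
proof -
  note [measurable] = borel_measurable_integrable[OF F]
  have J: "AE x in lborel. x \<in> cbox c d \<longrightarrow> F x = 0" if sub: "cbox c d \<subseteq> U" for c d
  proof -
    define f where "f x = indicator (box c d) x * F x" for x
    have f: "integrable lborel f"
      unfolding f_def using integrable_mult_indicator[OF _ F, of "box c d"] by simp
    note [measurable] = borel_measurable_integrable[OF f]
    \<comment> \<open>The coercion to \<open>ennreal\<close> cuts off negative values, so these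
      measures have the positive and the negative part of \<open>f\<close> as densities.\<close>
    have "density lborel f = density lborel (\<lambda>x. - f x)"
    proof (rule measure_eqI_generator_eq)
      let ?E = "range (\<lambda>(a, b). box a b::'a set)"
      show "Int_stable ?E" by (auto simp: Int_stable_def box_Int_box)
      show "?E \<subseteq> Pow UNIV" "sets (density lborel f) = sigma_sets UNIV ?E"
        "sets (density lborel (\<lambda>x. ennreal (- f x))) = sigma_sets UNIV ?E"
        by (simp_all add: borel_eq_box)
      let ?A = "\<lambda>n::nat. box (- (real n *\<^sub>R One)) (real n *\<^sub>R One) :: 'a set"
      show "range ?A \<subseteq> ?E" "(\<Union>i. ?A i) = UNIV"
        unfolding UN_box_eq_UNIV by auto
      show "emeasure (density lborel f) (?A i) \<noteq> \<infinity>" for i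
      proof -
        have "emeasure (density lborel f) (?A i) = (\<integral>\<^sup>+x. ennreal (f x) * indicator (?A i) x \<partial>lborel)"
          by (rule emeasure_density) auto
        also have "\<dots> \<le> (\<integral>\<^sup>+x. ennreal (norm (f x)) \<partial>lborel)"
          by (intro nn_integral_mono) (auto split: split_indicator intro: ennreal_leI)
        also have "\<dots> < \<infinity>" using f by (simp add: integrable_iff_bounded)
        finally show ?thesis by simp
      qed
      fix X assume "X \<in> ?E"
      then obtain a b where X: "X = box a b" by auto
      define g where "g x = indicator (box a b) x * f x" for x
      have g: "integrable lborel g"
        unfolding g_def using integrable_mult_indicator[OF _ f, of "box a b"] by simp
      obtain a' b' where ab: "box a b \<inter> box c d = box a' b'"
        using box_Int_box[of a b c d] by blast
      have g': "g x = indicator (box a' b') x * F x" for x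
        unfolding ab[symmetric] g_def f_def by (simp add: indicator_inter_arith)
      have "integral\<^sup>L lborel g = 0"
      proof (cases "box a' b' = {}")
        case False
        have "closure (box a' b') \<subseteq> cbox c d"
          using ab box_subset_cbox[of c d] by (intro closure_minimal) auto
        then have "cbox a' b' \<subseteq> U" using sub closure_box[OF False] by auto
        from box[OF this] show ?thesis unfolding g' .
      next
        case True
        then have "g = (\<lambda>x. 0)" by (auto simp: fun_eq_iff g')
        then show ?thesis by simp
      qed
      moreover have "(\<integral>\<^sup>+x. g x \<partial>lborel) \<noteq> \<infinity>" "(\<integral>\<^sup>+x. ennreal (- g x) \<partial>lborel) \<noteq> \<infinity>"
        using g by (auto simp: real_integrable_def)
      ultimately have "(\<integral>\<^sup>+x. g x \<partial>lborel) = (\<integral>\<^sup>+x. ennreal (- g x) \<partial>lborel)"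
        using real_lebesgue_integral_def[OF g]
        by (cases "(\<integral>\<^sup>+x. g x \<partial>lborel)"; cases "(\<integral>\<^sup>+x. ennreal (- g x) \<partial>lborel)") auto
      moreover have "emeasure (density lborel f) X = (\<integral>\<^sup>+x. g x \<partial>lborel)"
        unfolding X by (subst emeasure_density) (auto simp: g_def intro!: nn_integral_cong split: split_indicator)
      moreover have "emeasure (density lborel (\<lambda>x. - f x)) X = (\<integral>\<^sup>+x. ennreal (- g x) \<partial>lborel)"
        unfolding X by (subst emeasure_density) (auto simp: g_def intro!: nn_integral_cong split: split_indicator)
      ultimately show "emeasure (density lborel f) X = emeasure (density lborel (\<lambda>x. - f x)) X" by simp
    qed
    then have "AE x in lborel. ennreal (f x) = ennreal (- f x)"
      by (intro sigma_finite_measure.density_unique[OF sigma_finite_lborel]) auto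
    then have "AE x in lborel. f x = 0"
      by eventually_elim (metis ennreal_neg ennreal_eq_0_iff linorder_linear neg_0_le_iff_le neg_le_0_iff_le order_antisym)
    \<comment> \<open>On the faces \<open>f\<close> vanishes by construction and carries no
      information about \<open>F\<close>; they form a null set.\<close>
    moreover have "AE x in lborel. x \<notin> cbox c d - box c d"
    proof (intro AE_not_in null_setsI)
      show "emeasure lborel (cbox c d - box c d) = 0"
        using box_subset_cbox[of c d]
        by (subst emeasure_Diff) (auto simp: emeasure_lborel_box_eq emeasure_lborel_cbox_eq)
    qed auto
    ultimately show ?thesis by eventually_elim (auto simp: f_def)
  qed
  obtain \<D> where D: "countable \<D>" "\<D> \<subseteq> Pow U" "\<And>X. X \<in> \<D> \<Longrightarrow> \<exists>a b. X = cbox a b" "\<Union>\<D> = U"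
    using open_countable_Union_open_cbox[OF \<open>open U\<close>] by blast
  have "AE x in lborel. \<forall>X\<in>\<D>. x \<in> X \<longrightarrow> F x = 0"
    unfolding AE_ball_countable[OF D(1)] using D(2,3) J by (metis PowD subsetD)
  then show ?thesis by eventually_elim (use D(4) in auto)
qed

text \<open>Provides the product integrability for every use of Fubini below: with \<open>u\<close>
  itself, shift 0 and the derivative of a bump as \<open>K\<close>, and with
  \<open>v \<bullet> h\<close>, shift \<open>h\<close> and a bump or 1 as \<open>K\<close>.\<close>

lemma integrable_shift_bounded:
  fixes u :: "'a::euclidean_space \<Rightarrow> real" and K :: "'a \<Rightarrow> real \<Rightarrow> real"
  assumes u: "integrable lborel u"
    and [measurable]: "case_prod K \<in> borel_measurable (borel \<Otimes>\<^sub>M borel)"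
    and K: "\<And>x t. \<bar>K x t\<bar> \<le> B"
  shows "integrable (lborel \<Otimes>\<^sub>M lborel) (\<lambda>(x,t). u (x + t *\<^sub>R h) * indicator {0..1} t * K x t)"
proof (rule integrableI_bounded)
  note [measurable] = borel_measurable_integrable[OF u]
  have [measurable]: "(\<lambda>(x,t). K x t) \<in> borel_measurable (lborel \<Otimes>\<^sub>M lborel)"
    using assms(2) by simp
  show "(\<lambda>(x,t). u (x + t *\<^sub>R h) * indicator {0..1} t * K x t) \<in> borel_measurable (lborel \<Otimes>\<^sub>M lborel)"
    by measurable
  have B: "B \<ge> 0" using K[of 0 0] by linarith
  have "(\<integral>\<^sup>+z. ennreal (norm (case z of (x, t) \<Rightarrow> u (x + t *\<^sub>R h) * indicator {0..1} t * K x t)) \<partial>(lborel \<Otimes>\<^sub>M lborel))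
     \<le> (\<integral>\<^sup>+z. (case z of (x,t) \<Rightarrow> ennreal B * (ennreal \<bar>u (x + t *\<^sub>R h)\<bar> * indicator {0..1} t)) \<partial>(lborel \<Otimes>\<^sub>M lborel))"
  proof (rule nn_integral_mono)
    fix z :: "'a \<times> real"
    obtain x t where z: "z = (x, t)" by (cases z)
    have "\<bar>u (x + t *\<^sub>R h)\<bar> * \<bar>K x t\<bar> \<le> B * \<bar>u (x + t *\<^sub>R h)\<bar>"
      using mult_left_mono[OF K[of x t], of "\<bar>u (x + t *\<^sub>R h)\<bar>"] by (simp add: mult.commute)
    then have "ennreal (\<bar>u (x + t *\<^sub>R h)\<bar> * \<bar>K x t\<bar>) \<le> ennreal B * ennreal \<bar>u (x + t *\<^sub>R h)\<bar>"
      using B by (simp add: ennreal_mult[symmetric] ennreal_leI)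
    then show "ennreal (norm (case z of (x, t) \<Rightarrow> u (x + t *\<^sub>R h) * indicator {0..1} t * K x t))
      \<le> (case z of (x,t) \<Rightarrow> ennreal B * (ennreal \<bar>u (x + t *\<^sub>R h)\<bar> * indicator {0..1} t))"
      unfolding z by (simp add: abs_mult split: split_indicator)
  qed
  also have "\<dots> = (\<integral>\<^sup>+t. \<integral>\<^sup>+x. ennreal B * (ennreal \<bar>u (x + t *\<^sub>R h)\<bar> * indicator {0..1} t) \<partial>lborel \<partial>lborel)"
    by (subst lborel_pair.nn_integral_snd[symmetric]) auto
  also have "\<dots> = (\<integral>\<^sup>+t. ennreal B * (\<integral>\<^sup>+x. ennreal \<bar>u x\<bar> \<partial>lborel) * indicator {0..1::real} t \<partial>lborel)"
  proof (intro nn_integral_cong)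
    fix t :: real
    have "(\<integral>\<^sup>+x. ennreal B * (ennreal \<bar>u (x + t *\<^sub>R h)\<bar> * indicator {0..1} t) \<partial>lborel) =
        ennreal B * ((\<integral>\<^sup>+x. ennreal \<bar>u (x + t *\<^sub>R h)\<bar> \<partial>lborel) * indicator {0..1} t)"
      by (simp add: nn_integral_cmult nn_integral_multc)
    also have "(\<integral>\<^sup>+x. ennreal \<bar>u (x + t *\<^sub>R h)\<bar> \<partial>lborel) = (\<integral>\<^sup>+x. ennreal \<bar>u x\<bar> \<partial>lborel)"
      by (rule nn_integral_lborel_translate) auto
    finally show "(\<integral>\<^sup>+x. ennreal B * (ennreal \<bar>u (x + t *\<^sub>R h)\<bar> * indicator {0..1} t) \<partial>lborel) =
      ennreal B * (\<integral>\<^sup>+x. ennreal \<bar>u x\<bar> \<partial>lborel) * indicator {0..1} t" by (simp add: mult.assoc)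
  qed
  also have "\<dots> < \<infinity>"
    using u by (auto simp: nn_integral_cmult_indicator integrable_iff_bounded ennreal_mult_less_top)
  finally show "(\<integral>\<^sup>+z. ennreal (norm (case z of (x, t) \<Rightarrow> u (x + t *\<^sub>R h) * indicator {0..1} t * K x t)) \<partial>(lborel \<Otimes>\<^sub>M lborel)) < \<infinity>" .
qed

lemma integrable_mult_box_bump:
  fixes u :: "'a::euclidean_space \<Rightarrow> real"
  assumes "integrable lborel u"
  shows "integrable lborel (\<lambda>x. u x * box_bump m a b (x - c))"
proof (rule Bochner_Integration.integrable_bound[OF assms])
  have [measurable]: "box_bump m a b \<in> borel_measurable borel"
    using C_k_box_bump[of 0] by (auto intro: borel_measurable_continuous_onI)
  note [measurable] = borel_measurable_integrable[OF assms]
  show "(\<lambda>x. u x * box_bump m a b (x - c)) \<in> borel_measurable lborel" by measurable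
  show "AE x in lborel. norm (u x * box_bump m a b (x - c)) \<le> norm (u x)"
    using box_bump_bounds[of m a b] by (auto simp: abs_mult intro!: mult_right_le_one_le)
qed

lemma integrable_mult_box_bump_deriv:
  fixes u :: "'a::euclidean_space \<Rightarrow> real"
  assumes "integrable lborel u" "m > 0"
  shows "integrable lborel (\<lambda>x. u x * box_bump_deriv m a b h x)"
proof -
  obtain B where B: "B \<ge> 0" "\<And>x. \<bar>box_bump_deriv m a b h x\<bar> \<le> B"
    using box_bump_deriv_bounded[OF assms(2), of a b h] by blast
  have [measurable]: "box_bump_deriv m a b h \<in> borel_measurable borel"
    by (intro borel_measurable_continuous_onI continuous_box_bump_deriv)
  note [measurable] = borel_measurable_integrable[OF assms(1)]
  show ?thesis
  proof (rule Bochner_Integration.integrable_bound)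
    show "integrable lborel (\<lambda>x. u x * B)" using assms by auto
    show "AE x in lborel. norm (u x * box_bump_deriv m a b h x) \<le> norm (u x * B)"
      using B by (auto simp: abs_mult intro!: mult_left_mono)
  qed measurable
qed

section \<open>Differences along segments in terms of a weak gradient\<close>

context
  fixes G :: "'a::euclidean_space set" and u :: "'a \<Rightarrow> real" and v :: "'a \<Rightarrow> 'a"
  assumes u: "integrable lborel u" and v: "integrable lborel v"
    and weak: "\<And>\<psi> b. test_function G \<psi> \<Longrightarrow> b \<in> Basis \<Longrightarrow>
      (\<integral>x. u x * frechet_derivative \<psi> (at x) b \<partial>lborel) = - (\<integral>x. (v x \<bullet> b) * \<psi> x \<partial>lborel)"
begin

text \<open>The weak identity is given for basis directions only; linearity of the derivative in the
  direction extends it to every \<open>h\<close>.\<close>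

lemma weak_box_bump:
  fixes m :: real
  assumes "cbox a b \<subseteq> G" "m > 0"
  shows "(\<integral>x. u x * box_bump_deriv m a b h x \<partial>lborel) = - (\<integral>x. (v x \<bullet> h) * box_bump m a b x \<partial>lborel)"
proof -
  have vi: "integrable lborel (\<lambda>x. v x \<bullet> i)" for i using v by auto
  have vb: "integrable lborel (\<lambda>x. v x \<bullet> i * box_bump m a b x)" for i 
    using integrable_mult_box_bump[OF vi, where m = m and a = a and b = b and c = 0] by simp
  have "(\<integral>x. u x * box_bump_deriv m a b h x \<partial>lborel) =
      (\<integral>x. (\<Sum>i\<in>Basis. (h \<bullet> i) * (u x * box_bump_deriv m a b i x)) \<partial>lborel)"
    by (subst box_bump_deriv_sum) (simp add: sum_distrib_left mult_ac)
  also have "\<dots> = (\<Sum>i\<in>Basis. (h \<bullet> i) * (\<integral>x. u x * box_bump_deriv m a b i x \<partial>lborel))"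
    using integrable_mult_box_bump_deriv[OF u assms(2)] by (subst Bochner_Integration.integral_sum) auto
  also have "\<dots> = (\<Sum>i\<in>Basis. (h \<bullet> i) * - (\<integral>x. (v x \<bullet> i) * box_bump m a b x \<partial>lborel))"
    using weak[OF test_function_box_bump[OF assms(2,1)]] by (simp add: box_bump_deriv_def)
  also have "\<dots> = - (\<integral>x. (\<Sum>i\<in>Basis. (h \<bullet> i) * ((v x \<bullet> i) * box_bump m a b x)) \<partial>lborel)"
    using vb by (subst Bochner_Integration.integral_sum) (auto simp: sum_negf)
  also have "\<dots> = - (\<integral>x. (v x \<bullet> h) * box_bump m a b x \<partial>lborel)"
  proof -
    have "(\<Sum>i\<in>Basis. (h \<bullet> i) * ((v x \<bullet> i) * box_bump m a b x)) = (v x \<bullet> h) * box_bump m a b x" for x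
      by (subst euclidean_inner[of "v x" h]) (simp add: sum_distrib_left sum_distrib_right algebra_simps)
    then show ?thesis by simp
  qed
  finally show ?thesis .
qed

text \<open>The amount by which the fundamental theorem of calculus fails on the segment from
  \<open>y\<close> to \<open>y + h\<close>. As an integrable function of \<open>y\<close> it can be
  shown to vanish almost everywhere by testing it against bumps, without smoothing
  \<open>u\<close>.\<close>

definition "line_defect h y = u (y + h) - u y - (\<integral>t. indicator {0..1} t * (v (y + t *\<^sub>R h) \<bullet> h) \<partial>lborel)"

lemma line_integral_integrable:
  "integrable lborel (\<lambda>y. \<integral>t. indicator {0..1} t * (v (y + t *\<^sub>R h) \<bullet> h) \<partial>lborel)"
proof -
  have "integrable lborel (\<lambda>x. v x \<bullet> h)" using v by auto
  from integrable_shift_bounded[OF this, of "\<lambda>_ _. 1" 1 h]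
  have "integrable (lborel \<Otimes>\<^sub>M lborel) (\<lambda>(x,t). (v (x + t *\<^sub>R h) \<bullet> h) * indicator {0..1} t)" by auto
  from lborel_pair.integrable_fst[OF this] show ?thesis by (simp add: mult.commute)
qed

lemma line_defect_integrable: "integrable lborel (line_defect h)"
  unfolding line_defect_def
  by (rule Bochner_Integration.integrable_diff[OF Bochner_Integration.integrable_diff[OF
      lborel_integrable_translate[OF u, of h] u] line_integral_integrable[of h]])

text \<open>A change of variables moves the shift from \<open>u\<close> to the bump. The difference
  of the two bumps is a line integral of derivatives; for each \<open>t\<close> the translated bump
  still has its support in \<open>G\<close> by \<open>seg\<close>, so the weak identity applies, and
  translating back produces the gradient on the segment.\<close>

lemma line_defect_box_bump:
  fixes m :: real
  assumes "m > 0" and seg: "\<And>y t. y \<in> cbox a b \<Longrightarrow> t \<in> {0..1} \<Longrightarrow> y + t *\<^sub>R h \<in> G"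
  shows "(\<integral>x. line_defect h x * box_bump m a b x \<partial>lborel) = 0"
proof -
  note [measurable] = borel_measurable_integrable[OF u] borel_measurable_integrable[OF v]
  have [measurable]: "box_bump m a b \<in> borel_measurable borel"
    using C_k_box_bump[of 0] by (auto intro: borel_measurable_continuous_onI)
  have [measurable]: "box_bump_deriv m a b h \<in> borel_measurable borel"
    by (intro borel_measurable_continuous_onI continuous_box_bump_deriv)
  obtain B where B: "B \<ge> 0" "\<And>x. \<bar>box_bump_deriv m a b h x\<bar> \<le> B"
    using box_bump_deriv_bounded[OF assms(1), of a b h] by blast
  have vh: "integrable lborel (\<lambda>x. v x \<bullet> h)" using v by auto
  have ub: "integrable lborel (\<lambda>x. u x * box_bump m a b (x - c))" for c
    by (rule integrable_mult_box_bump[OF u])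
  have uh: "integrable lborel (\<lambda>x. u (x + h) * box_bump m a b x)"
    using lborel_integrable_translate[OF ub[of h], of h] by simp
  have lb: "integrable lborel (\<lambda>x. (\<integral>t. indicator {0..1} t * (v (x + t *\<^sub>R h) \<bullet> h) \<partial>lborel) * box_bump m a b x)"
    using integrable_mult_box_bump[OF line_integral_integrable, where m = m and a = a and b = b and c = 0] by simp
  have "(\<integral>x. u (x + h) * box_bump m a b x \<partial>lborel) - (\<integral>x. u x * box_bump m a b x \<partial>lborel) =
     (\<integral>x. u x * box_bump m a b (x - h) \<partial>lborel) - (\<integral>x. u x * box_bump m a b x \<partial>lborel)"
    using lborel_integral_translate[of "\<lambda>x. u x * box_bump m a b (x - h)" h] by simp
  also have "\<dots> = (\<integral>x. u x * (box_bump m a b (x - h) - box_bump m a b x) \<partial>lborel)"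
    using ub[of h] ub[of 0] by (simp add: right_diff_distrib)
  also have "\<dots> = (\<integral>x. (\<integral>t. u x * indicator {0..1} t * (- box_bump_deriv m a b h (x - t *\<^sub>R h)) \<partial>lborel) \<partial>lborel)"
    unfolding box_bump_line_integral by (simp add: mult.assoc)
  also have "\<dots> = (\<integral>t. (\<integral>x. u x * indicator {0..1} t * (- box_bump_deriv m a b h (x - t *\<^sub>R h)) \<partial>lborel) \<partial>lborel)"
    using integrable_shift_bounded[OF u, of "\<lambda>x t. - box_bump_deriv m a b h (x - t *\<^sub>R h)" B 0] B
    by (intro lborel_pair.Fubini_integral[symmetric]) simp
  also have "\<dots> = (\<integral>t. (\<integral>x. (v (x + t *\<^sub>R h) \<bullet> h) * indicator {0..1} t * box_bump m a b x \<partial>lborel) \<partial>lborel)"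
  proof (rule Bochner_Integration.integral_cong[OF refl])
    fix t :: real
    show "(\<integral>x. u x * indicator {0..1} t * (- box_bump_deriv m a b h (x - t *\<^sub>R h)) \<partial>lborel) =
      (\<integral>x. (v (x + t *\<^sub>R h) \<bullet> h) * indicator {0..1} t * box_bump m a b x \<partial>lborel)"
    proof (cases "t \<in> {0..1}")
      case True
      have "cbox (a + t *\<^sub>R h) (b + t *\<^sub>R h) \<subseteq> G"
      proof
        fix y assume "y \<in> cbox (a + t *\<^sub>R h) (b + t *\<^sub>R h)"
        then have "y - t *\<^sub>R h \<in> cbox a b" by (auto simp: mem_box algebra_simps)
        from seg[OF this True] show "y \<in> G" by simp
      qed
      from weak_box_bump[OF this assms(1), of h]
      have "(\<integral>x. u x * (- box_bump_deriv m a b h (x - t *\<^sub>R h)) \<partial>lborel) = (\<integral>x. (v x \<bullet> h) * box_bump m a b (x - t *\<^sub>R h) \<partial>lborel)"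
        by (simp add: box_bump_deriv_translate box_bump_translate)
      also have "\<dots> = (\<integral>x. (v (x + t *\<^sub>R h) \<bullet> h) * box_bump m a b x \<partial>lborel)"
        using lborel_integral_translate[of "\<lambda>x. (v x \<bullet> h) * box_bump m a b (x - t *\<^sub>R h)" "t *\<^sub>R h"] by simp
      finally show ?thesis using True by simp
    qed simp
  qed
  also have "\<dots> = (\<integral>x. (\<integral>t. (v (x + t *\<^sub>R h) \<bullet> h) * indicator {0..1} t * box_bump m a b x \<partial>lborel) \<partial>lborel)"
    using integrable_shift_bounded[OF vh, of "\<lambda>x t. box_bump m a b x" 1 h] box_bump_bounds[of m a b]
    by (intro lborel_pair.Fubini_integral) simp
  also have "\<dots> = (\<integral>x. (\<integral>t. indicator {0..1} t * (v (x + t *\<^sub>R h) \<bullet> h) \<partial>lborel) * box_bump m a b x \<partial>lborel)"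
  proof (rule Bochner_Integration.integral_cong[OF refl])
    fix x :: 'a
    show "(\<integral>t. (v (x + t *\<^sub>R h) \<bullet> h) * indicator {0..1} t * box_bump m a b x \<partial>lborel) =
      (\<integral>t. indicator {0..1} t * (v (x + t *\<^sub>R h) \<bullet> h) \<partial>lborel) * box_bump m a b x"
      by (subst Bochner_Integration.integral_mult_left_zero) (simp only: mult.commute)
  qed
  finally have "(\<integral>x. u (x + h) * box_bump m a b x \<partial>lborel) - (\<integral>x. u x * box_bump m a b x \<partial>lborel)
     - (\<integral>x. (\<integral>t. indicator {0..1} t * (v (x + t *\<^sub>R h) \<bullet> h) \<partial>lborel) * box_bump m a b x \<partial>lborel) = 0"
    by simp
  moreover have "(\<integral>x. u (x + h) * box_bump m a b x - u x * box_bump m a b x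
     - (\<integral>t. indicator {0..1} t * (v (x + t *\<^sub>R h) \<bullet> h) \<partial>lborel) * box_bump m a b x \<partial>lborel) = 
     (\<integral>x. u (x + h) * box_bump m a b x \<partial>lborel) - (\<integral>x. u x * box_bump m a b x \<partial>lborel)
     - (\<integral>x. (\<integral>t. indicator {0..1} t * (v (x + t *\<^sub>R h) \<bullet> h) \<partial>lborel) * box_bump m a b x \<partial>lborel)"
    using uh ub[of 0] lb by (subst Bochner_Integration.integral_diff, simp, simp)+ simp
  ultimately show ?thesis
    unfolding line_defect_def left_diff_distrib by simp
qed

text \<open>Bumps converge boundedly to box indicators, so dominated convergence carries the
  vanishing of the integrals over to boxes.\<close>

lemma line_defect_AE_0:
  assumes "open U" and seg: "\<And>y t. y \<in> U \<Longrightarrow> t \<in> {0..1} \<Longrightarrow> y + t *\<^sub>R h \<in> G"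
  shows "AE x in lborel. x \<in> U \<longrightarrow> line_defect h x = 0"
proof (rule AE_eq_0_of_box_integrals[OF line_defect_integrable assms(1)])
  fix a b assume ab: "cbox a b \<subseteq> U"
  note [measurable] = borel_measurable_integrable[OF line_defect_integrable]
  have [measurable]: "box_bump m a b \<in> borel_measurable borel" for m
    using C_k_box_bump[of 0] by (auto intro: borel_measurable_continuous_onI)
  have "(\<lambda>k. \<integral>x. box_bump (real (Suc k)) a b x * line_defect h x \<partial>lborel) \<longlonglongrightarrow> (\<integral>x. indicator (box a b) x * line_defect h x \<partial>lborel)"
  proof (rule integral_dominated_convergence[where w = "\<lambda>x. norm (line_defect h x)"])
    show "integrable lborel (\<lambda>x. norm (line_defect h x))" using line_defect_integrable by auto
    show "AE x in lborel. norm (box_bump (real (Suc k)) a b x * line_defect h x) \<le> norm (line_defect h x)" for k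
      using box_bump_bounds[of "real (Suc k)" a b] by (auto simp: abs_mult intro!: mult_left_le_one_le)
  qed (auto intro!: tendsto_intros box_bump_tendsto simp del: of_nat_Suc)
  moreover have "(\<integral>x. box_bump (real (Suc k)) a b x * line_defect h x \<partial>lborel) = 0" for k
    using line_defect_box_bump[of "real (Suc k)" a b h] ab seg by (auto simp: mult.commute)
  ultimately show "(\<integral>x. indicator (box a b) x * line_defect h x \<partial>lborel) = 0"
    by (simp only: LIMSEQ_const_iff)
qed

text \<open>The null set depends on \<open>h\<close>; \<open>controlled_of_weak_gradient\<close>
  later exchanges the two quantifiers by Fubini.\<close>

lemma weak_difference:
  assumes "open U" and seg: "\<And>y t. y \<in> U \<Longrightarrow> t \<in> {0..1} \<Longrightarrow> y + t *\<^sub>R h \<in> G"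
  shows "AE x in lborel. x \<in> U \<longrightarrow>
    ennreal \<bar>u (x + h) - u x\<bar> \<le> (\<integral>\<^sup>+t\<in>{0..1}. ennreal (norm h * norm (v (x + t *\<^sub>R h))) \<partial>lborel)"
proof -
  have "AE x in lborel. x \<in> U \<longrightarrow> line_defect h x = 0"
    using assms by (rule line_defect_AE_0)
  then show ?thesis
  proof eventually_elim
    case (elim x)
    note [measurable] = borel_measurable_integrable[OF u] borel_measurable_integrable[OF v]
    show ?case
    proof
      assume "x \<in> U"
      have CS: "\<bar>v y \<bullet> h\<bar> \<le> norm h * norm (v y)" for y
        by (metis Cauchy_Schwarz_ineq2 mult.commute)
      have "u (x + h) - u x = (\<integral>t. indicator {0..1} t * (v (x + t *\<^sub>R h) \<bullet> h) \<partial>lborel)"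
        using elim \<open>x \<in> U\<close> by (simp add: line_defect_def)
      then have "ennreal \<bar>u (x + h) - u x\<bar> = ennreal (norm (\<integral>t. indicator {0..1} t * (v (x + t *\<^sub>R h) \<bullet> h) \<partial>lborel))"
        by simp
      also have "\<dots> \<le> (\<integral>\<^sup>+t. ennreal (norm (indicator {0..1} t * (v (x + t *\<^sub>R h) \<bullet> h))) \<partial>lborel)"
        by (rule norm_integral_le_nn_integral)
      also have "\<dots> \<le> (\<integral>\<^sup>+t\<in>{0..1}. ennreal (norm h * norm (v (x + t *\<^sub>R h))) \<partial>lborel)"
        using CS by (intro nn_integral_mono) (auto split: split_indicator intro!: ennreal_leI simp: mult.commute)
      finally show "ennreal \<bar>u (x + h) - u x\<bar> \<le> (\<integral>\<^sup>+t\<in>{0..1}. ennreal (norm h * norm (v (x + t *\<^sub>R h))) \<partial>lborel)" .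
    qed
  qed
qed

end

section \<open>Arc length\<close>

text \<open>Recursive counterpart of the sum in \<open>curve_length\<close>, so that facts about
  partitions can be proved by induction on the list.\<close>

fun polygon_length :: "(real \<Rightarrow> 'a::metric_space) \<Rightarrow> real list \<Rightarrow> real" where
  "polygon_length g (x # y # ts) = dist (g x) (g y) + polygon_length g (y # ts)"
| "polygon_length g ts = 0"

lemma polygon_length_nonneg [simp]: "0 \<le> polygon_length g ts"
  by (induction g ts rule: polygon_length.induct) auto

lemma polygon_length_eq_sum:
  "(\<Sum>i<length ts - 1. dist (g (ts ! i)) (g (ts ! Suc i))) = polygon_length g ts"
  by (induction g ts rule: polygon_length.induct) (auto simp: sum.lessThan_Suc_shift simp del: sum.lessThan_Suc)

lemma curve_length_eq:
  "curve_length g a b = (SUP ts \<in> {ts. sorted ts \<and> set ts \<subseteq> {a..b}}. ennreal (polygon_length g ts))"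
  unfolding curve_length_def polygon_length_eq_sum ..

lemma polygon_length_le_curve_length:
  assumes "sorted ts" "set ts \<subseteq> {a..b}"
  shows "ennreal (polygon_length g ts) \<le> curve_length g a b"
  unfolding curve_length_eq using assms by (intro SUP_upper) auto

lemma polygon_length_append_ge:
  "polygon_length g xs + polygon_length g ys \<le> polygon_length g (xs @ ys)"
proof (induction g xs rule: polygon_length.induct)
  case ("2_2" g v)
  then show ?case by (cases ys) auto
qed auto

lemma polygon_length_insert:
  "polygon_length g (xs @ ys) \<le> polygon_length g (xs @ [b]) + polygon_length g (b # ys)"
proof (induction g xs rule: polygon_length.induct)
  case ("2_1" g)
  then show ?case by (cases ys) auto
next
  case ("2_2" g v)
  then show ?case by (cases ys) (auto simp: dist_triangle)
qed auto

lemma SUP_add_SUP_le: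
  fixes f :: "'i \<Rightarrow> ennreal" and h :: "'j \<Rightarrow> ennreal"
  assumes "I \<noteq> {}" "J \<noteq> {}" "\<And>i j. i \<in> I \<Longrightarrow> j \<in> J \<Longrightarrow> f i + h j \<le> c"
  shows "(SUP i\<in>I. f i) + (SUP j\<in>J. h j) \<le> c"
proof -
  have "(SUP i\<in>I. f i) + (SUP j\<in>J. h j) = (SUP i\<in>I. f i + (SUP j\<in>J. h j))"
    by (rule ennreal_SUP_add_left[OF assms(1), symmetric])
  also have "\<dots> = (SUP i\<in>I. SUP j\<in>J. f i + h j)"
    by (simp only: ennreal_SUP_add_right[OF assms(2)])
  also have "\<dots> \<le> c" using assms(3) by (intro SUP_least)
  finally show ?thesis .
qed

text \<open>Partitions may repeat a point. A run of equal points has no length, so the polygon has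
  in effect at most one intermediate vertex.\<close>

lemma polygon_length_const:
  assumes "\<forall>x\<in>set xs. x = c"
  shows "polygon_length g (s # xs @ [t]) \<le> dist (g s) (g c) + dist (g c) (g t)"
  using assms
proof (induction xs arbitrary: s)
  case Nil
  then show ?case by (auto simp: dist_triangle)
next
  case (Cons x xs)
  then show ?case using Cons.IH[of x] by simp
qed

lemma sorted_split:
  fixes ts :: "real list"
  assumes "sorted ts"
  obtains xs ys where "ts = xs @ ys" "sorted xs" "sorted ys" "\<forall>x\<in>set xs. x \<le> b" "\<forall>y\<in>set ys. b < y"
proof -
  define xs where "xs = takeWhile (\<lambda>x. x \<le> b) ts"
  define ys where "ys = dropWhile (\<lambda>x. x \<le> b) ts"
  have e: "ts = xs @ ys" by (simp add: xs_def ys_def)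
  have s: "sorted xs" "sorted ys" using assms unfolding e by (auto simp: sorted_append)
  have "\<forall>y\<in>set ys. b < y"
  proof (cases ys)
    case (Cons y zs)
    have "\<not> hd ys \<le> b" using Cons hd_dropWhile[of "\<lambda>x. x \<le> b" ts] unfolding ys_def by simp
    then show ?thesis using Cons s(2) by auto
  qed auto
  moreover have "\<forall>x\<in>set xs. x \<le> b" unfolding xs_def by (auto dest: set_takeWhileD)
  ultimately show ?thesis using that e s by blast
qed

text \<open>Inserting \<open>b\<close> into a partition does not decrease its length, which gives
  one inequality; concatenating partitions of the two halves gives the other.\<close>

lemma curve_length_additive:
  assumes "a \<le> b" "b \<le> c"
  shows "curve_length g a c = curve_length g a b + curve_length g b c"
proof (rule antisym)
  show "curve_length g a c \<le> curve_length g a b + curve_length g b c"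
    unfolding curve_length_eq[of g a c]
  proof (rule SUP_least, clarify)
    fix ts :: "real list" assume ts: "sorted ts" "set ts \<subseteq> {a..c}"
    obtain xs ys where xy: "ts = xs @ ys" "sorted xs" "sorted ys" "\<forall>x\<in>set xs. x \<le> b" "\<forall>y\<in>set ys. b < y"
      using sorted_split[OF ts(1), of b] by blast
    have "ennreal (polygon_length g ts) \<le> ennreal (polygon_length g (xs @ [b]) + polygon_length g (b # ys))"
      unfolding xy using polygon_length_insert by (intro ennreal_leI)
    also have "\<dots> = ennreal (polygon_length g (xs @ [b])) + ennreal (polygon_length g (b # ys))"
      by (rule ennreal_plus) auto
    also have "\<dots> \<le> curve_length g a b + curve_length g b c"
      using xy ts assms by (intro add_mono polygon_length_le_curve_length) (auto simp: sorted_append less_imp_le)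
    finally show "ennreal (polygon_length g ts) \<le> curve_length g a b + curve_length g b c" .
  qed
  have ne: "{ts. sorted ts \<and> set ts \<subseteq> {x..y}} \<noteq> {}" for x y :: real
    by (auto intro!: exI[of _ "[]"])
  show "curve_length g a b + curve_length g b c \<le> curve_length g a c"
    unfolding curve_length_eq[of g a b] curve_length_eq[of g b c]
  proof (rule SUP_add_SUP_le[OF ne ne])
    fix us ts :: "real list"
    assume "us \<in> {us. sorted us \<and> set us \<subseteq> {b..c}}" "ts \<in> {ts. sorted ts \<and> set ts \<subseteq> {a..b}}"
    then have us: "sorted us" "set us \<subseteq> {b..c}" and ts: "sorted ts" "set ts \<subseteq> {a..b}" by auto
    have "ennreal (polygon_length g ts) + ennreal (polygon_length g us) = ennreal (polygon_length g ts + polygon_length g us)"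
      by (simp add: ennreal_plus)
    also have "\<dots> \<le> ennreal (polygon_length g (ts @ us))"
      by (intro ennreal_leI polygon_length_append_ge)
    also have "\<dots> \<le> curve_length g a c"
      using us ts assms by (intro polygon_length_le_curve_length) (force simp: sorted_append subset_iff)+
    finally show "ennreal (polygon_length g ts) + ennreal (polygon_length g us) \<le> curve_length g a c" .
  qed
qed

lemma dist_le_curve_length:
  assumes "s \<le> t"
  shows "ennreal (dist (g s) (g t)) \<le> curve_length g s t"
  using polygon_length_le_curve_length[of "[s,t]" s t g] assms by simp

text \<open>This is the continuity of arc length. Fix a partition whose length is within
  \<open>e / 2\<close> of the total. An interval shorter than its smallest gap contains at most one
  of its points, and by uniform continuity the polygon spends at most \<open>e / 2\<close> there.
  Everything else is bounded by the length outside the interval, so at most \<open>e\<close> is left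
  for the interval itself.\<close>

lemma curve_length_small:
  assumes "rectifiable_path g" "e > 0"
  obtains \<delta> where "\<delta> > 0" "\<And>s t. \<lbrakk>0 \<le> s; s \<le> t; t \<le> 1; t - s < \<delta>\<rbrakk> \<Longrightarrow> curve_length g s t \<le> ennreal e"
proof -
  have fin: "curve_length g 0 1 < \<infinity>" and cont: "continuous_on {0..1} g"
    using assms by (auto simp: rectifiable_path_def path_def)
  have "uniformly_continuous_on {0..1} g"
    using cont compact_uniformly_continuous by auto
  then obtain d1 where d1: "d1 > 0" "\<And>s t. s \<in> {0..1} \<Longrightarrow> t \<in> {0..1} \<Longrightarrow> dist t s < d1 \<Longrightarrow> dist (g t) (g s) < e / 4"
    unfolding uniformly_continuous_on_def using assms(2) by (metis zero_less_divide_iff zero_less_numeral)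
  have "\<exists>ts. (sorted ts \<and> set ts \<subseteq> {0..1}) \<and> curve_length g 0 1 < ennreal (polygon_length g ts) + ennreal (e / 2)"
  proof (rule ccontr)
    assume "\<nexists>ts. (sorted ts \<and> set ts \<subseteq> {0..1}) \<and> curve_length g 0 1 < ennreal (polygon_length g ts) + ennreal (e / 2)"
    then have le: "ennreal (polygon_length g ts) + ennreal (e / 2) \<le> curve_length g 0 1"
      if "sorted ts" "set ts \<subseteq> {0..1}" for ts using that by (meson not_le)
    have ne: "{ts. sorted ts \<and> set ts \<subseteq> {0..1::real}} \<noteq> {}"
      by (auto intro!: exI[of _ "[]"])
    have "curve_length g 0 1 + ennreal (e / 2) \<le> curve_length g 0 1"
      unfolding curve_length_eq[of g 0 1]
      by (subst ennreal_SUP_add_left[OF ne, symmetric], rule SUP_least) (use le in \<open>auto simp: curve_length_eq\<close>)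
    then show False using fin assms(2)
      by (cases "curve_length g 0 1") (auto simp: ennreal_plus[symmetric] simp del: ennreal_plus)
  qed
  then obtain ts where ts: "sorted ts" "set ts \<subseteq> {0..1}"
    "curve_length g 0 1 < ennreal (polygon_length g ts) + ennreal (e / 2)" by auto
  \<comment> \<open>Inserting 1 keeps the minimum of the gaps meaningful when the partition has
    fewer than two distinct points.\<close>
  define D where "D = insert 1 ((\<lambda>(x,y). \<bar>x - y\<bar>) ` {(x,y) \<in> set ts \<times> set ts. x \<noteq> y})"
  have D: "finite D" "D \<noteq> {}" by (auto simp: D_def intro: finite_subset[of _ "set ts \<times> set ts"])
  define d2 where "d2 = Min D"
  have d2: "d2 > 0" unfolding d2_def using D by (auto simp: D_def)
  have sep: "x = y" if "x \<in> set ts" "y \<in> set ts" "\<bar>x - y\<bar> < d2" for x y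
  proof (rule ccontr)
    assume "x \<noteq> y"
    then have "\<bar>x - y\<bar> \<in> D" using that by (auto simp: D_def)
    then show False using that D by (auto simp: d2_def)
  qed
  show thesis
  proof (rule that[of "min d1 d2"])
    show "min d1 d2 > 0" using d1 d2 by auto
    fix s t :: real assume st: "0 \<le> s" "s \<le> t" "t \<le> 1" "t - s < min d1 d2"
    obtain ts1 ts' where a: "ts = ts1 @ ts'" "sorted ts1" "sorted ts'" "\<forall>x\<in>set ts1. x \<le> s" "\<forall>y\<in>set ts'. s < y"
      using sorted_split[OF ts(1), of s] by blast
    obtain ts2 ts3 where b: "ts' = ts2 @ ts3" "sorted ts2" "sorted ts3" "\<forall>x\<in>set ts2. x \<le> t" "\<forall>y\<in>set ts3. t < y"
      using sorted_split[OF a(3), of t] by blast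
    \<comment> \<open>When no partition point lies in the interval, \<open>s\<close> itself serves
      as the intermediate vertex.\<close>
    define c where "c = (if ts2 = [] then s else hd ts2)"
    have c: "c \<in> {s..t}" using a b st by (auto simp: c_def less_imp_le)
    have const: "\<forall>x\<in>set ts2. x = c"
    proof
      fix x assume x: "x \<in> set ts2"
      have "hd ts2 \<in> set ts2" using x by (intro hd_in_set) auto
      then have "hd ts2 \<in> {s..t}" "x \<in> {s..t}" using x a b by (auto simp: less_imp_le)
      then have "\<bar>x - hd ts2\<bar> < d2" using st by auto
      then show "x = c" using sep[of x "hd ts2"] x a b \<open>hd ts2 \<in> set ts2\<close> by (auto simp: c_def)
    qed
    have "dist (g s) (g c) < e/4" "dist (g c) (g t) < e/4"
      using c st d1(2)[of s c] d1(2)[of c t] by (auto simp: dist_commute dist_real_def)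
    then have mid: "polygon_length g (s # ts2 @ [t]) \<le> e/2"
      using polygon_length_const[OF const, of g s t] by linarith
    have "polygon_length g ts \<le> polygon_length g (ts1 @ [s]) + polygon_length g (s # ts2 @ ts3)"
      unfolding a b by (rule polygon_length_insert)
    also have "polygon_length g (s # ts2 @ ts3) \<le> polygon_length g (s # ts2 @ [t]) + polygon_length g (t # ts3)"
      using polygon_length_insert[of g "s # ts2" ts3 t] by simp
    finally have "polygon_length g ts \<le> e/2 + polygon_length g (ts1 @ [s]) + polygon_length g (t # ts3)"
      using mid by linarith
    then have "ennreal (polygon_length g ts) \<le> ennreal (e/2) + ennreal (polygon_length g (ts1 @ [s])) + ennreal (polygon_length g (t # ts3))"
      using assms(2) by (subst ennreal_plus[symmetric], auto simp: ennreal_plus[symmetric] simp del: ennreal_plus intro!: ennreal_leI)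
    also have "\<dots> \<le> ennreal (e/2) + curve_length g 0 s + curve_length g t 1"
    proof (intro add_mono order_refl polygon_length_le_curve_length)
      show "sorted (ts1 @ [s])" "set (ts1 @ [s]) \<subseteq> {0..s}" using a ts st by (auto simp: sorted_append)
      show "sorted (t # ts3)" "set (t # ts3) \<subseteq> {t..1}" using a b ts st by (auto simp: less_imp_le)
    qed
    finally have le: "curve_length g 0 1 \<le> ennreal (e/2) + curve_length g 0 s + curve_length g t 1 + ennreal (e/2)"
      using ts(3) by (meson add_right_mono less_imp_le order_trans)
    have eq: "curve_length g 0 1 = curve_length g 0 s + (curve_length g s t + curve_length g t 1)"
      using st by (simp add: curve_length_additive[of 0 s 1] curve_length_additive[of s t 1])
    have f: "curve_length g 0 s < \<infinity>" "curve_length g s t < \<infinity>" "curve_length g t 1 < \<infinity>"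
      using fin unfolding eq by (auto simp: less_top)
    obtain x y z where "curve_length g 0 s = ennreal x" "curve_length g s t = ennreal y" "curve_length g t 1 = ennreal z"
      "x \<ge> 0" "y \<ge> 0" "z \<ge> 0"
      using f by (metis ennreal_cases infinity_ennreal_def less_irrefl)
    then show "curve_length g s t \<le> ennreal e"
      using le assms(2) unfolding eq by (simp add: ennreal_plus[symmetric] del: ennreal_plus)
  qed
qed

text \<open>The arc length \<open>l\<close> is continuous with \<open>l 0 = 0\<close> and
  \<open>l 1 = L\<close>, so every value in between is attained. Distances on the curve are bounded
  by differences of \<open>l\<close>; hence parameters with the same arc length give the same point,
  and the choice made in \<open>arc_length_param\<close> is harmless.\<close>

lemma arc_length_parametrization:
  assumes "rectifiable_path g"
  defines "L \<equiv> enn2real (curve_length g 0 1)"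
  shows "0 \<le> L"
    and "arc_length_param g 0 = pathstart g"
    and "arc_length_param g L = pathfinish g"
    and "\<And>s. s \<in> {0..L} \<Longrightarrow> arc_length_param g s \<in> path_image g"
    and "\<And>s t. s \<in> {0..L} \<Longrightarrow> t \<in> {0..L} \<Longrightarrow> dist (arc_length_param g s) (arc_length_param g t) \<le> \<bar>s - t\<bar>"
proof -
  have fin: "curve_length g 0 1 < \<infinity>" using assms by (auto simp: rectifiable_path_def)
  define l where "l t = enn2real (curve_length g 0 t)" for t
  have fin': "curve_length g s t < \<infinity>" if "0 \<le> s" "s \<le> t" "t \<le> 1" for s t
  proof -
    have "curve_length g 0 1 = curve_length g 0 s + (curve_length g s t + curve_length g t 1)"
      using that by (simp add: curve_length_additive[of 0 s 1] curve_length_additive[of s t 1])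
    then show ?thesis using fin by (auto simp: less_top)
  qed
  have l: "curve_length g 0 t = ennreal (l t)" if "t \<in> {0..1}" for t
    using fin'[of 0 t] that by (auto simp: l_def less_top)
  have l_nn: "l t \<ge> 0" for t by (simp add: l_def)
  have l_add: "curve_length g s t = ennreal (l t - l s)" "l s \<le> l t" if "0 \<le> s" "s \<le> t" "t \<le> 1" for s t
  proof -
    have "curve_length g s t < \<infinity>" using fin'[OF that] .
    then obtain y where y: "curve_length g s t = ennreal y" "y \<ge> 0"
      by (cases "curve_length g s t") auto
    have "ennreal (l t) = ennreal (l s + y)"
      using curve_length_additive[of 0 s t g] that l[of s] l[of t] y l_nn[of s] by simp
    then have "l t = l s + y" using l_nn y by (metis add_nonneg_nonneg ennreal_inj)
    then show "curve_length g s t = ennreal (l t - l s)" "l s \<le> l t" using y by auto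
  qed
  have dist_l: "dist (g s) (g t) \<le> \<bar>l t - l s\<bar>" if "s \<in> {0..1}" "t \<in> {0..1}" for s t
  proof -
    have "dist (g s) (g t) \<le> l t - l s" if "0 \<le> s" "s \<le> t" "t \<le> 1" for s t
      using dist_le_curve_length[OF that(2), of g] l_add[OF that] by (simp add: ennreal_le_iff)
    from this[of s t] this[of t s] that show ?thesis
      by (cases "s \<le> t") (auto simp: dist_commute)
  qed
  have cont: "continuous_on {0..1} l"
    unfolding continuous_on_iff
  proof (intro ballI allI impI)
    fix x e :: real assume "x \<in> {0..1}" "0 < e"
    obtain \<delta> where \<delta>: "\<delta> > 0" "\<And>s t. \<lbrakk>0 \<le> s; s \<le> t; t \<le> 1; t - s < \<delta>\<rbrakk> \<Longrightarrow> curve_length g s t \<le> ennreal (e/2)"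
      using curve_length_small[OF assms(1), of "e/2"] \<open>0 < e\<close> by auto
    have *: "\<bar>l t - l s\<bar> < e" if "0 \<le> s" "s \<le> t" "t \<le> 1" "t - s < \<delta>" for s t
    proof -
      have "ennreal (l t - l s) \<le> ennreal (e/2)"
        using \<delta>(2)[OF that] l_add(1)[OF that(1-3)] by simp
      then show ?thesis using l_add(2)[OF that(1-3)] \<open>0 < e\<close> by (simp add: ennreal_le_iff)
    qed
    show "\<exists>d>0. \<forall>x'\<in>{0..1}. dist x' x < d \<longrightarrow> dist (l x') (l x) < e"
    proof (intro exI[of _ \<delta>] conjI ballI impI \<delta>)
      fix x' assume "x' \<in> {0..1}" "dist x' x < \<delta>"
      then show "dist (l x') (l x) < e"
        using *[of x x'] *[of x' x] \<open>x \<in> {0..1}\<close>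
        by (cases "x \<le> x'") (auto simp: dist_real_def abs_minus_commute)
    qed
  qed
  have l0: "l 0 = 0" using l_add(1)[of 0 0] l[of 0] l_nn by simp
  have l1: "l 1 = L" by (simp add: l_def L_def)
  have ex: "\<exists>t. t \<in> {0..1} \<and> curve_length g 0 t = ennreal s" if "s \<in> {0..L}" for s
  proof -
    have "\<exists>t\<ge>0. t \<le> 1 \<and> l t = s"
      using that l0 l1 by (intro IVT' cont) auto
    then show ?thesis using l by auto
  qed
  define T where "T s = (SOME t. t \<in> {0..1} \<and> curve_length g 0 t = ennreal s)" for s
  have T: "T s \<in> {0..1}" "l (T s) = s" if "s \<in> {0..L}" for s
  proof -
    have "T s \<in> {0..1} \<and> curve_length g 0 (T s) = ennreal s"
      unfolding T_def by (rule someI_ex[OF ex[OF that]])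
    then show "T s \<in> {0..1}" "l (T s) = s" using that by (auto simp: l_def)
  qed
  have al: "arc_length_param g s = g (T s)" for s by (simp add: arc_length_param_def T_def)
  show L: "0 \<le> L" by (simp add: L_def)
  show "arc_length_param g 0 = pathstart g"
    using dist_l[of 0 "T 0"] T[of 0] l0 L by (simp add: al pathstart_def)
  show "arc_length_param g L = pathfinish g"
    using dist_l[of 1 "T L"] T[of L] l1 L by (simp add: al pathfinish_def)
  show "\<And>s. s \<in> {0..L} \<Longrightarrow> arc_length_param g s \<in> path_image g"
    using T by (auto simp: al path_image_def)
  show "dist (arc_length_param g s) (arc_length_param g t) \<le> \<bar>s - t\<bar>" if "s \<in> {0..L}" "t \<in> {0..L}" for s t
    using dist_l[of "T s" "T t"] T[OF that(1)] T[OF that(2)] by (simp add: al abs_minus_commute)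
qed


section \<open>Chains of steps of relative length at most \<kappa> in place of curves\<close>

definition step_rel :: "real \<Rightarrow> 'a::metric_space set \<Rightarrow> ('a \<times> 'a) set" where
  "step_rel \<kappa> G = {(x, y). x \<in> G \<and> y \<in> G \<and> dist x y \<le> \<kappa> * infdist x (frontier G)}"

lemma infdist_Lipschitz: "\<bar>infdist x A - infdist y A\<bar> \<le> dist x y"
  using infdist_triangle[of x A y] infdist_triangle[of y A x] by (auto simp: dist_commute)

text \<open>Jump along the curve by \<kappa> times the current boundary distance. During a jump that
  distance is at most \<open>1 + \<kappa>\<close> times its initial value, so each jump uses up at
  least \<open>\<kappa> / (1 + \<kappa>)\<close> of the integral. The extra step in
  \<open>Suc n\<close> is the last, incomplete jump.\<close>

lemma chain_of_Lipschitz_curve: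
  fixes \<gamma> :: "real \<Rightarrow> 'a::metric_space"
  assumes "0 < \<kappa>" and pos: "\<And>x. x \<in> G \<Longrightarrow> 0 < infdist x (frontier G)"
    and G: "\<And>s. \<gamma> s \<in> G" and lip: "\<And>s t. dist (\<gamma> s) (\<gamma> t) \<le> \<bar>s - t\<bar>"
    and "a \<le> L"
    and "(\<integral>\<^sup>+s\<in>{a..L}. ennreal (1 / infdist (\<gamma> s) (frontier G)) \<partial>lborel) \<le> ennreal (real n * (\<kappa> / (1 + \<kappa>)))"
  shows "\<exists>m\<le>Suc n. (\<gamma> a, \<gamma> L) \<in> step_rel \<kappa> G ^^ m"
  using assms(5,6)
proof (induction n arbitrary: a)
  define f where "f s = ennreal (1 / infdist (\<gamma> s) (frontier G))" for s
  have cont: "continuous_on UNIV \<gamma>"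
    unfolding continuous_on_iff using lip by (metis UNIV_I dist_real_def order_le_less_trans dist_commute)
  have "continuous_on UNIV (\<lambda>s. 1 / infdist (\<gamma> s) (frontier G))"
    using pos G by (intro continuous_intros cont) (metis less_irrefl)
  then have [measurable]: "(\<lambda>s. 1 / infdist (\<gamma> s) (frontier G)) \<in> borel_measurable borel"
    by (rule borel_measurable_continuous_onI)
  have f[measurable]: "f \<in> borel_measurable lborel"
    unfolding f_def by measurable
  have one: "(\<gamma> a, \<gamma> L) \<in> step_rel \<kappa> G ^^ 1" if "a \<le> L" "L - a \<le> \<kappa> * infdist (\<gamma> a) (frontier G)" for a
    using lip[of a L] that G by (auto simp: step_rel_def)
  have step: "(\<gamma> a, \<gamma> (a + \<kappa> * infdist (\<gamma> a) (frontier G))) \<in> step_rel \<kappa> G" for a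
    using lip[of a "a + \<kappa> * infdist (\<gamma> a) (frontier G)"] G \<open>0 < \<kappa>\<close> by (auto simp: step_rel_def infdist_nonneg)
  have split: "ennreal (\<kappa> / (1 + \<kappa>)) + (\<integral>\<^sup>+s\<in>{a'..L}. f s \<partial>lborel) \<le> (\<integral>\<^sup>+s\<in>{a..L}. f s \<partial>lborel)"
    if "a' = a + \<kappa> * infdist (\<gamma> a) (frontier G)" "a' < L" for a a'
  proof -
    define D where "D = infdist (\<gamma> a) (frontier G)"
    have D: "D > 0" using pos G by (simp add: D_def)
    have a': "a < a'" using that D \<open>0 < \<kappa>\<close> by (simp add: D_def)
    have "\<kappa> / (1 + \<kappa>) = 1 / ((1 + \<kappa>) * D) * (a' - a)"
      using D by (simp add: that(1) D_def)
    then have "ennreal (\<kappa> / (1 + \<kappa>)) = (\<integral>\<^sup>+s. ennreal (1 / ((1 + \<kappa>) * D)) * indicator {a..<a'} s \<partial>lborel)"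
      using a' D \<open>0 < \<kappa>\<close> by (simp only:) (subst nn_integral_cmult_indicator; simp add: ennreal_mult[symmetric])
    also have "\<dots> \<le> (\<integral>\<^sup>+s. f s * indicator {a..<a'} s \<partial>lborel)"
    proof (intro nn_integral_mono)
      fix s
      show "ennreal (1 / ((1 + \<kappa>) * D)) * indicator {a..<a'} s \<le> f s * indicator {a..<a'} s"
      proof (cases "s \<in> {a..<a'}")
        case True
        have "infdist (\<gamma> s) (frontier G) \<le> D + dist (\<gamma> s) (\<gamma> a)"
          using infdist_Lipschitz[of "\<gamma> s" "frontier G" "\<gamma> a"] by (simp add: D_def)
        also have "\<dots> \<le> (1 + \<kappa>) * D"
          using lip[of s a] True that by (auto simp: D_def algebra_simps)
        finally have "1 / ((1 + \<kappa>) * D) \<le> 1 / infdist (\<gamma> s) (frontier G)"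
          using pos[OF G, of s] D by (intro divide_left_mono) auto
        then show ?thesis using True by (auto simp: f_def intro: ennreal_leI)
      qed auto
    qed
    finally have "ennreal (\<kappa> / (1 + \<kappa>)) + (\<integral>\<^sup>+s\<in>{a'..L}. f s \<partial>lborel) \<le>
        (\<integral>\<^sup>+s. f s * indicator {a..<a'} s \<partial>lborel) + (\<integral>\<^sup>+s\<in>{a'..L}. f s \<partial>lborel)"
      by (rule add_right_mono)
    also have "\<dots> = (\<integral>\<^sup>+s. f s * indicator {a..<a'} s + f s * indicator {a'..L} s \<partial>lborel)"
      by (rule nn_integral_add[symmetric]) auto
    also have "\<dots> \<le> (\<integral>\<^sup>+s\<in>{a..L}. f s \<partial>lborel)"
      using a' that by (intro nn_integral_mono) (auto split: split_indicator)
    finally show ?thesis .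
  qed
  {
    case (0 a)
    \<comment> \<open>With no integral left a complete jump is impossible, so the end of the curve
      is within reach.\<close>
    have "L - a \<le> \<kappa> * infdist (\<gamma> a) (frontier G)"
    proof (rule ccontr)
      assume "\<not> L - a \<le> \<kappa> * infdist (\<gamma> a) (frontier G)"
      then have "ennreal (\<kappa> / (1 + \<kappa>)) \<le> 0"
        using split[of _ a, OF refl] 0 unfolding f_def by (auto simp: add_increasing2)
      then show False using \<open>0 < \<kappa>\<close> by (simp add: field_simps ennreal_eq_0_iff)
    qed
    then show ?case using one[of a] 0 by auto
  next
    case (Suc n a)
    show ?case
    proof (cases "L - a \<le> \<kappa> * infdist (\<gamma> a) (frontier G)")
      case True
      then show ?thesis using one[of a] Suc by auto
    next
      case False
      define a' where "a' = a + \<kappa> * infdist (\<gamma> a) (frontier G)"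
      have "a' < L" using False by (simp add: a'_def)
      have "ennreal (\<kappa> / (1 + \<kappa>)) + (\<integral>\<^sup>+s\<in>{a'..L}. f s \<partial>lborel) \<le> ennreal (real (Suc n) * (\<kappa> / (1 + \<kappa>)))"
        using split[OF a'_def \<open>a' < L\<close>] Suc.prems(2) unfolding f_def by (rule order_trans)
      also have "\<dots> = ennreal (\<kappa> / (1 + \<kappa>)) + ennreal (real n * (\<kappa> / (1 + \<kappa>)))"
        using \<open>0 < \<kappa>\<close> by (subst ennreal_plus[symmetric]) (auto simp: algebra_simps add_divide_distrib)
      finally have "(\<integral>\<^sup>+s\<in>{a'..L}. f s \<partial>lborel) \<le> ennreal (real n * (\<kappa> / (1 + \<kappa>)))"
        by (subst (asm) ennreal_add_left_cancel_le) auto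
      then obtain m where m: "m \<le> Suc n" "(\<gamma> a', \<gamma> L) \<in> step_rel \<kappa> G ^^ m"
        using Suc.IH[of a'] \<open>a' < L\<close> unfolding f_def by auto
      have "(\<gamma> a, \<gamma> L) \<in> step_rel \<kappa> G ^^ Suc m"
        using step[of a] m unfolding a'_def by (intro relpow_Suc_I2) auto
      then show ?thesis using m by (meson Suc_le_mono)
    qed
  }
qed

lemma chain_of_quasihyperbolic_dist:
  assumes "0 < \<kappa>" and pos: "\<And>x. x \<in> G \<Longrightarrow> 0 < infdist x (frontier G)"
    and less: "quasihyperbolic_dist G x y < ennreal (real n * (\<kappa> / (1 + \<kappa>)))"
  shows "\<exists>m\<le>Suc n. (x, y) \<in> step_rel \<kappa> G ^^ m"
proof -
  obtain g where g: "rectifiable_path g" "path_image g \<subseteq> G" "pathstart g = x" "pathfinish g = y"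
    "arc_length_integral g (\<lambda>z. ennreal (1 / infdist z (frontier G))) < ennreal (real n * (\<kappa> / (1 + \<kappa>)))"
    using less unfolding quasihyperbolic_dist_def INF_less_iff by auto
  define L where "L = enn2real (curve_length g 0 1)"
  note p = arc_length_parametrization[OF g(1), folded L_def]
  \<comment> \<open>Clamping the parameter extends the curve to the whole line, with the same
    Lipschitz bound and values in \<open>G\<close>.\<close>
  define \<gamma> where "\<gamma> s = arc_length_param g (max 0 (min L s))" for s
  have "\<exists>m\<le>Suc n. (\<gamma> 0, \<gamma> L) \<in> step_rel \<kappa> G ^^ m"
  proof (rule chain_of_Lipschitz_curve[OF assms(1,2)])
    show "\<gamma> s \<in> G" for s using p(1) p(4)[of "max 0 (min L s)"] g(2) by (auto simp: \<gamma>_def)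
    show "dist (\<gamma> s) (\<gamma> t) \<le> \<bar>s - t\<bar>" for s t
    proof -
      have "dist (\<gamma> s) (\<gamma> t) \<le> \<bar>max 0 (min L s) - max 0 (min L t)\<bar>"
        unfolding \<gamma>_def using p(1) by (intro p(5)) auto
      also have "\<dots> \<le> \<bar>s - t\<bar>" by auto
      finally show ?thesis .
    qed
    have "(\<integral>\<^sup>+s\<in>{0..L}. ennreal (1 / infdist (\<gamma> s) (frontier G)) \<partial>lborel) =
        arc_length_integral g (\<lambda>z. ennreal (1 / infdist z (frontier G)))"
      unfolding arc_length_integral_def L_def[symmetric]
      by (intro nn_integral_cong) (auto simp: \<gamma>_def split: split_indicator)
    then show "(\<integral>\<^sup>+s\<in>{0..L}. ennreal (1 / infdist (\<gamma> s) (frontier G)) \<partial>lborel) \<le> ennreal (real n * (\<kappa> / (1 + \<kappa>)))"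
      using g(5) by simp
  qed (use p in auto)
  then show ?thesis using p g by (auto simp: \<gamma>_def)
qed

lemma chain_of_boundary_condition:
  assumes "quasihyperbolic_boundary_condition \<beta> G"
    and "0 < \<kappa>" and pos: "\<And>x. x \<in> G \<Longrightarrow> 0 < infdist x (frontier G)"
  obtains x0 c where "x0 \<in> G"
    "\<And>x. x \<in> G \<Longrightarrow> \<exists>m. (x, x0) \<in> step_rel \<kappa> G ^^ m \<and>
      real m * (\<kappa> / (1 + \<kappa>)) \<le> 1 / \<beta> * ln (1 / infdist x (frontier G)) + c"
proof -
  obtain x0 c where x0: "x0 \<in> G" and c: "\<And>x. x \<in> G \<Longrightarrow> enn2ereal (quasihyperbolic_dist G x x0)
          \<le> ereal (1 / \<beta> * ln (1 / infdist x (frontier G)) + c)"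
    using assms(1) unfolding quasihyperbolic_boundary_condition_def by auto
  define \<mu> where "\<mu> = \<kappa> / (1 + \<kappa>)"
  have \<mu>: "\<mu> > 0" using assms by (simp add: \<mu>_def)
  show thesis
  \<comment> \<open>The 1 makes the bound strict, so that some curve beats it; one
    \<open>\<mu>\<close> pays for rounding up to \<open>n\<close>, the other for
    \<open>Suc n\<close>.\<close>
  proof (rule that[of x0 "c + 1 + 2 * \<mu>"], fact, fold \<mu>_def)
    fix x assume x: "x \<in> G"
    define K where "K = 1 / \<beta> * ln (1 / infdist x (frontier G)) + c"
    have K: "enn2ereal (quasihyperbolic_dist G x x0) \<le> ereal K" using c[OF x] by (simp add: K_def)
    \<comment> \<open>\<open>K\<close> bounds a nonnegative distance, so it passes to
      \<open>ennreal\<close> without truncation.\<close>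
    have "0 \<le> ereal K" using K by (meson enn2ereal_nonneg order_trans)
    then have "0 \<le> K" by simp
    have le: "quasihyperbolic_dist G x x0 \<le> ennreal K"
      using K \<open>0 \<le> K\<close> by (simp add: less_eq_ennreal.rep_eq ennreal.rep_eq)
    define n where "n = nat \<lceil>(K + 1) / \<mu>\<rceil>"
    have n: "(K + 1) / \<mu> \<le> real n" "real n \<le> (K + 1) / \<mu> + 1"
      using divide_nonneg_pos[of "K + 1" \<mu>] \<open>0 \<le> K\<close> \<mu> unfolding n_def by linarith+
    have n': "K + 1 \<le> real n * \<mu>" "real n * \<mu> \<le> K + 1 + \<mu>"
      using n \<mu> by (auto simp: field_simps)
    have "ennreal K < ennreal (real n * \<mu>)" using n' \<open>0 \<le> K\<close> by (simp add: ennreal_less_iff)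
    then obtain m where m: "m \<le> Suc n" "(x, x0) \<in> step_rel \<kappa> G ^^ m"
      using chain_of_quasihyperbolic_dist[OF assms(2) pos, of x x0 n] le unfolding \<mu>_def by force
    have "real m * \<mu> \<le> real (Suc n) * \<mu>" using m \<mu> by (intro mult_right_mono) auto
    also have "\<dots> \<le> K + 1 + 2 * \<mu>" using n' by (simp add: algebra_simps)
    finally have "real m * \<mu> \<le> 1 / \<beta> * ln (1 / infdist x (frontier G)) + (c + 1 + 2 * \<mu>)"
      by (simp add: K_def)
    then show "\<exists>m. (x, x0) \<in> step_rel \<kappa> G ^^ m \<and> real m * \<mu> \<le> 1 / \<beta> * ln (1 / infdist x (frontier G)) + (c + 1 + 2 * \<mu>)"
      using m by blast
  qed
qed

section \<open>Shortest chains\<close>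

lemma sum_exp_decay_le:
  fixes \<eta> :: real
  assumes "\<eta> > 0"
  shows "(\<Sum>j<i. exp (- \<eta> * real (i - j))) \<le> 1 / (1 - exp (- \<eta>))"
    and "(\<Sum>j\<le>i. exp (- \<eta> * real (i - j))) \<le> 1 / (1 - exp (- \<eta>))"
proof -
  define q where "q = exp (- \<eta>)"
  have q: "0 < q" "q < 1" using assms by (auto simp: q_def)
  have e: "exp (- \<eta> * real k) = q ^ k" for k
    by (simp add: q_def exp_of_nat_mult[symmetric] mult.commute)
  have "(\<Sum>j\<le>i. exp (- \<eta> * real (i - j))) = (\<Sum>j\<le>i. q ^ (i - j))"
    unfolding e ..
  also have "\<dots> = (\<Sum>j\<le>i. q ^ j)"
    using sum.nat_diff_reindex[of "\<lambda>k. q ^ k" "Suc i"] by (simp add: lessThan_Suc_atMost)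
  also have "\<dots> \<le> (\<Sum>j. q ^ j)"
    using q by (intro sum_le_suminf summable_geometric) auto
  also have "\<dots> = 1 / (1 - q)" using q by (intro suminf_geometric) auto
  finally show 1: "(\<Sum>j\<le>i. exp (- \<eta> * real (i - j))) \<le> 1 / (1 - exp (- \<eta>))" by (simp add: q_def)
  have "(\<Sum>j<i. exp (- \<eta> * real (i - j))) \<le> (\<Sum>j\<le>i. exp (- \<eta> * real (i - j)))"
    by (intro sum_mono2) auto
  with 1 show "(\<Sum>j<i. exp (- \<eta> * real (i - j))) \<le> 1 / (1 - exp (- \<eta>))" by linarith
qed

text \<open>Going back from index \<open>i\<close> by \<open>t\<close> steps, \<open>D\<close> grows at most like \<open>D i * exp (\<tau> * t)\<close> and is at
  most of order \<open>D i powr (\<sigma> / \<tau>) * exp (- \<sigma> * t)\<close>. A geometric mean of the two bounds is summable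
  in \<open>t\<close>; the best admissible \<open>\<theta>\<close> is where the exponent \<open>2 * \<beta> / (1 + \<beta>)\<close> comes from.\<close>

lemma chain_displacement:
  fixes D :: "nat \<Rightarrow> real"
  assumes "0 < \<kappa>" "\<kappa> < 1" "0 < \<sigma>" "0 < C0" "0 < \<theta>" "\<theta> < 1"
    and \<tau>_def: "\<tau> = - ln (1 - \<kappa>)"
    and \<eta>: "0 < \<sigma> * (1 - \<theta>) - \<theta> * \<tau>"
    and pos: "\<And>i. i \<le> N \<Longrightarrow> 0 < D i"
    and step: "\<And>i. i < N \<Longrightarrow> \<bar>D (Suc i) - D i\<bar> \<le> \<kappa> * D i"
    and decay: "\<And>i. i \<le> N \<Longrightarrow> D i \<le> C0 * exp (- \<sigma> * real (N - i))"
    and "i \<le> N"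
  shows "(\<Sum>j<i. D j) \<le> (C0 * D N powr (- (\<sigma> / \<tau>))) powr (1 - \<theta>) /
      (1 - exp (- (\<sigma> * (1 - \<theta>) - \<theta> * \<tau>))) * D i powr (\<theta> + \<sigma> / \<tau> * (1 - \<theta>))"
proof -
  define \<eta> where "\<eta> = \<sigma> * (1 - \<theta>) - \<theta> * \<tau>"
  define \<beta> where "\<beta> = \<sigma> / \<tau>"
  define C1 where "C1 = (C0 * D N powr (- \<beta>)) powr (1 - \<theta>)"
  have \<tau>: "\<tau> > 0" using assms by (simp add: \<tau>_def)
  have "\<beta> > 0" unfolding \<beta>_def using \<tau> assms(3) by (intro divide_pos_pos)
  have e\<tau>: "exp (- \<tau>) = 1 - \<kappa>" using assms by (simp add: \<tau>_def)
  have up1: "D j \<le> exp \<tau> * D (Suc j)" if "j < N" for j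
  proof -
    have "exp (- \<tau>) * D j \<le> D (Suc j)" using step[OF that] by (simp add: e\<tau> algebra_simps)
    then have "exp \<tau> * (exp (- \<tau>) * D j) \<le> exp \<tau> * D (Suc j)" by (intro mult_left_mono) auto
    then show ?thesis by (simp add: mult.assoc[symmetric] exp_add[symmetric])
  qed
  have dn1: "D (Suc j) \<le> exp \<tau> * D j" if "j < N" for j
  proof -
    have "D (Suc j) \<le> (1 + \<kappa>) * D j" using step[OF that] by (simp add: algebra_simps)
    \<comment> \<open>Upward growth by a factor \<open>1 + \<kappa>\<close> is covered by the same
      rate \<tau>, since \<open>1 + \<kappa> \<le> 1 / (1 - \<kappa>)\<close>.\<close>
    also have "(1 + \<kappa>) * (1 - \<kappa>) \<le> 1" by (simp add: algebra_simps)
    then have "1 + \<kappa> \<le> exp \<tau>" using assms by (simp add: \<tau>_def exp_minus field_simps)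
    then have "(1 + \<kappa>) * D j \<le> exp \<tau> * D j" using pos[of j] that by (intro mult_right_mono) auto
    finally show ?thesis .
  qed
  have up: "D (i - t) \<le> exp (\<tau> * real t) * D i" if "t \<le> i" for t
    using that
  proof (induction t)
    case (Suc t)
    have "D (i - Suc t) \<le> exp \<tau> * D (Suc (i - Suc t))" using Suc.prems \<open>i \<le> N\<close> by (intro up1) auto
    also have "Suc (i - Suc t) = i - t" using Suc.prems by simp
    also have "exp \<tau> * D (i - t) \<le> exp \<tau> * (exp (\<tau> * real t) * D i)" using Suc by (intro mult_left_mono) auto
    also have "\<dots> = exp (\<tau> * real (Suc t)) * D i" by (simp add: mult.assoc[symmetric] exp_add[symmetric] algebra_simps)
    finally show ?case .
  qed simp
  have dn: "D (i + t) \<le> exp (\<tau> * real t) * D i" if "i + t \<le> N" for t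
    using that
  proof (induction t)
    case (Suc t)
    have "D (i + Suc t) \<le> exp \<tau> * D (i + t)" using Suc.prems dn1[of "i + t"] by simp
    also have "\<dots> \<le> exp \<tau> * (exp (\<tau> * real t) * D i)" using Suc by (intro mult_left_mono) auto
    also have "\<dots> = exp (\<tau> * real (Suc t)) * D i" by (simp add: mult.assoc[symmetric] exp_add[symmetric] algebra_simps)
    finally show ?case .
  qed simp
  have Di: "D i > 0" "D N > 0" using pos assms by auto
  \<comment> \<open>Since \<open>D\<close> grows by at most \<open>exp \<tau>\<close> per step, at
    least \<open>ln (D N / D i) / \<tau>\<close> steps remain after \<open>i\<close>. This turns
    exponential decay into a power of \<open>D i\<close>.\<close>
  have dec: "exp (- \<sigma> * real (N - i)) \<le> (D i / D N) powr \<beta>"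
  proof -
    have "D N \<le> exp (\<tau> * real (N - i)) * D i" using dn[of "N - i"] \<open>i \<le> N\<close> by simp
    then have "exp (- (\<tau> * real (N - i))) \<le> D i / D N" using Di by (simp add: exp_minus field_simps)
    then have "exp (- (\<tau> * real (N - i))) powr \<beta> \<le> (D i / D N) powr \<beta>"
      using \<open>\<beta> > 0\<close> by (intro powr_mono2) auto
    also have "exp (- (\<tau> * real (N - i))) powr \<beta> = exp (- \<sigma> * real (N - i))"
      using \<tau> by (simp add: powr_def \<beta>_def)
    finally show ?thesis .
  qed
  have main: "D j \<le> C1 * D i powr (\<theta> + \<beta> * (1 - \<theta>)) * exp (- \<eta> * real (i - j))" if "j < i" for j
  proof -
    define t where "t = i - j"
    have Dj: "D j > 0" using pos that \<open>i \<le> N\<close> by simp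
    have a: "D j \<le> exp (\<tau> * real t) * D i" using up[of t] that by (simp add: t_def)
    have "D j \<le> C0 * exp (- \<sigma> * real (N - j))" using decay that \<open>i \<le> N\<close> by simp
    also have "real (N - j) = real (N - i) + real t" using that \<open>i \<le> N\<close> by (simp add: t_def)
    also have "exp (- \<sigma> * (real (N - i) + real t)) = exp (- \<sigma> * real (N - i)) * exp (- \<sigma> * real t)"
      by (simp add: exp_add[symmetric] algebra_simps)
    also have "C0 * (exp (- \<sigma> * real (N - i)) * exp (- \<sigma> * real t)) \<le> C0 * ((D i / D N) powr \<beta> * exp (- \<sigma> * real t))"
      using assms by (intro mult_left_mono mult_right_mono dec) auto
    also have "\<dots> = (C0 * D N powr (- \<beta>)) * D i powr \<beta> * exp (- \<sigma> * real t)"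
      using Di by (simp add: powr_divide powr_minus field_simps)
    finally have b: "D j \<le> (C0 * D N powr (- \<beta>)) * D i powr \<beta> * exp (- \<sigma> * real t)" .
    \<comment> \<open>The weight \<theta> goes to the growth bound, \<open>1 - \<theta>\<close> to
      the decay bound.\<close>
    have "D j = D j powr \<theta> * D j powr (1 - \<theta>)" using Dj by (simp add: powr_add[symmetric])
    also have "\<dots> \<le> (exp (\<tau> * real t) * D i) powr \<theta> * ((C0 * D N powr (- \<beta>)) * D i powr \<beta> * exp (- \<sigma> * real t)) powr (1 - \<theta>)"
      using a b Dj assms(5,6) by (intro mult_mono powr_mono2) auto
    also have "\<dots> = C1 * (D i powr \<theta> * D i powr (\<beta> * (1 - \<theta>))) * (exp (\<theta> * (\<tau> * real t)) * exp ((1 - \<theta>) * (- \<sigma> * real t)))"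
      using Di assms by (simp add: powr_mult C1_def powr_powr powr_def[of "exp _"])
    also have "D i powr \<theta> * D i powr (\<beta> * (1 - \<theta>)) = D i powr (\<theta> + \<beta> * (1 - \<theta>))"
      by (simp add: powr_add)
    also have "exp (\<theta> * (\<tau> * real t)) * exp ((1 - \<theta>) * (- \<sigma> * real t)) = exp (- \<eta> * real t)"
      by (simp add: exp_add[symmetric] \<eta>_def algebra_simps)
    finally show ?thesis by (simp add: t_def)
  qed
  have "(\<Sum>j<i. D j) \<le> (\<Sum>j<i. C1 * D i powr (\<theta> + \<beta> * (1 - \<theta>)) * exp (- \<eta> * real (i - j)))"
    by (intro sum_mono main) auto
  also have "\<dots> = C1 * D i powr (\<theta> + \<beta> * (1 - \<theta>)) * (\<Sum>j<i. exp (- \<eta> * real (i - j)))"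
    by (simp add: sum_distrib_left)
  also have "\<dots> \<le> C1 * D i powr (\<theta> + \<beta> * (1 - \<theta>)) * (1 / (1 - exp (- \<eta>)))"
    using \<eta> by (intro mult_left_mono sum_exp_decay_le) (auto simp: C1_def \<eta>_def)
  finally show ?thesis by (simp add: C1_def \<beta>_def \<eta>_def)
qed

text \<open>The ratio \<open>B \<kappa>\<close> of decay rate to growth rate tends to \<beta> as
  \<kappa> tends to 0. For its value \<open>\<beta>'\<close>, summability requires
  \<open>\<theta> < \<beta>' / (1 + \<beta>')\<close> and the exponent requires
  \<open>\<theta> \<ge> (b - \<beta>') / (1 - \<beta>')\<close>; the two are compatible exactly when
  \<open>b < 2 * \<beta>' / (1 + \<beta>')\<close>, which holds for small \<kappa>. The bound
  \<open>1/20\<close> leaves room for the ball comparisons to come.\<close>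

lemma exists_chain_parameters:
  fixes \<beta> b :: real
  assumes "0 < \<beta>" "\<beta> \<le> 1" "b < 2 * \<beta> / (1 + \<beta>)"
  obtains \<kappa> \<theta> where "0 < \<kappa>" "\<kappa> < 1/20" "0 < \<theta>" "\<theta> < 1"
    "0 < \<beta> * (\<kappa> / (1 + \<kappa>)) * (1 - \<theta>) - \<theta> * (- ln (1 - \<kappa>))"
    "b \<le> \<theta> + \<beta> * (\<kappa> / (1 + \<kappa>)) / (- ln (1 - \<kappa>)) * (1 - \<theta>)"
proof -
  define B where "B \<kappa> = \<beta> * (\<kappa> / (1 + \<kappa>)) / (- ln (1 - \<kappa>))" for \<kappa> :: real
  have lim: "(B \<longlongrightarrow> \<beta>) (at_right 0)" unfolding B_def by real_asymp
  then have "((\<lambda>\<kappa>. 2 * B \<kappa> / (1 + B \<kappa>)) \<longlongrightarrow> 2 * \<beta> / (1 + \<beta>)) (at_right 0)"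
    using assms by (intro tendsto_intros) auto
  then have "eventually (\<lambda>\<kappa>. b < 2 * B \<kappa> / (1 + B \<kappa>)) (at_right 0)"
    using assms(3) by (rule order_tendstoD)
  moreover have "eventually (\<lambda>\<kappa>::real. 0 < \<kappa> \<and> \<kappa> < 1/20) (at_right 0)"
    by (auto simp: eventually_at_right_field intro!: exI[of _ "1/20"])
  ultimately have "eventually (\<lambda>\<kappa>. b < 2 * B \<kappa> / (1 + B \<kappa>) \<and> 0 < \<kappa> \<and> \<kappa> < 1/20) (at_right 0)"
    by eventually_elim auto
  then obtain \<kappa> where \<kappa>: "b < 2 * B \<kappa> / (1 + B \<kappa>)" "0 < \<kappa>" "\<kappa> < 1/20"
    using eventually_happens'[OF trivial_limit_at_right_real] by blast
  define \<beta>' where "\<beta>' = B \<kappa>"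
  define \<tau> where "\<tau> = - ln (1 - \<kappa>)"
  have \<tau>: "\<kappa> \<le> \<tau>" using ln_le_minus_one[of "1 - \<kappa>"] \<kappa> by (simp add: \<tau>_def)
  have \<beta>'\<tau>: "\<beta> * (\<kappa> / (1 + \<kappa>)) = \<beta>' * \<tau>" using \<tau> \<kappa> by (simp add: \<beta>'_def B_def \<tau>_def)
  have "\<beta> * (\<kappa> / (1 + \<kappa>)) \<le> 1 * (\<kappa> / (1 + \<kappa>))" using assms \<kappa> by (intro mult_right_mono) auto
  also have "\<dots> < \<kappa>" using \<kappa> by (simp add: field_simps)
  also have "\<dots> \<le> \<tau>" by fact
  \<comment> \<open>Strict even for \<open>\<beta> = 1\<close>, because
    \<open>\<kappa> / (1 + \<kappa>) < \<kappa> \<le> \<tau>\<close>.\<close>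
  finally have "\<beta>' < 1" unfolding \<beta>'\<tau> using \<tau> \<kappa> by (simp add: mult_less_cancel_right1)
  have "\<beta>' > 0"
    unfolding \<beta>'_def B_def \<tau>_def[symmetric] using assms \<kappa> \<tau> by (intro divide_pos_pos mult_pos_pos) auto
  have "(b - \<beta>') / (1 - \<beta>') < \<beta>' / (1 + \<beta>')"
  proof -
    have "b * (1 + \<beta>') < 2 * \<beta>'" using \<kappa>(1) \<open>\<beta>' > 0\<close> by (simp add: \<beta>'_def[symmetric] field_simps)
    then show ?thesis using \<open>\<beta>' > 0\<close> \<open>\<beta>' < 1\<close> by (simp add: field_simps)
  qed
  moreover have "0 < \<beta>' / (1 + \<beta>')" using \<open>\<beta>' > 0\<close> by simp
  ultimately obtain \<theta> where \<theta>: "max 0 ((b - \<beta>') / (1 - \<beta>')) < \<theta>" "\<theta> < \<beta>' / (1 + \<beta>')"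
    using dense[of "max 0 ((b - \<beta>') / (1 - \<beta>'))" "\<beta>' / (1 + \<beta>')"] by auto
  show thesis
  proof (rule that[of \<kappa> \<theta>])
    show "0 < \<kappa>" "\<kappa> < 1/20" "0 < \<theta>" using \<kappa> \<theta> by auto
    have "\<beta>' / (1 + \<beta>') < 1" using \<open>\<beta>' > 0\<close> by simp
    then show "\<theta> < 1" using \<theta> by simp
    have "0 < \<tau> * (\<beta>' * (1 - \<theta>) - \<theta>)" using \<theta> \<tau> \<kappa> \<open>\<beta>' > 0\<close> by (intro mult_pos_pos) (auto simp: field_simps)
    then show "0 < \<beta> * (\<kappa> / (1 + \<kappa>)) * (1 - \<theta>) - \<theta> * (- ln (1 - \<kappa>))"
      unfolding \<beta>'\<tau> \<tau>_def[symmetric] by (simp add: algebra_simps)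
    have "(b - \<beta>') / (1 - \<beta>') < \<theta>" using \<theta> by simp
    then have "b - \<beta>' < \<theta> * (1 - \<beta>')" using \<open>\<beta>' < 1\<close> by (simp add: field_simps)
    then show "b \<le> \<theta> + \<beta> * (\<kappa> / (1 + \<kappa>)) / (- ln (1 - \<kappa>)) * (1 - \<theta>)"
      unfolding B_def[symmetric] \<beta>'_def[symmetric] by (simp add: algebra_simps)
  qed
qed

text \<open>Minimality is used twice. Replacing the tail from \<open>f i\<close> by the chain that
  \<open>decay\<close> offers cannot shorten the whole, so \<open>N - i\<close> is at most the
  length of that chain and its estimate applies at \<open>f i\<close>. A direct step from
  \<open>f i\<close> to a later \<open>f j\<close> would shorten the chain unless
  \<open>j = Suc i\<close>.\<close>

lemma shortest_chain:
  assumes "(z, x0) \<in> step_rel \<kappa> G ^^ m" "z \<in> G"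
    and decay: "\<And>x. x \<in> G \<Longrightarrow> \<exists>m. (x, x0) \<in> step_rel \<kappa> G ^^ m \<and> infdist x (frontier G) \<le> C0 * exp (- \<sigma> * real m)"
    and "0 < C0" "0 < \<sigma>"
  obtains f N where "f 0 = z" "f N = x0" "\<And>i. i \<le> N \<Longrightarrow> f i \<in> G"
    "\<And>i. i < N \<Longrightarrow> dist (f i) (f (Suc i)) \<le> \<kappa> * infdist (f i) (frontier G)"
    "\<And>i. i \<le> N \<Longrightarrow> infdist (f i) (frontier G) \<le> C0 * exp (- \<sigma> * real (N - i))"
    "\<And>i j. i < j \<Longrightarrow> j \<le> N \<Longrightarrow> dist (f i) (f j) \<le> \<kappa> * infdist (f i) (frontier G) \<Longrightarrow> j = Suc i"
proof -
  let ?R = "step_rel \<kappa> G"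
  define N where "N = (LEAST m. (z, x0) \<in> ?R ^^ m)"
  have "(z, x0) \<in> ?R ^^ N" unfolding N_def using assms(1) by (rule LeastI)
  then obtain f where f: "f 0 = z" "f N = x0" "\<And>i. i < N \<Longrightarrow> (f i, f (Suc i)) \<in> ?R"
    unfolding relpow_fun_conv by blast
  have seg: "(f i, f (i + k)) \<in> ?R ^^ k" if "i + k \<le> N" for i k
    unfolding relpow_fun_conv using f(3) that by (intro exI[of _ "\<lambda>j. f (i + j)"]) auto
  have min: "N \<le> m" if "(z, x0) \<in> ?R ^^ m" for m unfolding N_def using that by (rule Least_le)
  have G: "f i \<in> G" if "i \<le> N" for i
    using that f(1) f(3)[of "i - 1"] assms(2) by (cases i) (auto simp: step_rel_def)
  show thesis
  proof (rule that[of f N])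
    show "dist (f i) (f (Suc i)) \<le> \<kappa> * infdist (f i) (frontier G)" if "i < N" for i
      using f(3)[OF that] by (auto simp: step_rel_def)
    show "infdist (f i) (frontier G) \<le> C0 * exp (- \<sigma> * real (N - i))" if i: "i \<le> N" for i
    proof -
      obtain m where m: "(f i, x0) \<in> ?R ^^ m" "infdist (f i) (frontier G) \<le> C0 * exp (- \<sigma> * real m)"
        using decay[OF G[OF i]] by blast
      have "(z, f i) \<in> ?R ^^ i" using seg[of 0 i] i f(1) by simp
      then have "(z, x0) \<in> ?R ^^ (i + m)" using m(1) by (auto simp: relpow_add)
      from min[OF this] have "real (N - i) \<le> real m" by linarith
      then have "C0 * exp (- \<sigma> * real m) \<le> C0 * exp (- \<sigma> * real (N - i))"
        using assms by (intro mult_left_mono) (auto intro: mult_left_mono)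
      with m(2) show ?thesis by linarith
    qed
    show "j = Suc i" if ij: "i < j" "j \<le> N" and "dist (f i) (f j) \<le> \<kappa> * infdist (f i) (frontier G)" for i j
    proof -
      have "(f i, f j) \<in> ?R" using that G by (auto simp: step_rel_def)
      moreover have "(z, f i) \<in> ?R ^^ i" using seg[of 0 i] ij f(1) by simp
      moreover have "(f j, x0) \<in> ?R ^^ (N - j)" using seg[of j "N - j"] ij f(2) by simp
      ultimately have "(z, x0) \<in> ?R ^^ (Suc i + (N - j))"
        unfolding relpow_add[of "Suc i"] by (intro relcompI[of z "f j"] relpow_Suc_I)
      from min[OF this] ij show ?thesis by linarith
    qed
  qed (use f G in auto)
qed

lemma chain_family:
  fixes G :: "'a::metric_space set"
  assumes qhbc: "quasihyperbolic_boundary_condition \<beta> G"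
    and pos: "\<And>x. x \<in> G \<Longrightarrow> 0 < infdist x (frontier G)"
    and bdd: "\<And>x. x \<in> G \<Longrightarrow> infdist x (frontier G) \<le> D0"
    and "0 < \<beta>" "\<beta> \<le> 1" "0 < b" "b < 2 * \<beta> / (1 + \<beta>)"
  obtains \<kappa> x0 C0 \<sigma> C f N where "0 < \<kappa>" "\<kappa> < 1/20" "x0 \<in> G" "0 < C0" "0 < \<sigma>" "0 < C"
    "\<And>z. z \<in> G \<Longrightarrow> f z 0 = z" "\<And>z. z \<in> G \<Longrightarrow> f z (N z) = x0"
    "\<And>z i. z \<in> G \<Longrightarrow> i \<le> N z \<Longrightarrow> f z i \<in> G"
    "\<And>z i. z \<in> G \<Longrightarrow> i < N z \<Longrightarrow> dist (f z i) (f z (Suc i)) \<le> \<kappa> * infdist (f z i) (frontier G)"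
    "\<And>z i. z \<in> G \<Longrightarrow> i \<le> N z \<Longrightarrow> infdist (f z i) (frontier G) \<le> C0 * exp (- \<sigma> * real (N z - i))"
    "\<And>z i j. z \<in> G \<Longrightarrow> i < j \<Longrightarrow> j \<le> N z \<Longrightarrow> dist (f z i) (f z j) \<le> \<kappa> * infdist (f z i) (frontier G) \<Longrightarrow> j = Suc i"
    "\<And>z i. z \<in> G \<Longrightarrow> i \<le> N z \<Longrightarrow> dist z (f z i) \<le> C * infdist (f z i) (frontier G) powr b"
proof -
  define d where "d x = infdist x (frontier G)" for x
  obtain \<kappa> \<theta> where \<kappa>: "0 < \<kappa>" "\<kappa> < 1/20" "0 < \<theta>" "\<theta> < 1"
    "0 < \<beta> * (\<kappa> / (1 + \<kappa>)) * (1 - \<theta>) - \<theta> * (- ln (1 - \<kappa>))"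
    "b \<le> \<theta> + \<beta> * (\<kappa> / (1 + \<kappa>)) / (- ln (1 - \<kappa>)) * (1 - \<theta>)"
    using exists_chain_parameters[OF assms(4,5,7)] by blast
  define \<sigma> where "\<sigma> = \<beta> * (\<kappa> / (1 + \<kappa>))"
  define \<tau> where "\<tau> = - ln (1 - \<kappa>)"
  have \<sigma>: "\<sigma> > 0" using \<kappa> assms by (simp add: \<sigma>_def)
  obtain x0 c where x0: "x0 \<in> G" and c: "\<And>x. x \<in> G \<Longrightarrow> \<exists>m. (x, x0) \<in> step_rel \<kappa> G ^^ m \<and>
      real m * (\<kappa> / (1 + \<kappa>)) \<le> 1 / \<beta> * ln (1 / infdist x (frontier G)) + c"
    using chain_of_boundary_condition[OF qhbc \<kappa>(1) pos] by blast
  \<comment> \<open>The factor that appears when the boundary condition is solved for the boundary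
    distance.\<close>
  define C0 where "C0 = exp (\<beta> * c)"
  have C0: "C0 > 0" by (simp add: C0_def)
  have decay: "\<exists>m. (x, x0) \<in> step_rel \<kappa> G ^^ m \<and> infdist x (frontier G) \<le> C0 * exp (- \<sigma> * real m)" if "x \<in> G" for x
  proof -
    from c[OF that] obtain m where m: "(x, x0) \<in> step_rel \<kappa> G ^^ m"
      "real m * (\<kappa> / (1 + \<kappa>)) \<le> 1 / \<beta> * ln (1 / infdist x (frontier G)) + c" by blast
    have "\<beta> * (real m * (\<kappa> / (1 + \<kappa>))) \<le> \<beta> * (1 / \<beta> * ln (1 / infdist x (frontier G)) + c)"
      using m(2) assms by (intro mult_left_mono) auto
    also have "\<dots> = - ln (infdist x (frontier G)) + \<beta> * c"
      using assms pos[OF that] by (simp add: ln_div algebra_simps)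
    finally have "ln (infdist x (frontier G)) \<le> \<beta> * c + - \<sigma> * real m" by (simp add: \<sigma>_def algebra_simps)
    then have "infdist x (frontier G) \<le> exp (\<beta> * c + - \<sigma> * real m)"
      using pos[OF that] by (metis exp_le_cancel_iff exp_ln)
    then show ?thesis using m(1) unfolding C0_def exp_add by blast
  qed
  define P where "P z fN \<longleftrightarrow> (case fN of (f, N) \<Rightarrow> f 0 = z \<and> f N = x0 \<and> (\<forall>i\<le>N. f i \<in> G) \<and>
    (\<forall>i<N. dist (f i) (f (Suc i)) \<le> \<kappa> * infdist (f i) (frontier G)) \<and>
    (\<forall>i\<le>N. infdist (f i) (frontier G) \<le> C0 * exp (- \<sigma> * real (N - i))) \<and>
    (\<forall>i j. i < j \<longrightarrow> j \<le> N \<longrightarrow> dist (f i) (f j) \<le> \<kappa> * infdist (f i) (frontier G) \<longrightarrow> j = Suc i))"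
    for z and fN :: "(nat \<Rightarrow> 'a) \<times> nat"
  have "\<exists>fN. P z fN" if z: "z \<in> G" for z
  proof -
    obtain m where m: "(z, x0) \<in> step_rel \<kappa> G ^^ m" using c[OF z] by blast
    show ?thesis
    proof (rule shortest_chain[OF m z decay C0 \<sigma>], goal_cases)
      case (2 f N)
      then show ?case unfolding P_def by (intro exI[of _ "(f, N)"]) auto
    qed auto
  qed
  then obtain F where F: "\<And>z. z \<in> G \<Longrightarrow> P z (F z)" by metis
  define f where "f z = fst (F z)" for z
  define N where "N z = snd (F z)" for z
  have ch: "f z 0 = z" "f z (N z) = x0" "\<And>i. i \<le> N z \<Longrightarrow> f z i \<in> G"
    "\<And>i. i < N z \<Longrightarrow> dist (f z i) (f z (Suc i)) \<le> \<kappa> * infdist (f z i) (frontier G)"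
    "\<And>i. i \<le> N z \<Longrightarrow> infdist (f z i) (frontier G) \<le> C0 * exp (- \<sigma> * real (N z - i))"
    "\<And>i j. i < j \<Longrightarrow> j \<le> N z \<Longrightarrow> dist (f z i) (f z j) \<le> \<kappa> * infdist (f z i) (frontier G) \<Longrightarrow> j = Suc i"
    if "z \<in> G" for z
    using F[OF that] unfolding P_def f_def N_def by (auto simp: case_prod_beta)
  define K where "K = (C0 * infdist x0 (frontier G) powr (- (\<sigma> / \<tau>))) powr (1 - \<theta>) /
      (1 - exp (- (\<sigma> * (1 - \<theta>) - \<theta> * \<tau>)))"
  define b' where "b' = \<theta> + \<sigma> / \<tau> * (1 - \<theta>)"
  have \<eta>: "0 < \<sigma> * (1 - \<theta>) - \<theta> * \<tau>" and b': "b \<le> b'" using \<kappa> by (auto simp: \<sigma>_def \<tau>_def b'_def)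
  have K: "K \<ge> 0" unfolding K_def using \<eta> by (intro divide_nonneg_pos) auto
  have D0: "D0 > 0" using pos[OF x0] bdd[OF x0] by simp
  \<comment> \<open>The surplus power \<open>b' - b \<ge> 0\<close> of the boundary distance is
    absorbed by the bound \<open>D0\<close>; adding 1 makes \<open>C\<close> positive.\<close>
  define C where "C = K * D0 powr (b' - b) + 1"
  have disp: "dist z (f z i) \<le> C * infdist (f z i) (frontier G) powr b" if z: "z \<in> G" and i: "i \<le> N z" for z i
  proof -
    define D where "D j = infdist (f z j) (frontier G)" for j
    have Dpos: "0 < D j" if "j \<le> N z" for j using pos ch(3)[OF z that] by (simp add: D_def)
    have DN: "D (N z) = infdist x0 (frontier G)" using ch(2)[OF z] by (simp add: D_def)
    have "dist z (f z i) \<le> (\<Sum>j<i. dist (f z j) (f z (Suc j)))"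
    proof -
      have "dist (f z 0) (f z i) \<le> (\<Sum>j<i. dist (f z j) (f z (Suc j)))"
      proof (induction i)
        case (Suc i)
        have "dist (f z 0) (f z (Suc i)) \<le> dist (f z 0) (f z i) + dist (f z i) (f z (Suc i))"
          by (rule dist_triangle)
        with Suc show ?case by simp
      qed simp
      then show ?thesis using ch(1)[OF z] by simp
    qed
    also have "\<dots> \<le> (\<Sum>j<i. D j)"
    proof (intro sum_mono)
      fix j assume "j \<in> {..<i}"
      then have j: "j < N z" using i by simp
      have "dist (f z j) (f z (Suc j)) \<le> \<kappa> * D j" using ch(4)[OF z j] by (simp add: D_def)
      also have "\<dots> \<le> 1 * D j" using \<kappa> Dpos[of j] j by (intro mult_right_mono) auto
      finally show "dist (f z j) (f z (Suc j)) \<le> D j" by simp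
    qed
    also have "\<dots> \<le> K * D i powr b'"
      unfolding K_def DN[symmetric] b'_def
    proof (rule chain_displacement[where \<kappa> = \<kappa> and N = "N z"])
      show "\<bar>D (Suc i) - D i\<bar> \<le> \<kappa> * D i" if "i < N z" for i
        using infdist_Lipschitz[of "f z (Suc i)" "frontier G" "f z i"] ch(4)[OF z that]
        by (simp add: D_def dist_commute)
    qed (use \<kappa> \<sigma> C0 \<eta> \<tau>_def i Dpos ch(5)[OF z] in \<open>auto simp: D_def\<close>)
    also have "D i powr b' = D i powr (b' - b) * D i powr b" by (simp add: powr_add[symmetric])
    also have "K * (D i powr (b' - b) * D i powr b) \<le> K * (D0 powr (b' - b) * D i powr b)"
      using K b' Dpos[OF i] bdd[OF ch(3)[OF z i]]
      by (intro mult_left_mono mult_right_mono powr_mono2) (auto simp: D_def)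
    also have "\<dots> \<le> C * D i powr b" by (simp add: C_def algebra_simps)
    finally show ?thesis by (simp add: D_def)
  qed
  have "C > 0" using K D0 by (auto simp: C_def intro!: add_nonneg_pos)
  show thesis
    by (rule that[of \<kappa> x0 C0 \<sigma> C f N]) (use \<kappa> x0 C0 \<sigma> \<open>C > 0\<close> ch disp in auto)
qed

section \<open>Integrability of powers of the boundary distance\<close>

text \<open>Any \<open>lam'\<close> above the dimension lies outside the set whose supremum defines
  it, so the upper limit of its content is finite.\<close>

lemma minkowski_content_bound:
  fixes E :: "'a::euclidean_space set"
  assumes "upper_minkowski_dim E \<le> ennreal lam" "0 \<le> lam" "lam < lam'"
  obtains r0 M where "r0 > 0" "M \<ge> 0"
    "\<And>r. 0 < r \<Longrightarrow> r < r0 \<Longrightarrow>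
      emeasure lebesgue (\<Union>x\<in>E. ball x r) \<le> ennreal (M * r powr (real DIM('a) - lam'))"
proof -
  have "Limsup (at_right 0) (minkowski_content_at lam' E) \<noteq> \<infinity>"
  proof
    assume "Limsup (at_right 0) (minkowski_content_at lam' E) = \<infinity>"
    then have "ennreal lam' \<le> upper_minkowski_dim E"
      unfolding upper_minkowski_dim_def using assms by (intro Sup_upper) auto
    then have "ennreal lam' \<le> ennreal lam" using assms(1) by (rule order_trans)
    then show False using assms by (simp add: ennreal_le_iff2)
  qed
  then obtain M where M: "M \<ge> 0" "Limsup (at_right 0) (minkowski_content_at lam' E) < ennreal M"
    by (metis dense ennreal_cases infinity_ennreal_def less_top top.not_eq_extremum)
  have "eventually (\<lambda>r. minkowski_content_at lam' E r < ennreal M) (at_right 0)"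
    using M(2) by (rule Limsup_lessD)
  then obtain r0 where r0: "r0 > 0" "\<And>r. 0 < r \<Longrightarrow> r < r0 \<Longrightarrow> minkowski_content_at lam' E r < ennreal M"
    unfolding eventually_at_right_field by auto
  show thesis
  proof (rule that[OF r0(1) M(1)])
    fix r :: real assume r: "0 < r" "r < r0"
    define c where "c = r powr (real DIM('a) - lam')"
    have c: "c > 0" using r by (simp add: c_def)
    have "emeasure lebesgue (\<Union>x\<in>E. ball x r) = (emeasure lebesgue (\<Union>x\<in>E. ball x r) / ennreal c) * ennreal c"
      using c ennreal_mult_divide_eq[of "ennreal c" "emeasure lebesgue (\<Union>x\<in>E. ball x r)"]
      by (metis ennreal_eq_0_iff ennreal_neq_top ennreal_times_divide leD mult.commute)
    also have "\<dots> \<le> ennreal M * ennreal c"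
      using r0(2)[OF r] by (intro mult_right_mono) (auto simp: minkowski_content_at_def c_def)
    finally show "emeasure lebesgue (\<Union>x\<in>E. ball x r) \<le> ennreal (M * r powr (real DIM('a) - lam'))"
      using M(1) c by (simp add: ennreal_mult c_def)
  qed
qed

text \<open>The part of \<open>G\<close> at boundary distance below \<open>\<rho> j\<close> lies in
  the \<open>\<rho> j\<close>-neighbourhood of the frontier, so its volume is at most
  \<open>M * \<rho> j powr (n - lam')\<close>. Between consecutive radii the integrand is at most
  \<open>\<rho> (Suc j) powr (- s)\<close>, and the resulting series is geometric because
  \<open>s < n - lam'\<close>.\<close>

lemma nn_integral_infdist_powr_finite:
  fixes G :: "'a::euclidean_space set"
  assumes "open G" "bounded G" "frontier G \<noteq> {}" and pos: "\<And>x. x \<in> G \<Longrightarrow> 0 < infdist x (frontier G)"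
    and "upper_minkowski_dim (frontier G) \<le> ennreal lam" "0 \<le> lam" "0 \<le> s" "s < real DIM('a) - lam"
  shows "(\<integral>\<^sup>+x\<in>G. ennreal (infdist x (frontier G) powr (- s)) \<partial>lborel) < \<infinity>"
proof -
  define d where "d x = infdist x (frontier G)" for x
  define n where "n = real DIM('a)"
  obtain lam' where lam': "lam < lam'" "s < n - lam'"
    using assms(8) dense[of lam "n - s"] by (auto simp: n_def)
  obtain r0 M where r0: "r0 > 0" "M \<ge> 0" and M: "\<And>r. 0 < r \<Longrightarrow> r < r0 \<Longrightarrow>
      emeasure lebesgue (\<Union>x\<in>frontier G. ball x r) \<le> ennreal (M * r powr (n - lam'))"
    using minkowski_content_bound[OF assms(5,6) lam'(1)] unfolding n_def by blast
  define r1 where "r1 = r0 / 2"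
  have r1: "0 < r1" "r1 < r0" using r0 by (auto simp: r1_def)
  define \<rho> where "\<rho> j = r1 * (1/2) ^ j" for j :: nat
  have \<rho>: "0 < \<rho> j" "\<rho> j < r0" for j
  proof -
    show "0 < \<rho> j" using r1 by (simp add: \<rho>_def)
    have "\<rho> j \<le> r1 * 1" unfolding \<rho>_def using r1 by (intro mult_left_mono power_le_one) auto
    then show "\<rho> j < r0" using r1 by simp
  qed
  define A where "A j = {x \<in> G. d x < \<rho> j}" for j
  have [measurable]: "d \<in> borel_measurable borel"
    unfolding d_def by (intro borel_measurable_continuous_onI continuous_intros)
  have [measurable]: "G \<in> sets borel" using assms by auto
  have [measurable]: "A j \<in> sets borel" for j unfolding A_def by measurable
  have mA: "emeasure lborel (A j) \<le> ennreal (M * \<rho> j powr (n - lam'))" for j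
  proof -
    have "A j \<subseteq> (\<Union>x\<in>frontier G. ball x (\<rho> j))"
    proof
      fix x assume "x \<in> A j"
      then have "infdist x (frontier G) < \<rho> j" by (simp add: A_def d_def)
      then obtain y where "y \<in> frontier G" "dist x y < \<rho> j"
        using infdist_attains_inf[OF frontier_closed assms(3), of x] by metis
      then show "x \<in> (\<Union>x\<in>frontier G. ball x (\<rho> j))" by (auto simp: dist_commute)
    qed
    moreover have "open (\<Union>x\<in>frontier G. ball x (\<rho> j))" by auto
    then have "(\<Union>x\<in>frontier G. ball x (\<rho> j)) \<in> sets borel" by (rule borel_open)
    ultimately have "emeasure lebesgue (A j) \<le> emeasure lebesgue (\<Union>x\<in>frontier G. ball x (\<rho> j))"
      by (intro emeasure_mono) auto
    also have "\<dots> \<le> ennreal (M * \<rho> j powr (n - lam'))" using M \<rho> by blast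
    finally show ?thesis by simp
  qed
  have single: "g j \<le> (\<Sum>j. g j)" for g :: "nat \<Rightarrow> ennreal" and j
    using sum_le_suminf[of g "{j}"] by simp
  have pw: "ennreal (d x powr (- s)) * indicator G x \<le>
      ennreal (r1 powr (- s)) * indicator G x + (\<Sum>j. ennreal (\<rho> (Suc j) powr (- s)) * indicator (A j) x)" for x
  proof (cases "x \<in> G \<and> d x < r1")
    case False
    then have "ennreal (d x powr (- s)) * indicator G x \<le> ennreal (r1 powr (- s)) * indicator G x"
      using r1 assms(7) by (auto split: split_indicator intro!: ennreal_leI powr_mono2')
    then show ?thesis by (rule order_trans) simp
  next
    case True
    have dx: "d x > 0" using True pos by (simp add: d_def)
    have "(\<lambda>j. r1 * (1/2) ^ j) \<longlonglongrightarrow> r1 * 0" by (intro tendsto_intros LIMSEQ_power_zero) auto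
    then have "eventually (\<lambda>j. r1 * (1/2) ^ j < d x) sequentially"
      using dx by (simp add: order_tendstoD(2))
    then obtain j0 where "\<rho> j0 < d x" unfolding \<rho>_def eventually_sequentially by auto
    then have ex: "\<exists>j. \<rho> j \<le> d x" by (auto intro: less_imp_le)
    \<comment> \<open>The first radius not exceeding \<open>d x\<close>. It is not the initial one
      because \<open>d x < r1\<close>, and its predecessor puts \<open>x\<close> into
      \<open>A j\<close>.\<close>
    define k where "k = (LEAST j. \<rho> j \<le> d x)"
    have k: "\<rho> k \<le> d x" unfolding k_def using ex by (rule LeastI_ex)
    have "k \<noteq> 0"
    proof
      assume "k = 0"
      then show False using k True by (simp add: \<rho>_def)
    qed
    then obtain j where j: "k = Suc j" using not0_implies_Suc by blast
    have "\<not> \<rho> j \<le> d x" using not_less_Least[of j "\<lambda>j. \<rho> j \<le> d x"] unfolding k_def[symmetric] j by simp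
    then have xA: "x \<in> A j" using True by (simp add: A_def)
    have "ennreal (d x powr (- s)) * indicator G x \<le> ennreal (\<rho> (Suc j) powr (- s)) * indicator (A j) x"
      using True xA k j \<rho>(1)[of "Suc j"] assms(7) by (auto intro!: ennreal_leI powr_mono2')
    also have "\<dots> \<le> (\<Sum>j. ennreal (\<rho> (Suc j) powr (- s)) * indicator (A j) x)"
      by (rule single)
    also have "\<dots> \<le> ennreal (r1 powr (- s)) * indicator G x + \<dots>" by simp
    finally show ?thesis .
  qed
  define K where "K = (1/2) powr (- s) * M * r1 powr (n - lam' - s)"
  define \<theta> where "\<theta> = (1/2::real) powr (n - lam' - s)"
  have \<theta>: "0 < \<theta>" "\<theta> < 1" using lam' by (auto simp: \<theta>_def powr01_less_one)
  have K: "K \<ge> 0" using r0 by (simp add: K_def)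
  have mterm: "(\<integral>\<^sup>+x. ennreal (\<rho> (Suc j) powr (- s)) * indicator (A j) x \<partial>lborel) \<le> ennreal (K * \<theta> ^ j)" for j
  proof -
    have "(\<integral>\<^sup>+x. ennreal (\<rho> (Suc j) powr (- s)) * indicator (A j) x \<partial>lborel) =
        ennreal (\<rho> (Suc j) powr (- s)) * emeasure lborel (A j)"
      by (rule nn_integral_cmult_indicator) auto
    also have "\<dots> \<le> ennreal (\<rho> (Suc j) powr (- s)) * ennreal (M * \<rho> j powr (n - lam'))"
      by (intro mult_left_mono mA) auto
    also have "\<dots> = ennreal (\<rho> (Suc j) powr (- s) * (M * \<rho> j powr (n - lam')))"
      using r0 by (simp add: ennreal_mult)
    also have "\<rho> (Suc j) powr (- s) * (M * \<rho> j powr (n - lam')) = K * \<theta> ^ j"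
    proof -
      have "\<rho> (Suc j) = (1/2) * \<rho> j" by (simp add: \<rho>_def)
      then have "\<rho> (Suc j) powr (- s) * (M * \<rho> j powr (n - lam')) = (1/2) powr (- s) * M * (\<rho> j powr (- s) * \<rho> j powr (n - lam'))"
        by (simp only: powr_mult) (simp add: mult_ac)
      also have "\<rho> j powr (- s) * \<rho> j powr (n - lam') = \<rho> j powr (n - lam' - s)"
        by (simp add: powr_add[symmetric])
      also have "\<dots> = r1 powr (n - lam' - s) * ((1/2) ^ j) powr (n - lam' - s)"
        by (simp only: \<rho>_def powr_mult)
      also have "((1/2::real) ^ j) powr (n - lam' - s) = \<theta> ^ j"
        by (simp add: \<theta>_def powr_realpow[symmetric] powr_powr mult.commute)
      finally show ?thesis by (simp add: K_def)
    qed
    finally show ?thesis .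
  qed
  have "(\<integral>\<^sup>+x\<in>G. ennreal (d x powr (- s)) \<partial>lborel) \<le>
     (\<integral>\<^sup>+x. ennreal (r1 powr (- s)) * indicator G x + (\<Sum>j. ennreal (\<rho> (Suc j) powr (- s)) * indicator (A j) x) \<partial>lborel)"
    using pw by (intro nn_integral_mono) auto
  also have "\<dots> = (\<integral>\<^sup>+x. ennreal (r1 powr (- s)) * indicator G x \<partial>lborel) +
      (\<Sum>j. \<integral>\<^sup>+x. ennreal (\<rho> (Suc j) powr (- s)) * indicator (A j) x \<partial>lborel)"
    by (simp add: nn_integral_add nn_integral_suminf)
  also have "\<dots> \<le> ennreal (r1 powr (- s)) * emeasure lborel G + (\<Sum>j. ennreal (K * \<theta> ^ j))"
    by (intro add_mono suminf_le mterm) (auto simp: nn_integral_cmult_indicator)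
  also have "(\<Sum>j. ennreal (K * \<theta> ^ j)) = ennreal (\<Sum>j. K * \<theta> ^ j)"
    using K \<theta> by (intro suminf_ennreal2) (auto intro!: summable_mult summable_geometric)
  also have "ennreal (r1 powr (- s)) * emeasure lborel G + \<dots> < \<infinity>"
    using emeasure_bounded_finite[OF assms(2)] by (simp add: ennreal_mult_less_top)
  finally show ?thesis by (simp add: d_def)
qed

section \<open>The chain kernel\<close>

lemma powr_comparable:
  fixes a x e :: real
  assumes "0 < a" "a \<le> 2 * x" "x \<le> 2 * a"
  shows "x powr e \<le> 2 powr \<bar>e\<bar> * a powr e"
proof (cases "e \<ge> 0")
  case True
  have "x powr e \<le> (2 * a) powr e" using True assms by (intro powr_mono2) auto
  then show ?thesis using True by (simp add: powr_mult)
next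
  case False
  have "x powr e \<le> (a / 2) powr e" using False assms by (intro powr_mono2') auto
  also have "\<dots> = 2 powr (- e) * a powr e" by (simp add: powr_divide powr_minus field_simps)
  finally show ?thesis using False by simp
qed

lemma emeasure_lborel_ball_powr:
  fixes x :: "'a::euclidean_space"
  assumes "r \<ge> 0"
  shows "emeasure lborel (ball x r) = ennreal (unit_ball_vol (real DIM('a)) * r powr real DIM('a))"
  using assms by (simp add: emeasure_ball powr_realpow' )

text \<open>The geometric data in a form that no longer mentions curves or the frontier:
  \<open>d\<close> stands for the boundary distance. In the application \<open>b\<close> is below
  \<open>2 * \<beta> / (1 + \<beta>)\<close>; the dimension \<open>n\<close> is a real number
  because it occurs in exponents.\<close>

locale chain_domain =
  fixes G :: "'a::euclidean_space set" and d :: "'a \<Rightarrow> real" and \<kappa> C0 \<sigma> C b D0 n \<omega> :: real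
    and x0 :: 'a and f :: "'a \<Rightarrow> nat \<Rightarrow> 'a" and N :: "'a \<Rightarrow> nat"
  assumes n_eq: "n = real DIM('a)" and \<omega>_eq: "\<omega> = unit_ball_vol n"
    and open_G: "open G" and bounded_G: "bounded G"
    and d_Lipschitz: "\<bar>d x - d y\<bar> \<le> dist x y"
    and d_pos: "x \<in> G \<Longrightarrow> 0 < d x"
    and d_le: "x \<in> G \<Longrightarrow> d x \<le> D0"
    and ball_subset: "x \<in> G \<Longrightarrow> ball x (d x) \<subseteq> G"
    and \<kappa>: "0 < \<kappa>" "\<kappa> < 1/20"
    and params: "0 < C0" "0 < \<sigma>" "0 < C" "0 < b" "b \<le> 1"
    and x0: "x0 \<in> G"
    and f_0: "z \<in> G \<Longrightarrow> f z 0 = z"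
    and f_N: "z \<in> G \<Longrightarrow> f z (N z) = x0"
    and f_in: "z \<in> G \<Longrightarrow> i \<le> N z \<Longrightarrow> f z i \<in> G"
    and f_step: "z \<in> G \<Longrightarrow> i < N z \<Longrightarrow> dist (f z i) (f z (Suc i)) \<le> \<kappa> * d (f z i)"
    and f_decay: "z \<in> G \<Longrightarrow> i \<le> N z \<Longrightarrow> d (f z i) \<le> C0 * exp (- \<sigma> * real (N z - i))"
    and f_shortest: "z \<in> G \<Longrightarrow> i < j \<Longrightarrow> j \<le> N z \<Longrightarrow> dist (f z i) (f z j) \<le> \<kappa> * d (f z i) \<Longrightarrow> j = Suc i"
    and f_displacement: "z \<in> G \<Longrightarrow> i \<le> N z \<Longrightarrow> dist z (f z i) \<le> C * d (f z i) powr b"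
begin

lemma n_pos: "0 < n" by (simp add: n_eq)

lemma \<omega>_pos: "0 < \<omega>" by (simp add: \<omega>_eq n_eq)

lemma emeasure_ball_powr: "r \<ge> 0 \<Longrightarrow> emeasure lborel (ball (x :: 'a) r) = ennreal (\<omega> * r powr n)"
  by (simp add: emeasure_lborel_ball_powr n_eq \<omega>_eq)

lemma d_continuous: "continuous_on UNIV d"
  unfolding continuous_on_iff using d_Lipschitz by (metis UNIV_I dist_real_def order_le_less_trans)

lemma d_measurable [measurable]: "d \<in> borel_measurable borel"
  by (rule borel_measurable_continuous_onI[OF d_continuous])

lemma G_measurable [measurable]: "G \<in> sets borel" using open_G by auto

lemma near:
  assumes "x \<in> G" "dist x y \<le> c * d x" "c \<le> 1/4"
  shows "y \<in> G" "(1 - c) * d x \<le> d y" "d y \<le> (1 + c) * d x" "d x \<le> 2 * d y" "d y \<le> 2 * d x"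
proof -
  have "c * d x \<le> 1/4 * d x" using assms d_pos[OF assms(1)] by (intro mult_right_mono) auto
  then have le: "dist x y \<le> d x / 4" using assms by simp
  then have "dist x y < d x" using d_pos[OF assms(1)] by simp
  then show "y \<in> G" using ball_subset[OF assms(1)] by auto
  show "(1 - c) * d x \<le> d y" "d y \<le> (1 + c) * d x" "d x \<le> 2 * d y" "d y \<le> 2 * d x"
    using d_Lipschitz[of x y] assms le d_pos[OF assms(1)] by (auto simp: algebra_simps)
qed

definition "net_cover z \<longleftrightarrow> range z \<subseteq> G \<and> (\<forall>x\<in>G. \<exists>k. x \<in> ball (z k) (\<kappa>/4 * d (z k)))" for z :: "nat \<Rightarrow> 'a"

lemma ex_net_cover: "\<exists>z. net_cover z"
proof -
  obtain D :: "'a set" where D: "countable D" "\<And>X. open X \<Longrightarrow> X \<noteq> {} \<Longrightarrow> \<exists>x\<in>D. x \<in> X"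
    using countable_dense_exists by blast
  have ne: "D \<inter> G \<noteq> {}" using D(2)[OF open_G] x0 by auto
  define z where "z = from_nat_into (D \<inter> G)"
  have rz: "range z = D \<inter> G" unfolding z_def using ne D(1) by (intro range_from_nat_into) auto
  have "\<exists>k. x \<in> ball (z k) (\<kappa>/4 * d (z k))" if x: "x \<in> G" for x
  proof -
    have dx: "d x > 0" using d_pos[OF x] .
    \<comment> \<open>Half of the target radius suffices, since \<open>d x\<close> and
      \<open>d y\<close> differ at most by a factor 2.\<close>
    have "x \<in> ball x (\<kappa>/8 * d x)" using dx \<kappa> by simp
    then obtain y where y: "y \<in> D" "dist x y < \<kappa>/8 * d x" using D(2)[of "ball x (\<kappa>/8 * d x)"] by auto
    have n: "y \<in> G" "d x \<le> 2 * d y" using near[OF x, of y "\<kappa>/8"] y \<kappa> by auto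
    have "\<kappa>/8 * d x \<le> \<kappa>/8 * (2 * d y)" using n \<kappa> by (intro mult_left_mono) auto
    then have "x \<in> ball y (\<kappa>/4 * d y)" using y by (simp add: dist_commute)
    then show ?thesis using rz y n by (metis IntI rangeE)
  qed
  then show ?thesis using rz unfolding net_cover_def by blast
qed

definition net :: "nat \<Rightarrow> 'a" where "net = (SOME z. net_cover z)"

lemma net_cover_net: "net_cover net" unfolding net_def using ex_net_cover by (rule someI_ex)

lemma net_in: "net k \<in> G" using net_cover_net by (auto simp: net_cover_def)

text \<open>Taking the least index makes the cells disjoint, so they form a countable Borel
  partition of \<open>G\<close>.\<close>

definition cell :: "'a \<Rightarrow> nat" where "cell x = (LEAST k. x \<in> ball (net k) (\<kappa>/4 * d (net k)))"

lemma cell_measurable [measurable]: "cell \<in> measurable borel (count_space UNIV)"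
  unfolding cell_def mem_ball by measurable

lemma dist_net_cell:
  assumes "x \<in> G"
  shows "dist (net (cell x)) x < \<kappa>/4 * d (net (cell x))"
proof -
  have "\<exists>k. x \<in> ball (net k) (\<kappa>/4 * d (net k))" using net_cover_net assms by (auto simp: net_cover_def)
  then have "x \<in> ball (net (cell x)) (\<kappa>/4 * d (net (cell x)))" unfolding cell_def by (rule LeastI_ex)
  then show ?thesis by simp
qed

definition chain_ball :: "'a \<Rightarrow> nat \<Rightarrow> 'a set" where
  "chain_ball z i = ball (f z i) (\<kappa>/4 * d (f z i))"

text \<open>Using one chain per cell keeps the kernel measurable in \<open>x\<close>. Outside \<open>G\<close> the index \<open>cell x\<close> is
  junk, hence the indicator.\<close>

definition kernel :: "'a \<Rightarrow> 'a \<Rightarrow> ennreal" where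
  "kernel x y = indicator G x * (\<Sum>i\<le>N (net (cell x)). indicator (chain_ball (net (cell x)) i) y)"

lemma chain_ball_measurable [measurable]: "chain_ball z i \<in> sets borel"
  by (simp add: chain_ball_def)

lemma kernel_measurable [measurable]: "case_prod kernel \<in> borel_measurable (borel \<Otimes>\<^sub>M borel)"
proof -
  have "(\<lambda>p. \<Sum>i\<le>N (net (cell (fst p))). indicator (chain_ball (net (cell (fst p))) i) (snd p) :: ennreal)
      \<in> borel_measurable (borel \<Otimes>\<^sub>M borel)"
    by (rule measurable_compose_countable[where f = "\<lambda>k p. \<Sum>i\<le>N (net k). indicator (chain_ball (net k) i) (snd p)"]) measurable
  then show ?thesis unfolding kernel_def case_prod_beta' by measurable
qed

lemma kernel_measurable' [measurable (raw)]:
  assumes "g \<in> measurable M borel" "h \<in> measurable M borel"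
  shows "(\<lambda>x. kernel (g x) (h x)) \<in> borel_measurable M"
proof -
  have "(\<lambda>x. (g x, h x)) \<in> measurable M (borel \<Otimes>\<^sub>M borel)" using assms by measurable
  from measurable_compose[OF this kernel_measurable] show ?thesis by simp
qed

lemma chain_ball_near:
  assumes "z \<in> G" "i \<le> N z" "y \<in> chain_ball z i"
  shows "y \<in> G" "d (f z i) \<le> 2 * d y" "d y \<le> 2 * d (f z i)" "79/80 * d (f z i) \<le> d y"
proof -
  have fz: "f z i \<in> G" using f_in assms by auto
  have "dist (f z i) y \<le> \<kappa>/4 * d (f z i)" using assms(3) by (auto simp: chain_ball_def)
  note near[OF fz this]
  note n = this(1)[OF _ ] this(2-5)
  have k: "\<kappa>/4 \<le> 1/4" using \<kappa> by simp
  show "y \<in> G" "d (f z i) \<le> 2 * d y" "d y \<le> 2 * d (f z i)" using n k by auto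
  \<comment> \<open>\<open>79/80\<close> is the value of \<open>1 - \<kappa>/4\<close> at
    \<open>\<kappa> = 1/20\<close>.\<close>
  have "79/80 * d (f z i) \<le> (1 - \<kappa>/4) * d (f z i)" using \<kappa> d_pos[OF fz] by (intro mult_right_mono) auto
  then show "79/80 * d (f z i) \<le> d y" using n(2)[OF k] by linarith
qed

text \<open>If \<open>y\<close> lies in the balls of indices \<open>i < j\<close>, then
  \<open>f z j\<close> is within \<open>\<kappa> * d (f z i)\<close> of \<open>f z i\<close>, and a
  shortest chain allows this only for \<open>j = Suc i\<close>. So the indices are among the
  smallest one and its successor.\<close>

lemma chain_multiplicity:
  assumes "z \<in> G"
  shows "(\<Sum>i\<le>N z. indicator (chain_ball z i) y :: ennreal) \<le> 2"
proof -
  define I where "I = {i. i \<le> N z \<and> y \<in> chain_ball z i}"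
  have succ: "j = Suc i" if "i \<in> I" "j \<in> I" "i < j" for i j
  proof -
    define a where "a = f z i"
    have ai: "a \<in> G" using f_in[OF assms] that by (auto simp: I_def a_def)
    have da: "d a > 0" using d_pos ai by auto
    have ya: "dist a y < \<kappa>/4 * d a" using that by (auto simp: I_def chain_ball_def a_def)
    have yj: "dist (f z j) y < \<kappa>/4 * d (f z j)" using that by (auto simp: I_def chain_ball_def)
    have j: "79/80 * d (f z j) \<le> d y" "d y \<le> (1 + \<kappa>/4) * d a"
      using chain_ball_near(4)[OF assms, of j y] near(3)[OF ai less_imp_le[OF ya]] that \<kappa> by (auto simp: I_def)
    have "(1 + \<kappa>/4) * d a \<le> 81/80 * d a" using \<kappa> da by (intro mult_right_mono) auto
    \<comment> \<open>The factor obtained is \<open>81/79\<close>; even with 2 in its place,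
      \<open>\<kappa>/4 + \<kappa>/2\<close> stays below \<kappa>.\<close>
    then have "d (f z j) \<le> 2 * d a" using j da by linarith
    then have "\<kappa>/4 * d (f z j) \<le> \<kappa>/4 * (2 * d a)" using \<kappa> by (intro mult_left_mono) auto
    then have "dist a (f z j) \<le> \<kappa>/4 * d a + \<kappa>/4 * (2 * d a)"
      using dist_triangle2[of a "f z j" y] ya yj by linarith
    also have "\<dots> \<le> \<kappa> * d a" using \<kappa> da by simp
    finally show ?thesis using f_shortest[OF assms \<open>i < j\<close>] that by (auto simp: I_def a_def)
  qed
  have fin: "finite I" by (auto simp: I_def intro: finite_subset[of _ "{..N z}"])
  have "card I \<le> 2"
  proof (cases "I = {}")
    case False
    define i where "i = Min I"
    have i: "i \<in> I" "\<And>j. j \<in> I \<Longrightarrow> i \<le> j" using fin False by (auto simp: i_def)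
    have "I \<subseteq> {i, Suc i}" using succ[OF i(1)] i(2) by (metis insert_iff le_neq_implies_less subsetI)
    then have "card I \<le> card {i, Suc i}" by (intro card_mono) auto
    then show ?thesis by simp
  qed simp
  have "(\<Sum>i\<le>N z. indicator (chain_ball z i) y :: ennreal) = (\<Sum>i\<in>I. 1)"
  proof -
    have "I = {i \<in> {..N z}. y \<in> chain_ball z i}" by (auto simp: I_def)
    then have "(\<Sum>i\<in>I. 1 :: ennreal) = (\<Sum>i\<le>N z. if y \<in> chain_ball z i then 1 else 0)"
      by (simp only: sum.inter_filter[OF finite_atMost])
    also have "\<dots> = (\<Sum>i\<le>N z. indicator (chain_ball z i) y)"
      by (intro sum.cong) auto
    finally show ?thesis by simp
  qed
  also have "\<dots> = of_nat (card I)" by simp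
  also have "\<dots> \<le> of_nat 2" using \<open>card I \<le> 2\<close> by (rule of_nat_mono)
  finally show ?thesis by simp
qed

lemma kernel_le_2: "kernel x y \<le> 2"
  using chain_multiplicity[OF net_in[of "cell x"], of y] by (auto simp: kernel_def split: split_indicator)

text \<open>Dominates \<open>C + D0 powr (1 - b)\<close>, the factor that arises in
  \<open>kernel_support\<close>.\<close>

definition "C2 = C + (1 + C) * (D0 powr (1 - b) + 1)"

text \<open>The chain from the net point of the cell of \<open>x\<close> passes near
  \<open>y\<close>, so the displacement bound controls \<open>dist x y\<close>; lengths of order
  \<open>d\<close> are absorbed into \<open>d powr b\<close> because \<open>b \<le> 1\<close> and
  \<open>d \<le> D0\<close>. The third claim bounds shadows, the fourth trades negative powers of
  \<open>d y\<close> for those of \<open>d x\<close>.\<close>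

lemma kernel_support:
  assumes "kernel x y \<noteq> 0"
  shows "x \<in> G" "y \<in> G" "dist x y \<le> 2 * C2 * 2 powr b * d y powr b" 
    "d x \<le> (2 * C2 * 2 powr b + D0 powr (1 - b)) * d y powr b"
proof -
  show x: "x \<in> G" using assms by (auto simp: kernel_def split: split_indicator_asm)
  define z where "z = net (cell x)"
  have z: "z \<in> G" by (simp add: z_def net_in)
  obtain i where i: "i \<le> N z" "y \<in> chain_ball z i"
    using assms by (auto simp: kernel_def z_def indicator_eq_0_iff split: split_indicator_asm)
  define a where "a = f z i"
  have a: "a \<in> G" using f_in[OF z i(1)] by (simp add: a_def)
  have nr: "y \<in> G" "d a \<le> 2 * d y" "d y \<le> 2 * d a" using chain_ball_near[OF z i] by (auto simp: a_def)
  show "y \<in> G" by fact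
  have lin: "d y \<le> D0 powr (1 - b) * d y powr b" if "y \<in> G" for y
  proof -
    have "d y = d y powr (1 - b) * d y powr b" using d_pos[OF that] by (simp add: powr_add[symmetric])
    also have "\<dots> \<le> D0 powr (1 - b) * d y powr b"
      using d_pos[OF that] d_le[OF that] params by (intro mult_right_mono powr_mono2) auto
    finally show ?thesis .
  qed
  have za: "dist z a \<le> C * d a powr b" using f_displacement[OF z i(1)] by (simp add: a_def)
  have small: "\<kappa>/4 * d y \<le> d y" if "y \<in> G" for y
    using mult_right_mono[of "\<kappa>/4" 1 "d y"] \<kappa> d_pos[OF that] by simp
  have zx: "dist z x \<le> d z" using dist_net_cell[OF x] small[OF z] unfolding z_def by linarith
  have dz: "d z \<le> d a + dist z a" using d_Lipschitz[of z a] by linarith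
  have ay: "dist a y \<le> d a" using i(2) small[OF a] by (simp add: chain_ball_def a_def)
  have "dist x y \<le> dist z x + dist z a + dist a y"
    using dist_triangle[of x y z] dist_triangle[of z y a] by (simp add: dist_commute)
  also have "\<dots> \<le> 2 * dist z a + 2 * d a" using zx dz ay by linarith
  also have "\<dots> \<le> 2 * (C * d a powr b) + 2 * (D0 powr (1 - b) * d a powr b)" using za lin[OF a] by linarith
  also have "\<dots> = 2 * (C + D0 powr (1 - b)) * d a powr b" by (simp add: algebra_simps)
  also have "\<dots> \<le> 2 * C2 * (2 * d y) powr b"
    using params nr d_pos[OF a] by (intro mult_mono powr_mono2) (auto simp: C2_def algebra_simps)
  finally show *: "dist x y \<le> 2 * C2 * 2 powr b * d y powr b" by (simp add: powr_mult mult.assoc)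
  have "d x \<le> dist x y + d y" using d_Lipschitz[of x y] by linarith
  also have "\<dots> \<le> 2 * C2 * 2 powr b * d y powr b + D0 powr (1 - b) * d y powr b" using * lin[OF nr(1)] by linarith
  finally show "d x \<le> (2 * C2 * 2 powr b + D0 powr (1 - b)) * d y powr b" by (simp add: algebra_simps)
qed

lemma C2_pos: "C2 > 0" using params by (auto simp: C2_def intro!: add_pos_nonneg)

definition "S0 = 2 * \<omega> * (2 * C2 * 2 powr b + 1) powr n"

text \<open>The points whose chain meets \<open>y\<close> lie in one ball of radius of order
  \<open>d y powr b\<close>, and each counts at most twice.\<close>

lemma kernel_shadow:
  assumes "y \<in> G"
  shows "(\<integral>\<^sup>+x. kernel x y \<partial>lborel) \<le> ennreal (S0 * d y powr (b * n))"
proof -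
  define R where "R = (2 * C2 * 2 powr b + 1) * d y powr b"
  note C2 = C2_pos
  have R: "R \<ge> 0" using C2 by (simp add: R_def)
  have dy: "d y > 0" using d_pos[OF assms] .
  have "kernel x y \<le> 2 * indicator (ball y R) x" for x
  proof (cases "kernel x y = 0")
    case False
    have "dist x y \<le> 2 * C2 * 2 powr b * d y powr b" using kernel_support(3)[OF False] .
    also have "\<dots> < R" using dy by (simp add: R_def algebra_simps)
    finally show ?thesis using kernel_le_2[of x y] by (simp add: dist_commute)
  qed simp
  then have "(\<integral>\<^sup>+x. kernel x y \<partial>lborel) \<le> (\<integral>\<^sup>+x. 2 * indicator (ball y R) x \<partial>lborel)"
    by (intro nn_integral_mono) auto
  also have "\<dots> = 2 * emeasure lborel (ball y R)" by (rule nn_integral_cmult_indicator) auto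
  also have "\<dots> = ennreal (2 * (\<omega> * R powr n))"
    unfolding emeasure_ball_powr[OF R] using \<omega>_pos by (subst ennreal_mult) auto
  also have "2 * (\<omega> * R powr n) = S0 * d y powr (b * n)"
    using C2 by (simp add: R_def S0_def powr_mult powr_powr)
  finally show ?thesis .
qed

text \<open>A chain ball contributes about \<open>d (f z i) powr \<epsilon>\<close>, since its
  volume cancels the power \<open>- n\<close>. These contributions decay geometrically in the number
  of steps left to \<open>x0\<close>, uniformly over all chains. This is the measure to which
  Jensen's inequality is applied.\<close>

lemma kernel_mass:
  assumes "\<epsilon> > 0"
  obtains K where "K > 0" "\<And>x. (\<integral>\<^sup>+y. kernel x y * ennreal (d y powr (\<epsilon> - n)) \<partial>lborel) \<le> ennreal K"
proof -
  define c where "c = 2 powr \<bar>\<epsilon> - n\<bar> * (\<omega> * (\<kappa>/4) powr n)"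
  define q where "q = exp (- (\<sigma> * \<epsilon>))"
  have q: "0 < q" "q < 1" using assms params by (auto simp: q_def)
  have c: "c > 0" using \<kappa> \<omega>_pos by (simp add: c_def)
  define K where "K = c * C0 powr \<epsilon> * (1 / (1 - q))"
  have K: "K > 0" using c q params by (simp add: K_def)
  show thesis
  proof (rule that[OF K])
    fix x
    show "(\<integral>\<^sup>+y. kernel x y * ennreal (d y powr (\<epsilon> - n)) \<partial>lborel) \<le> ennreal K"
    proof (cases "x \<in> G")
      case True
      define z where "z = net (cell x)"
      have z: "z \<in> G" by (simp add: z_def net_in)
      have one: "(\<integral>\<^sup>+y. indicator (chain_ball z i) y * ennreal (d y powr (\<epsilon> - n)) \<partial>lborel)
        \<le> ennreal (c * C0 powr \<epsilon> * q ^ (N z - i))" if i: "i \<le> N z" for i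
      proof -
        define a where "a = d (f z i)"
        have a: "a > 0" using d_pos f_in[OF z i] by (simp add: a_def)
        have "(\<integral>\<^sup>+y. indicator (chain_ball z i) y * ennreal (d y powr (\<epsilon> - n)) \<partial>lborel) \<le>
          (\<integral>\<^sup>+y. ennreal (2 powr \<bar>\<epsilon> - n\<bar> * a powr (\<epsilon> - n)) * indicator (chain_ball z i) y \<partial>lborel)"
          using chain_ball_near[OF z i] a unfolding a_def
          by (intro nn_integral_mono) (auto split: split_indicator intro!: ennreal_leI powr_comparable)
        also have "\<dots> = ennreal (2 powr \<bar>\<epsilon> - n\<bar> * a powr (\<epsilon> - n)) * emeasure lborel (chain_ball z i)"
          by (rule nn_integral_cmult_indicator) auto
        also have "\<dots> = ennreal (2 powr \<bar>\<epsilon> - n\<bar> * a powr (\<epsilon> - n)) * ennreal (\<omega> * (\<kappa>/4 * a) powr n)"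
          unfolding chain_ball_def a_def[symmetric] using a \<kappa> by (subst emeasure_ball_powr) auto
        also have "\<dots> = ennreal (2 powr \<bar>\<epsilon> - n\<bar> * a powr (\<epsilon> - n) * (\<omega> * (\<kappa>/4 * a) powr n))"
          using \<omega>_pos by (intro ennreal_mult[symmetric]) auto
        also have "2 powr \<bar>\<epsilon> - n\<bar> * a powr (\<epsilon> - n) * (\<omega> * (\<kappa>/4 * a) powr n) = c * (a powr (\<epsilon> - n) * a powr n)"
          unfolding powr_mult c_def by simp
        also have "a powr (\<epsilon> - n) * a powr n = a powr \<epsilon>" by (simp add: powr_add[symmetric])
        also have "ennreal (c * a powr \<epsilon>) \<le> ennreal (c * (C0 * exp (- \<sigma> * real (N z - i))) powr \<epsilon>)"
          using f_decay[OF z i] c a assms unfolding a_def by (intro ennreal_leI mult_left_mono powr_mono2) auto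
        also have "(C0 * exp (- \<sigma> * real (N z - i))) powr \<epsilon> = C0 powr \<epsilon> * q ^ (N z - i)"
          unfolding powr_mult by (simp add: powr_def q_def exp_of_nat_mult[symmetric] mult_ac)
        finally show ?thesis by (simp add: mult.assoc)
      qed
      have "(\<integral>\<^sup>+y. kernel x y * ennreal (d y powr (\<epsilon> - n)) \<partial>lborel) =
         (\<integral>\<^sup>+y. (\<Sum>i\<le>N z. indicator (chain_ball z i) y * ennreal (d y powr (\<epsilon> - n))) \<partial>lborel)"
        using True by (simp add: kernel_def z_def sum_distrib_right)
      also have "\<dots> = (\<Sum>i\<le>N z. \<integral>\<^sup>+y. indicator (chain_ball z i) y * ennreal (d y powr (\<epsilon> - n)) \<partial>lborel)"
        by (rule nn_integral_sum) auto
      also have "\<dots> \<le> (\<Sum>i\<le>N z. ennreal (c * C0 powr \<epsilon> * q ^ (N z - i)))"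
        by (intro sum_mono one) auto
      also have "\<dots> = ennreal (\<Sum>i\<le>N z. c * C0 powr \<epsilon> * q ^ (N z - i))"
        using c q by (intro sum_ennreal) auto
      also have "(\<Sum>i\<le>N z. c * C0 powr \<epsilon> * q ^ (N z - i)) = c * C0 powr \<epsilon> * (\<Sum>i\<le>N z. q ^ i)"
        using sum.nat_diff_reindex[of "\<lambda>k. q ^ k" "Suc (N z)"] by (simp add: lessThan_Suc_atMost sum_distrib_left[symmetric])
      also have "ennreal (c * C0 powr \<epsilon> * (\<Sum>i\<le>N z. q ^ i)) \<le> ennreal K"
      proof -
        have "(\<Sum>i\<le>N z. q ^ i) \<le> (\<Sum>i. q ^ i)"
          using q by (intro sum_le_suminf summable_geometric) auto
        also have "(\<Sum>i. q ^ i) = 1 / (1 - q)" using q by (intro suminf_geometric) auto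
        finally show ?thesis unfolding K_def using c by (intro ennreal_leI mult_left_mono) auto
      qed
      finally show ?thesis .
    qed (simp add: kernel_def)
  qed
qed

end

section \<open>Oscillation estimates\<close>

lemma ennreal_le_divide_const:
  assumes "M > 0" "a \<ge> 0" "ennreal M * X \<le> ennreal a * Y"
  shows "X \<le> ennreal (a / M) * Y"
proof -
  have "X = ennreal (1 / M) * (ennreal M * X)"
    using assms(1) by (simp add: mult.assoc[symmetric] ennreal_mult[symmetric])
  also have "\<dots> \<le> ennreal (1 / M) * (ennreal a * Y)" using assms(3) by (intro mult_left_mono) auto
  also have "\<dots> = ennreal (a / M) * Y"
    using assms by (simp add: mult.assoc[symmetric] ennreal_mult[symmetric])
  finally show ?thesis .
qed

lemma ennreal_abs_triangle:
  fixes a b c :: real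
  assumes "\<bar>a\<bar> \<le> \<bar>b\<bar> + \<bar>c\<bar>"
  shows "ennreal \<bar>a\<bar> \<le> ennreal \<bar>b\<bar> + ennreal \<bar>c\<bar>"
  using ennreal_leI[OF assms] by simp

lemma average_diff_le:
  fixes u :: "'a::euclidean_space \<Rightarrow> real"
  assumes u: "integrable lborel u" and [measurable]: "B \<in> sets borel"
    and m: "emeasure lborel B = ennreal m" "0 < m"
  shows "ennreal m * ennreal \<bar>(\<integral>x. indicator B x * u x \<partial>lborel) / m - a\<bar> \<le> (\<integral>\<^sup>+x. indicator B x * ennreal \<bar>u x - a\<bar> \<partial>lborel)"
proof -
  have i1: "integrable lborel (\<lambda>x. indicator B x * u x)"
    using integrable_mult_indicator[OF _ u, of B] by simp
  have i2: "integrable lborel (\<lambda>x. indicator B x * a)" using m by auto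
  have "measure lborel B = m" using m by (simp add: measure_def)
  then have "(\<integral>x. indicator B x * (u x - a) \<partial>lborel) = (\<integral>x. indicator B x * u x \<partial>lborel) - m * a"
    using i1 i2 by (simp add: right_diff_distrib)
  also have "\<dots> = m * ((\<integral>x. indicator B x * u x \<partial>lborel) / m - a)" using m by (simp add: algebra_simps)
  finally have e: "m * ((\<integral>x. indicator B x * u x \<partial>lborel) / m - a) = (\<integral>x. indicator B x * (u x - a) \<partial>lborel)" ..
  have "ennreal m * ennreal \<bar>(\<integral>x. indicator B x * u x \<partial>lborel) / m - a\<bar> =
      ennreal (norm (m * ((\<integral>x. indicator B x * u x \<partial>lborel) / m - a)))"
    using m by (simp add: ennreal_mult[symmetric] abs_mult)
  also have "\<dots> \<le> (\<integral>\<^sup>+x. ennreal (norm (indicator B x * (u x - a))) \<partial>lborel)"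
    unfolding e by (rule norm_integral_le_nn_integral)
  also have "\<dots> = (\<integral>\<^sup>+x. indicator B x * ennreal \<bar>u x - a\<bar> \<partial>lborel)"
    by (intro nn_integral_cong) (auto split: split_indicator)
  finally show ?thesis .
qed

text \<open>For fixed \<open>h\<close> and \<open>t\<close> the shift by
  \<open>t *\<^sub>R h\<close> preserves Lebesgue measure, so the integral over \<open>t\<close>
  averages equal values.\<close>

lemma nn_integral_segments:
  fixes J :: "'a::euclidean_space \<Rightarrow> 'a \<Rightarrow> ennreal"
  assumes J[measurable]: "case_prod J \<in> borel_measurable (borel \<Otimes>\<^sub>M borel)"
  shows "(\<integral>\<^sup>+s. (\<integral>\<^sup>+h. (\<integral>\<^sup>+t. indicator {0..1::real} t * J h (s + t *\<^sub>R h) \<partial>lborel) \<partial>lborel) \<partial>lborel) =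
    (\<integral>\<^sup>+h. (\<integral>\<^sup>+z. J h z \<partial>lborel) \<partial>lborel)"
proof -
  have J': "(\<lambda>x. J (g x) (k x)) \<in> borel_measurable M"
    if "g \<in> measurable M borel" "k \<in> measurable M borel" for M and g k :: "'b \<Rightarrow> 'a"
  proof -
    have "(\<lambda>x. (g x, k x)) \<in> measurable M (borel \<Otimes>\<^sub>M borel)" using that by measurable
    from measurable_compose[OF this J] show ?thesis by simp
  qed
  have "(\<integral>\<^sup>+s. (\<integral>\<^sup>+h. (\<integral>\<^sup>+t. indicator {0..1::real} t * J h (s + t *\<^sub>R h) \<partial>lborel) \<partial>lborel) \<partial>lborel) =
    (\<integral>\<^sup>+h. (\<integral>\<^sup>+s. (\<integral>\<^sup>+t. indicator {0..1::real} t * J h (s + t *\<^sub>R h) \<partial>lborel) \<partial>lborel) \<partial>lborel)"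
    by (rule lborel_pair.Fubini'[symmetric])
       (auto simp: case_prod_beta' intro!: lborel.borel_measurable_nn_integral borel_measurable_times_ennreal J')
  also have "\<dots> = (\<integral>\<^sup>+h. (\<integral>\<^sup>+t. (\<integral>\<^sup>+s. indicator {0..1::real} t * J h (s + t *\<^sub>R h) \<partial>lborel) \<partial>lborel) \<partial>lborel)"
    by (intro nn_integral_cong lborel_pair.Fubini'[symmetric])
       (auto simp: case_prod_beta' intro!: borel_measurable_times_ennreal J')
  also have "\<dots> = (\<integral>\<^sup>+h. (\<integral>\<^sup>+t. indicator {0..1::real} t * (\<integral>\<^sup>+z. J h z \<partial>lborel) \<partial>lborel) \<partial>lborel)"
  proof (intro nn_integral_cong)
    fix h :: 'a and t :: real
    have m: "J h \<in> borel_measurable borel" by (rule J') auto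
    have "(\<integral>\<^sup>+s. indicator {0..1::real} t * J h (s + t *\<^sub>R h) \<partial>lborel) = indicator {0..1} t * (\<integral>\<^sup>+s. J h (s + t *\<^sub>R h) \<partial>lborel)"
      by (rule nn_integral_cmult) (auto intro!: J')
    also have "(\<integral>\<^sup>+s. J h (s + t *\<^sub>R h) \<partial>lborel) = (\<integral>\<^sup>+z. J h z \<partial>lborel)"
      by (rule nn_integral_lborel_translate[OF m])
    finally show "(\<integral>\<^sup>+s. indicator {0..1::real} t * J h (s + t *\<^sub>R h) \<partial>lborel) = indicator {0..1} t * (\<integral>\<^sup>+z. J h z \<partial>lborel)" .
  qed
  also have "\<dots> = (\<integral>\<^sup>+h. (\<integral>\<^sup>+z. J h z \<partial>lborel) \<partial>lborel)"
    by (intro nn_integral_cong) (simp add: nn_integral_multc)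
  finally show ?thesis .
qed

section \<open>Averages over balls and their differences along chains\<close>

context chain_domain
begin

text \<open>All that is retained of a Sobolev function and the norm \<open>w\<close> of its
  gradient. The exceptional set of \<open>h\<close> may depend on \<open>x\<close>, as the estimates
  below fix \<open>x\<close> and integrate over \<open>h\<close>.\<close>

definition controlled :: "('a \<Rightarrow> real) \<Rightarrow> ('a \<Rightarrow> real) \<Rightarrow> bool" where
  "controlled u w \<longleftrightarrow> integrable lborel u \<and> w \<in> borel_measurable borel \<and> (\<forall>x. 0 \<le> w x) \<and>
    (AE x in lborel. AE h in lborel. x \<in> G \<and> norm h < d x \<longrightarrow>
      ennreal \<bar>u (x + h) - u x\<bar> \<le> (\<integral>\<^sup>+t\<in>{0..1}. ennreal (norm h * w (x + t *\<^sub>R h)) \<partial>lborel))"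

lemma controlledD:
  assumes "controlled u w"
  shows "integrable lborel u" "u \<in> borel_measurable borel" "w \<in> borel_measurable borel" "0 \<le> w x"
    "AE x in lborel. AE h in lborel. x \<in> G \<and> norm h < d x \<longrightarrow>
      ennreal \<bar>u (x + h) - u x\<bar> \<le> (\<integral>\<^sup>+t\<in>{0..1}. ennreal (norm h * w (x + t *\<^sub>R h)) \<partial>lborel)"
  using assms borel_measurable_integrable[of lborel u] by (auto simp: controlled_def)

text \<open>Put \<open>t = s + h\<close>. Segments between points of the ball stay in it by
  convexity, and \<open>h\<close> ranges over a ball of radius \<open>2 * \<rho>\<close>, which
  accounts for both factors of the constant. The condition \<open>3 * \<rho> \<le> d c\<close>
  ensures \<open>norm h < d s\<close>.\<close>

lemma ball_oscillation:
  assumes uw: "controlled u w" and c: "c \<in> G" and \<rho>: "0 < \<rho>" "3 * \<rho> \<le> d c"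
  shows "(\<integral>\<^sup>+s. indicator (ball c \<rho>) s * (\<integral>\<^sup>+t. indicator (ball c \<rho>) t * ennreal \<bar>u t - u s\<bar> \<partial>lborel) \<partial>lborel)
     \<le> ennreal (2 * \<rho> * (\<omega> * (2 * \<rho>) powr n)) * (\<integral>\<^sup>+z. indicator (ball c \<rho>) z * ennreal (w z) \<partial>lborel)"
proof -
  note [measurable] = controlledD(2,3)[OF uw]
  define D where "D = ball c \<rho>"
  have [measurable]: "D \<in> sets borel" by (simp add: D_def)
  define B where "B = ball (0 :: 'a) (2 * \<rho>)"
  have [measurable]: "B \<in> sets borel" by (simp add: B_def)
  have convex_D: "convex D" by (simp add: D_def)
  define W where "W = (\<integral>\<^sup>+z. indicator D z * ennreal (w z) \<partial>lborel)"
  define J :: "'a \<Rightarrow> 'a \<Rightarrow> ennreal" where "J h z = indicator B h * (indicator D z * (ennreal (2 * \<rho>) * ennreal (w z)))" for h z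
  have [measurable]: "case_prod J \<in> borel_measurable (borel \<Otimes>\<^sub>M borel)" unfolding J_def by measurable
  have "(\<integral>\<^sup>+s. indicator D s * (\<integral>\<^sup>+t. indicator D t * ennreal \<bar>u t - u s\<bar> \<partial>lborel) \<partial>lborel) =
     (\<integral>\<^sup>+s. (\<integral>\<^sup>+h. indicator D s * (indicator D (h + s) * ennreal \<bar>u (h + s) - u s\<bar>) \<partial>lborel) \<partial>lborel)"
    by (intro nn_integral_cong, subst nn_integral_cmult, measurable)
       (simp add: nn_integral_lborel_translate[where f = "\<lambda>t. indicator D t * ennreal \<bar>u t - u _\<bar>"])
  also have "\<dots> \<le> (\<integral>\<^sup>+s. (\<integral>\<^sup>+h. (\<integral>\<^sup>+t. indicator {0..1::real} t * J h (s + t *\<^sub>R h) \<partial>lborel) \<partial>lborel) \<partial>lborel)"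
  proof (rule nn_integral_mono_AE)
    show "AE s in lborel. (\<integral>\<^sup>+h. indicator D s * (indicator D (h + s) * ennreal \<bar>u (h + s) - u s\<bar>) \<partial>lborel)
       \<le> (\<integral>\<^sup>+h. (\<integral>\<^sup>+t. indicator {0..1::real} t * J h (s + t *\<^sub>R h) \<partial>lborel) \<partial>lborel)"
      using controlledD(5)[OF uw]
    proof eventually_elim
      case (elim s)
      show ?case
      proof (rule nn_integral_mono_AE)
        show "AE h in lborel. indicator D s * (indicator D (h + s) * ennreal \<bar>u (h + s) - u s\<bar>)
          \<le> (\<integral>\<^sup>+t. indicator {0..1::real} t * J h (s + t *\<^sub>R h) \<partial>lborel)"
          using elim
        proof eventually_elim
          case (elim h)
          show ?case
          proof (cases "s \<in> D \<and> h + s \<in> D")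
            case True
            then have s: "dist c s < \<rho>" "dist c (s + h) < \<rho>" by (auto simp: D_def add.commute)
            have "\<rho> \<le> 1/3 * d c" using \<rho> by simp
            then have "dist c s \<le> 1/3 * d c" using s by linarith
            then have "dist c s < d c" using d_pos[OF c] by linarith
            then have sG: "s \<in> G" using ball_subset[OF c] by auto
            have "dist s (s + h) < 2 * \<rho>" using s dist_triangle[of s "s + h" c] by (simp add: dist_commute)
            then have h: "norm h < 2 * \<rho>" by (simp add: dist_norm)
            have "d c - \<rho> \<le> d s" using d_Lipschitz[of c s] s by linarith
            then have "norm h < d s" using h \<rho> by linarith
            with elim sG have "ennreal \<bar>u (s + h) - u s\<bar> \<le> (\<integral>\<^sup>+t\<in>{0..1}. ennreal (norm h * w (s + t *\<^sub>R h)) \<partial>lborel)" by blast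
            also have "\<dots> \<le> (\<integral>\<^sup>+t. indicator {0..1::real} t * J h (s + t *\<^sub>R h) \<partial>lborel)"
            proof (rule nn_integral_mono)
              fix t :: real
              show "ennreal (norm h * w (s + t *\<^sub>R h)) * indicator {0..1} t \<le> indicator {0..1} t * J h (s + t *\<^sub>R h)"
              proof (cases "t \<in> {0..1}")
                case t: True
                have "(1 - t) *\<^sub>R s + t *\<^sub>R (h + s) \<in> D"
                  using convex_D True t by (intro convexD_alt) auto
                then have "s + t *\<^sub>R h \<in> D" by (simp add: algebra_simps)
                moreover have "norm h * w (s + t *\<^sub>R h) \<le> 2 * \<rho> * w (s + t *\<^sub>R h)"
                  using h controlledD(4)[OF uw] by (intro mult_right_mono) auto
                ultimately show ?thesis using t h \<rho> controlledD(4)[OF uw]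
                  by (simp add: J_def B_def ennreal_mult[symmetric] ennreal_leI)
              qed simp
            qed
            finally show ?thesis using True by (simp add: add.commute)
          qed auto
        qed
      qed
    qed
  qed
  also have "\<dots> = (\<integral>\<^sup>+h. (\<integral>\<^sup>+z. J h z \<partial>lborel) \<partial>lborel)"
    by (rule nn_integral_segments) measurable
  also have "\<dots> = (\<integral>\<^sup>+h. indicator B h * (ennreal (2 * \<rho>) * W) \<partial>lborel)"
  proof (rule nn_integral_cong)
    fix h
    have "(\<integral>\<^sup>+z. J h z \<partial>lborel) = (\<integral>\<^sup>+z. (indicator B h * ennreal (2 * \<rho>)) * (indicator D z * ennreal (w z)) \<partial>lborel)"
      unfolding J_def by (simp add: mult_ac)
    also have "\<dots> = (indicator B h * ennreal (2 * \<rho>)) * W"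
      unfolding W_def by (rule nn_integral_cmult) measurable
    finally show "(\<integral>\<^sup>+z. J h z \<partial>lborel) = indicator B h * (ennreal (2 * \<rho>) * W)" by (simp add: mult.assoc)
  qed
  also have "\<dots> = emeasure lborel B * (ennreal (2 * \<rho>) * W)"
    by (subst nn_integral_multc) auto
  also have "\<dots> = ennreal (\<omega> * (2 * \<rho>) powr n) * (ennreal (2 * \<rho>) * W)"
    unfolding B_def using \<rho> by (subst emeasure_ball_powr) auto
  also have "\<dots> = ennreal (2 * \<rho> * (\<omega> * (2 * \<rho>) powr n)) * W"
  proof -
    have "ennreal (2 * \<rho> * (\<omega> * (2 * \<rho>) powr n)) = ennreal (2 * \<rho>) * ennreal (\<omega> * (2 * \<rho>) powr n)"
      using \<rho> \<omega>_pos by (intro ennreal_mult) auto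
    then show ?thesis by (simp only: mult_ac)
  qed
  finally show ?thesis by (simp add: D_def W_def)
qed

definition ball_avg :: "('a \<Rightarrow> real) \<Rightarrow> 'a \<Rightarrow> real" where
  "ball_avg u x = (\<integral>y. indicator (ball x (\<kappa> * d x)) y * u y \<partial>lborel) / (\<omega> * (\<kappa> * d x) powr n)"

lemma ball_avg_diff_le:
  assumes "integrable lborel u" "x \<in> G"
  shows "ennreal (\<omega> * (\<kappa> * d x) powr n) * ennreal \<bar>ball_avg u x - a\<bar>
    \<le> (\<integral>\<^sup>+y. indicator (ball x (\<kappa> * d x)) y * ennreal \<bar>u y - a\<bar> \<partial>lborel)"
  unfolding ball_avg_def using \<kappa> d_pos[OF assms(2)] \<omega>_pos
  by (intro average_diff_le[OF assms(1)] emeasure_ball_powr) auto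

text \<open>The constant of \<open>ball_oscillation\<close> at radius
  \<open>3 * \<kappa> * d x\<close>, divided by the volume of the ball at \<open>x\<close> and by a
  lower bound for that of the neighbouring ball, with the powers of \<open>d x\<close> split
  off.\<close>

definition "c4 = 6 * \<kappa> * (\<omega> * (6 * \<kappa>) powr n) / (\<omega> * (\<kappa>/2) powr n * (\<omega> * \<kappa> powr n))"

lemma c4_pos: "c4 > 0" using \<kappa> \<omega>_pos by (simp add: c4_def)

text \<open>Both balls fit into the ball of radius \<open>3 * \<kappa> * d x\<close>, because the
  step has length at most \<open>\<kappa> * d x\<close> and \<open>d y \<le> 2 * d x\<close>; its
  oscillation bounds the difference of the averages.\<close>

lemma ball_avg_step:
  assumes uw: "controlled u w" and x: "x \<in> G" and y: "y \<in> G" and "dist x y \<le> \<kappa> * d x"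
  shows "ennreal \<bar>ball_avg u x - ball_avg u y\<bar> \<le>
    ennreal (c4 * d x powr (1 - n)) * (\<integral>\<^sup>+z. indicator (ball x (3 * \<kappa> * d x)) z * ennreal (w z) \<partial>lborel)"
proof -
  note [measurable] = controlledD(2,3)[OF uw]
  have [measurable]: "ball x r \<in> sets borel" for x :: 'a and r by simp
  note u = controlledD(1)[OF uw]
  define D where "D = ball x (3 * \<kappa> * d x)"
  have [measurable]: "D \<in> sets borel" by (simp add: D_def)
  define W where "W = (\<integral>\<^sup>+z. indicator D z * ennreal (w z) \<partial>lborel)"
  have dx: "d x > 0" using d_pos[OF x] .
  have k: "\<kappa> \<le> 1/4" using \<kappa> by simp
  have dy: "d y \<le> 2 * d x" "d x \<le> 2 * d y" using near[OF x assms(4) k] by auto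
  have B1: "ball x (\<kappa> * d x) \<subseteq> D" using mult_pos_pos[OF \<kappa>(1) dx] by (auto simp: D_def)
  have B2: "ball y (\<kappa> * d y) \<subseteq> D"
  proof
    fix t assume "t \<in> ball y (\<kappa> * d y)"
    moreover have "\<kappa> * d y \<le> \<kappa> * (2 * d x)" using dy \<kappa> by (intro mult_left_mono) auto
    ultimately have "dist x t < \<kappa> * d x + \<kappa> * (2 * d x)"
      using assms(4) dist_triangle[of x t y] by simp
    then show "t \<in> D" by (simp add: D_def)
  qed
  define m1 where "m1 = \<omega> * (\<kappa> * d x) powr n"
  define m2 where "m2 = \<omega> * (\<kappa> * d y) powr n"
  \<comment> \<open>A lower bound for \<open>m2\<close> in terms of \<open>x\<close> only, from
    \<open>d x \<le> 2 * d y\<close>.\<close>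
  define m3 where "m3 = \<omega> * (\<kappa>/2 * d x) powr n"
  have m: "m1 > 0" "m2 > 0" "m3 > 0" using \<kappa> dx d_pos[OF y] \<omega>_pos by (auto simp: m1_def m2_def m3_def)
  have "\<kappa> * d x \<le> \<kappa> * (2 * d y)" using \<kappa> dy by (intro mult_left_mono) auto
  then have m32: "m3 \<le> m2" unfolding m2_def m3_def using \<kappa> dx n_pos \<omega>_pos by (intro mult_left_mono powr_mono2) auto
  have "ennreal (m3 * m1) * ennreal \<bar>ball_avg u x - ball_avg u y\<bar> = ennreal m3 * (ennreal m1 * ennreal \<bar>ball_avg u x - ball_avg u y\<bar>)"
    using m by (simp add: ennreal_mult mult.assoc)
  also have "\<dots> \<le> ennreal m2 * (ennreal m1 * ennreal \<bar>ball_avg u x - ball_avg u y\<bar>)"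
    using m32 by (intro mult_right_mono ennreal_leI) auto
  also have "\<dots> \<le> ennreal m2 * (\<integral>\<^sup>+s. indicator (ball x (\<kappa> * d x)) s * ennreal \<bar>u s - ball_avg u y\<bar> \<partial>lborel)"
    unfolding m1_def by (intro mult_left_mono ball_avg_diff_le u x) auto
  also have "\<dots> = (\<integral>\<^sup>+s. indicator (ball x (\<kappa> * d x)) s * (ennreal m2 * ennreal \<bar>ball_avg u y - u s\<bar>) \<partial>lborel)"
    by (subst nn_integral_cmult[symmetric]) (auto simp: mult_ac abs_minus_commute)
  also have "\<dots> \<le> (\<integral>\<^sup>+s. indicator (ball x (\<kappa> * d x)) s * (\<integral>\<^sup>+t. indicator (ball y (\<kappa> * d y)) t * ennreal \<bar>u t - u s\<bar> \<partial>lborel) \<partial>lborel)"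
    unfolding m2_def by (intro nn_integral_mono mult_left_mono ball_avg_diff_le u y) auto
  also have "\<dots> \<le> (\<integral>\<^sup>+s. indicator D s * (\<integral>\<^sup>+t. indicator D t * ennreal \<bar>u t - u s\<bar> \<partial>lborel) \<partial>lborel)"
    using B1 B2 by (intro nn_integral_mono mult_mono) (auto split: split_indicator)
  also have "\<dots> \<le> ennreal (2 * (3 * \<kappa> * d x) * (\<omega> * (2 * (3 * \<kappa> * d x)) powr n)) * W"
  proof -
    have "3 * (3 * \<kappa> * d x) \<le> 1 * d x" using \<kappa> dx by (simp add: mult.assoc[symmetric] del: mult_1)
    then show ?thesis unfolding D_def W_def using \<kappa> dx by (intro ball_oscillation[OF uw x]) auto
  qed
  finally have "ennreal \<bar>ball_avg u x - ball_avg u y\<bar> \<le> ennreal ((2 * (3 * \<kappa> * d x) * (\<omega> * (2 * (3 * \<kappa> * d x)) powr n)) / (m3 * m1)) * W"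
    using m \<kappa> dx \<omega>_pos by (intro ennreal_le_divide_const) auto
  also have "(2 * (3 * \<kappa> * d x) * (\<omega> * (2 * (3 * \<kappa> * d x)) powr n)) / (m3 * m1) = c4 * d x powr (1 - n)"
  proof -
    have e: "2 * (3 * \<kappa> * d x) = (6 * \<kappa>) * d x" by simp
    have "d x powr (1 - n) = d x / d x powr n" using dx by (simp add: powr_diff)
    then show ?thesis unfolding e m1_def m3_def powr_mult c4_def using dx \<omega>_pos \<kappa> by (simp add: field_simps)
  qed
  finally show ?thesis by (simp add: D_def W_def)
qed

text \<open>Recentres the gradient integrals of \<open>ball_avg_step\<close> at an arbitrary point
  \<open>y\<close> of a chain ball, so that a sum over a chain becomes an integral against
  \<open>kernel\<close>. Relative radius \<open>4 * \<kappa>\<close> in place of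
  \<open>3 * \<kappa>\<close> pays for the move; the conditional form makes joint measurability
  immediate.\<close>

definition nb :: "'a \<Rightarrow> 'a \<Rightarrow> ennreal" where
  "nb y z = (if y \<in> G \<and> dist y z < 4 * \<kappa> * d y then 1 else 0)"

lemma nb_measurable [measurable (raw)]:
  assumes [measurable]: "g \<in> measurable M borel" "h \<in> measurable M borel"
  shows "(\<lambda>x. nb (g x) (h x)) \<in> borel_measurable M"
  unfolding nb_def by measurable

definition "c6 = 2 * (c4 * 2 powr \<bar>1 - 2 * n\<bar> / (\<omega> * (\<kappa>/4) powr n))"

lemma c6_pos: "c6 > 0" using c4_pos \<kappa> \<omega>_pos by (simp add: c6_def)

text \<open>On the chain ball the integrand on the right is bounded below by a constant;
  \<open>c6\<close> cancels the volume of the ball and the loss from comparing \<open>d y\<close>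
  with \<open>d (f z i)\<close>. The leading 2 anticipates the two sums in
  \<open>ball_avg_chain\<close>.\<close>

lemma chain_ball_integral_ge:
  assumes uw: "controlled u w" and z: "z \<in> G" and i: "i \<le> N z"
  shows "2 * (ennreal (c4 * d (f z i) powr (1 - n)) * (\<integral>\<^sup>+t. indicator (ball (f z i) (3 * \<kappa> * d (f z i))) t * ennreal (w t) \<partial>lborel))
    \<le> ennreal c6 * (\<integral>\<^sup>+y. indicator (chain_ball z i) y * (ennreal (d y powr (1 - 2 * n)) * (\<integral>\<^sup>+t. nb y t * ennreal (w t) \<partial>lborel)) \<partial>lborel)"
proof -
  note [measurable] = controlledD(2,3)[OF uw]
  define a where "a = d (f z i)"
  have fz: "f z i \<in> G" using f_in[OF z i] .
  have a: "a > 0" using d_pos[OF fz] by (simp add: a_def)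
  define W where "W = (\<integral>\<^sup>+t. indicator (ball (f z i) (3 * \<kappa> * a)) t * ennreal (w t) \<partial>lborel)"
  define e where "e = 2 powr (- \<bar>1 - 2 * n\<bar>) * a powr (1 - 2 * n)"
  have e: "e > 0" using a by (simp add: e_def)
  have low: "indicator (chain_ball z i) y * (ennreal e * W) \<le>
      indicator (chain_ball z i) y * (ennreal (d y powr (1 - 2 * n)) * (\<integral>\<^sup>+t. nb y t * ennreal (w t) \<partial>lborel))" for y
  proof (cases "y \<in> chain_ball z i")
    case True
    note nr = chain_ball_near[OF z i True, folded a_def]
    have dy: "d y > 0" using d_pos[OF nr(1)] .
    have "a powr (1 - 2 * n) \<le> 2 powr \<bar>1 - 2 * n\<bar> * d y powr (1 - 2 * n)"
      using powr_comparable[OF dy nr(3,2)] .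
    then have "e \<le> d y powr (1 - 2 * n)" by (simp add: e_def powr_minus field_simps)
    moreover have "W \<le> (\<integral>\<^sup>+t. nb y t * ennreal (w t) \<partial>lborel)"
      unfolding W_def
    proof (intro nn_integral_mono mult_right_mono)
      fix t
      show "indicator (ball (f z i) (3 * \<kappa> * a)) t \<le> nb y t"
      proof (cases "t \<in> ball (f z i) (3 * \<kappa> * a)")
        case t: True
        have "dist (f z i) y < \<kappa>/4 * a" using True by (simp add: chain_ball_def a_def)
        then have "dist y t < \<kappa>/4 * a + 3 * \<kappa> * a" using t dist_triangle[of y t "f z i"] by (simp add: dist_commute)
        \<comment> \<open>\<open>1/4 + 3 = 4 * 13/16\<close>, and \<open>13/16\<close> is below the
          factor \<open>79/80\<close> that compares \<open>d y\<close> with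
          \<open>a\<close>.\<close>
        also have "\<dots> = 4 * \<kappa> * (13/16 * a)" by simp
        also have "\<dots> \<le> 4 * \<kappa> * d y" using \<kappa> nr(4) a by (intro mult_left_mono) auto
        finally show ?thesis using nr(1) by (auto simp: nb_def split: split_indicator)
      qed simp
    qed simp
    ultimately show ?thesis by (intro mult_left_mono mult_mono ennreal_leI) auto
  qed simp
  define m where "m = \<omega> * (\<kappa>/4 * a) powr n"
  have m: "m > 0" using \<kappa> a \<omega>_pos by (simp add: m_def)
  have "ennreal (m * e) * W = emeasure lborel (chain_ball z i) * (ennreal e * W)"
  proof -
    have "emeasure lborel (chain_ball z i) = ennreal m"
      unfolding chain_ball_def a_def[symmetric] m_def using \<kappa> a by (intro emeasure_ball_powr) auto
    then show ?thesis using m e by (simp add: ennreal_mult mult.assoc)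
  qed
  also have "\<dots> = (\<integral>\<^sup>+y. indicator (chain_ball z i) y * (ennreal e * W) \<partial>lborel)"
    by (subst nn_integral_multc) auto
  also have "\<dots> \<le> (\<integral>\<^sup>+y. indicator (chain_ball z i) y * (ennreal (d y powr (1 - 2 * n)) * (\<integral>\<^sup>+t. nb y t * ennreal (w t) \<partial>lborel)) \<partial>lborel)"
    by (intro nn_integral_mono low)
  finally have le: "ennreal c6 * (ennreal (m * e) * W) \<le> ennreal c6 * (\<integral>\<^sup>+y. indicator (chain_ball z i) y * (ennreal (d y powr (1 - 2 * n)) * (\<integral>\<^sup>+t. nb y t * ennreal (w t) \<partial>lborel)) \<partial>lborel)"
    by (intro mult_left_mono) auto
  have "c6 * (m * e) = 2 * (c4 * a powr (1 - n))"
  proof -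
    have "a powr (1 - n) = a powr n * a powr (1 - 2 * n)" by (simp add: powr_add[symmetric])
    then show ?thesis unfolding c6_def m_def e_def powr_mult using \<kappa> \<omega>_pos by (simp add: powr_minus field_simps)
  qed
  then have "ennreal c6 * (ennreal (m * e) * W) = 2 * (ennreal (c4 * a powr (1 - n)) * W)"
    using c6_pos m e c4_pos by (simp add: mult.assoc[symmetric] ennreal_mult[symmetric]) (simp add: ennreal_mult mult.assoc)
  with le show ?thesis by (simp add: W_def a_def)
qed

lemma ball_avg_chain:
  assumes uw: "controlled u w" and x: "x \<in> G"
  shows "ennreal \<bar>ball_avg u x - ball_avg u x0\<bar> \<le>
    ennreal c6 * (\<integral>\<^sup>+y. kernel x y * (ennreal (d y powr (1 - 2 * n)) * (\<integral>\<^sup>+t. nb y t * ennreal (w t) \<partial>lborel)) \<partial>lborel)"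
proof -
  note [measurable] = controlledD(2,3)[OF uw]
  define z where "z = net (cell x)"
  have z: "z \<in> G" by (simp add: z_def net_in)
  define g where "g i = ennreal (c4 * d (f z i) powr (1 - n)) * (\<integral>\<^sup>+t. indicator (ball (f z i) (3 * \<kappa> * d (f z i))) t * ennreal (w t) \<partial>lborel)" for i
  have "\<kappa>/4 * d z \<le> \<kappa> * d z" using \<kappa> d_pos[OF z] by simp
  then have zx: "dist z x \<le> \<kappa> * d z" using dist_net_cell[OF x] by (simp add: z_def)
  have "ennreal \<bar>ball_avg u z - ball_avg u x\<bar> \<le> g 0"
    using ball_avg_step[OF uw z x zx] f_0[OF z] by (simp add: g_def)
  also have "g 0 \<le> (\<Sum>i\<le>N z. g i)" by (intro member_le_sum) auto
  finally have 1: "ennreal \<bar>ball_avg u z - ball_avg u x\<bar> \<le> (\<Sum>i\<le>N z. g i)" .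
  have "ennreal \<bar>ball_avg u (f z 0) - ball_avg u (f z k)\<bar> \<le> (\<Sum>i<k. g i)" if "k \<le> N z" for k
    using that
  proof (induction k)
    case (Suc k)
    have "\<bar>ball_avg u (f z 0) - ball_avg u (f z (Suc k))\<bar> \<le>
      \<bar>ball_avg u (f z 0) - ball_avg u (f z k)\<bar> + \<bar>ball_avg u (f z k) - ball_avg u (f z (Suc k))\<bar>" by linarith
    then have "ennreal \<bar>ball_avg u (f z 0) - ball_avg u (f z (Suc k))\<bar> \<le>
      ennreal \<bar>ball_avg u (f z 0) - ball_avg u (f z k)\<bar> + ennreal \<bar>ball_avg u (f z k) - ball_avg u (f z (Suc k))\<bar>"
      by (rule ennreal_abs_triangle)
    also have "\<dots> \<le> (\<Sum>i<k. g i) + g k"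
      unfolding g_def[of k] using Suc f_in[OF z] f_step[OF z] by (intro add_mono ball_avg_step[OF uw]) auto
    finally show ?case by simp
  qed simp
  from this[OF order_refl] have "ennreal \<bar>ball_avg u z - ball_avg u x0\<bar> \<le> (\<Sum>i<N z. g i)"
    using f_0[OF z] f_N[OF z] by simp
  also have "\<dots> \<le> (\<Sum>i\<le>N z. g i)" by (intro sum_mono2) auto
  finally have 2: "ennreal \<bar>ball_avg u z - ball_avg u x0\<bar> \<le> (\<Sum>i\<le>N z. g i)" .
  have "\<bar>ball_avg u x - ball_avg u x0\<bar> \<le> \<bar>ball_avg u z - ball_avg u x\<bar> + \<bar>ball_avg u z - ball_avg u x0\<bar>" by linarith
  then have "ennreal \<bar>ball_avg u x - ball_avg u x0\<bar> \<le> ennreal \<bar>ball_avg u z - ball_avg u x\<bar> + ennreal \<bar>ball_avg u z - ball_avg u x0\<bar>"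
    by (rule ennreal_abs_triangle)
  \<comment> \<open>The first sum covers the single step between \<open>x\<close> and its net point,
    the second the chain to \<open>x0\<close>.\<close>
  also have "\<dots> \<le> (\<Sum>i\<le>N z. g i) + (\<Sum>i\<le>N z. g i)" by (intro add_mono 1 2)
  also have "\<dots> = (\<Sum>i\<le>N z. 2 * g i)" by (simp add: sum_distrib_left mult_2 sum.distrib)
  also have "\<dots> \<le> (\<Sum>i\<le>N z. ennreal c6 * (\<integral>\<^sup>+y. indicator (chain_ball z i) y * (ennreal (d y powr (1 - 2 * n)) * (\<integral>\<^sup>+t. nb y t * ennreal (w t) \<partial>lborel)) \<partial>lborel))"
    unfolding g_def by (intro sum_mono chain_ball_integral_ge[OF uw z]) auto
  also have "\<dots> = ennreal c6 * (\<integral>\<^sup>+y. (\<Sum>i\<le>N z. indicator (chain_ball z i) y * (ennreal (d y powr (1 - 2 * n)) * (\<integral>\<^sup>+t. nb y t * ennreal (w t) \<partial>lborel))) \<partial>lborel)"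
    by (subst nn_integral_sum) (auto simp: sum_distrib_left)
  also have "\<dots> = ennreal c6 * (\<integral>\<^sup>+y. kernel x y * (ennreal (d y powr (1 - 2 * n)) * (\<integral>\<^sup>+t. nb y t * ennreal (w t) \<partial>lborel)) \<partial>lborel)"
    using x by (simp add: kernel_def z_def sum_distrib_right)
  finally show ?thesis .
qed

end

section \<open>The Poincare estimate on a chain domain\<close>

text \<open>If \<open>h > t\<close> then \<open>h powr (1 - q) \<le> t powr (1 - q)\<close>. The
  free parameter \<open>t\<close> lets the bound be integrated in \<open>ennreal\<close> first and
  optimised afterwards.\<close>

lemma le_add_powr:
  fixes h t q :: real
  assumes "0 \<le> h" "0 < t" "1 \<le> q"
  shows "h \<le> t + t powr (1 - q) * h powr q"
proof (cases "h \<le> t")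
  case False
  then have "h = h powr (1 - q) * h powr q" using assms by (simp add: powr_add[symmetric])
  also have "\<dots> \<le> t powr (1 - q) * h powr q"
    using False assms by (intro mult_right_mono powr_mono2') auto
  finally show ?thesis using assms by linarith
qed (use assms in \<open>simp add: add_increasing2\<close>)

text \<open>Jensen's inequality in linearised form: the hypothesis is what \<open>le_add_powr\<close> yields when it
  is integrated against a measure of mass \<open>K\<close>, with \<open>I\<close> the integral of the \<open>q\<close>-th power.\<close>

lemma powr_le_of_linearised:
  fixes r K q :: real and I :: ennreal
  assumes "0 \<le> r" "0 < K" and le: "\<And>t. 0 < t \<Longrightarrow> ennreal r \<le> ennreal (t * K) + ennreal (t powr (1 - q)) * I"
  shows "ennreal (r powr q) \<le> ennreal (2 * (2 * K) powr (q - 1)) * I"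
proof (cases "r = 0")
  case False
  then have r: "r > 0" using assms by simp
  define c where "c = (r / (2 * K)) powr (1 - q)"
  have "ennreal (r / 2) + ennreal (r / 2) = ennreal r" using r by (subst ennreal_plus[symmetric]) auto
  \<comment> \<open>With \<open>t = r / (2 * K)\<close> the first term is half of the left-hand side
    and can be absorbed, being finite.\<close>
  also have "\<dots> \<le> ennreal (r / (2 * K) * K) + ennreal c * I"
    unfolding c_def using r assms(2) by (intro le) auto
  also have "r / (2 * K) * K = r / 2" using assms(2) by simp
  finally have half: "ennreal (r / 2) \<le> ennreal c * I"
    by (subst (asm) ennreal_add_left_cancel_le) auto
  have "r powr q = 2 * r powr (q - 1) * (r / 2)" using r by (simp add: powr_diff)
  then have "ennreal (r powr q) = ennreal (2 * r powr (q - 1)) * ennreal (r / 2)"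
    using r by (simp only:) (rule ennreal_mult; simp)
  also have "\<dots> \<le> ennreal (2 * r powr (q - 1)) * (ennreal c * I)" by (intro mult_left_mono half) auto
  also have "\<dots> = ennreal (2 * r powr (q - 1) * c) * I"
    using r by (simp add: ennreal_mult c_def mult.assoc)
  also have "2 * r powr (q - 1) * c = 2 * (2 * K) powr (q - 1)"
  proof -
    have "c = r powr (1 - q) / (2 * K) powr (1 - q)" unfolding c_def by (rule powr_divide) 
    also have "r powr (1 - q) = inverse (r powr (q - 1))" by (simp add: powr_minus[symmetric])
    also have "(2 * K) powr (1 - q) = inverse ((2 * K) powr (q - 1))" by (simp add: powr_minus[symmetric])
    finally show ?thesis using r by (simp add: field_simps)
  qed
  finally show ?thesis .
qed simp

lemma nn_integral_linear:
  fixes a c :: ennreal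
  assumes "g \<in> borel_measurable M" "h \<in> borel_measurable M"
  shows "(\<integral>\<^sup>+x. a * g x + c * h x \<partial>M) = a * (\<integral>\<^sup>+x. g x \<partial>M) + c * (\<integral>\<^sup>+x. h x \<partial>M)"
  using assms by (simp add: nn_integral_add nn_integral_cmult)

text \<open>Weighted Young inequality, by cases. If the first summand does not dominate, then
  \<open>w powr (p - q) < D powr (e + B)\<close>, and inserting this bound for \<open>w\<close>
  gives the second summand.\<close>

lemma powr_product_split:
  fixes D w e B p q :: real
  assumes "0 < D" "0 \<le> w" "0 < q" "q < p"
  shows "D powr e * w powr q \<le> D powr (- B) * w powr p + D powr ((B * q + e * p) / (p - q))"
proof (cases "D powr e * w powr q \<le> D powr (- B) * w powr p")
  case False
  have w: "w > 0" using False assms by (cases "w = 0") auto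
  define E where "E = (e + B) / (p - q)"
  have "w powr (p - q) = D powr B * (D powr (- B) * w powr p) / w powr q"
    using assms w by (simp add: powr_diff powr_minus field_simps)
  also have "\<dots> \<le> D powr B * (D powr e * w powr q) / w powr q"
    using False by (intro divide_right_mono mult_left_mono) auto
  also have "\<dots> = D powr (e + B)" using assms w by (simp add: powr_add)
  finally have "(w powr (p - q)) powr (1 / (p - q)) \<le> (D powr (e + B)) powr (1 / (p - q))"
    using assms by (intro powr_mono2) auto
  then have "w \<le> D powr E" using assms w by (simp add: powr_powr E_def)
  then have "D powr e * w powr q \<le> D powr e * (D powr E) powr q"
    using assms w by (intro mult_left_mono powr_mono2) auto
  also have "\<dots> = D powr (e + E * q)" by (simp add: powr_powr powr_add)
  also have "e + E * q = (B * q + e * p) / (p - q)" using assms by (simp add: E_def field_simps)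
  finally show ?thesis by (simp add: add_increasing)
qed (simp add: add_increasing2)

lemma powr_abs_add_le:
  fixes a x y q :: real
  assumes "\<bar>a\<bar> \<le> \<bar>x\<bar> + \<bar>y\<bar>" "0 \<le> q"
  shows "\<bar>a\<bar> powr q \<le> 2 powr q * (\<bar>x\<bar> powr q + \<bar>y\<bar> powr q)"
proof -
  have "\<bar>a\<bar> powr q \<le> (2 * max \<bar>x\<bar> \<bar>y\<bar>) powr q" using assms by (intro powr_mono2) auto
  also have "\<dots> = 2 powr q * max \<bar>x\<bar> \<bar>y\<bar> powr q" by (simp add: powr_mult)
  also have "max \<bar>x\<bar> \<bar>y\<bar> powr q \<le> \<bar>x\<bar> powr q + \<bar>y\<bar> powr q" by (auto simp: max_def)
  finally show ?thesis by simp
qed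

section \<open>Energy integrals and the oscillation estimate\<close>

context chain_domain
begin

lemma ball_measurable [measurable]: "ball (x :: 'a) r \<in> sets borel"
  by simp

lemma nb_support:
  assumes "nb y z \<noteq> 0"
  shows "y \<in> G" "z \<in> G" "d y \<le> 2 * d z" "d z \<le> 2 * d y" "dist z y < 8 * \<kappa> * d z" "nb y z = 1"
proof -
  have y: "y \<in> G" "dist y z < 4 * \<kappa> * d y" using assms by (auto simp: nb_def split: if_splits)
  have "4 * \<kappa> \<le> 1/4" using \<kappa> by simp
  from near[OF y(1) less_imp_le[OF y(2)] this] show n: "z \<in> G" "d y \<le> 2 * d z" "d z \<le> 2 * d y" by auto
  show "y \<in> G" "nb y z = 1" using y by (auto simp: nb_def)
  have "4 * \<kappa> * d y \<le> 4 * \<kappa> * (2 * d z)" using \<kappa> n by (intro mult_left_mono) auto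
  then show "dist z y < 8 * \<kappa> * d z" using y(2) by (simp add: dist_commute)
qed

lemma nb_mass:
  assumes "y \<in> G"
  shows "(\<integral>\<^sup>+t. nb y t \<partial>lborel) = ennreal (\<omega> * (4 * \<kappa>) powr n * d y powr n)"
proof -
  have "(\<integral>\<^sup>+t. nb y t \<partial>lborel) = (\<integral>\<^sup>+t. indicator (ball y (4 * \<kappa> * d y)) t \<partial>lborel)"
    using assms by (intro nn_integral_cong) (auto simp: nb_def split: split_indicator)
  also have "\<dots> = emeasure lborel (ball y (4 * \<kappa> * d y))" by (rule nn_integral_indicator) auto
  also have "\<dots> = ennreal (\<omega> * (4 * \<kappa> * d y) powr n)"
    using \<kappa> d_pos[OF assms] by (intro emeasure_ball_powr) auto
  finally show ?thesis unfolding powr_mult[of "4 * \<kappa>"] by (simp add: mult.assoc)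
qed

definition "c7 = 2 powr n * (\<omega> * (8 * \<kappa>) powr n)"

text \<open>\<open>nb\<close> is not symmetric: seen from \<open>t\<close>, the admissible
  \<open>y\<close> lie in a ball of relative radius \<open>8 * \<kappa>\<close>, whose volume
  cancels \<open>d y powr (- n)\<close> up to a constant.\<close>

lemma nb_mass':
  "(\<integral>\<^sup>+y. nb y t * ennreal (d y powr (- n)) \<partial>lborel) \<le> ennreal c7 * indicator G t"
proof (cases "t \<in> G")
  case True
  have dt: "d t > 0" using d_pos[OF True] .
  have "(\<integral>\<^sup>+y. nb y t * ennreal (d y powr (- n)) \<partial>lborel) \<le>
     (\<integral>\<^sup>+y. ennreal (2 powr n * d t powr (- n)) * indicator (ball t (8 * \<kappa> * d t)) y \<partial>lborel)"
  proof (intro nn_integral_mono)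
    fix y
    show "nb y t * ennreal (d y powr (- n)) \<le> ennreal (2 powr n * d t powr (- n)) * indicator (ball t (8 * \<kappa> * d t)) y"
    proof (cases "nb y t = 0")
      case False
      note s = nb_support[OF False]
      have "d y powr (- n) \<le> 2 powr \<bar>- n\<bar> * d t powr (- n)"
        using s dt by (intro powr_comparable) auto
      then show ?thesis using s n_pos by (auto intro!: ennreal_leI)
    qed simp
  qed
  also have "\<dots> = ennreal (2 powr n * d t powr (- n)) * ennreal (\<omega> * (8 * \<kappa> * d t) powr n)"
    using \<kappa> dt by (subst nn_integral_cmult_indicator) (auto simp: emeasure_ball_powr)
  also have "\<dots> = ennreal (2 powr n * d t powr (- n) * (\<omega> * (8 * \<kappa> * d t) powr n))"
    using \<omega>_pos by (intro ennreal_mult[symmetric]) auto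
  also have "2 powr n * d t powr (- n) * (\<omega> * (8 * \<kappa> * d t) powr n) = c7"
    unfolding powr_mult[of "8 * \<kappa>"] c7_def using dt by (simp add: powr_minus field_simps)
  finally show ?thesis using True by simp
next
  case False
  then have "nb y t = 0" for y using nb_support(2) by blast
  then show ?thesis by simp
qed

text \<open>The offset \<open>- n\<close> in the exponent compensates the volume of the inner ball,
  so \<open>e\<close> is the effective power of \<open>d\<close>. For \<open>q = 0\<close> and
  \<open>w = 1\<close> only that power is left, which is the error term of Young's
  inequality.\<close>

definition energy :: "real \<Rightarrow> real \<Rightarrow> ('a \<Rightarrow> real) \<Rightarrow> 'a \<Rightarrow> ennreal" where
  "energy e q w x = (\<integral>\<^sup>+y. kernel x y * (\<integral>\<^sup>+t. nb y t * ennreal (d y powr (e - n) * w t powr q) \<partial>lborel) \<partial>lborel)"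

lemma energy_measurable [measurable]:
  assumes [measurable]: "w \<in> borel_measurable borel"
  shows "energy e q w \<in> borel_measurable borel"
  unfolding energy_def by measurable

text \<open>Split \<open>d y powr (1 - 2 * n) * w t\<close> into
  \<open>d y powr (\<epsilon> - 2 * n)\<close> and \<open>d y powr (1 - \<epsilon>) * w t\<close>,
  and apply \<open>le_add_powr\<close> to the second factor. Integrating out the inner ball turns
  the first into the weight of \<open>kernel_mass\<close>, whose total mass is bounded. The exponent
  of \<open>energy\<close> results from this split.\<close>

lemma ball_avg_powr_le_energy:
  assumes "0 < \<epsilon>" "1 \<le> q"
  obtains c where "c > 0" "\<And>u w x. controlled u w \<Longrightarrow> x \<in> G \<Longrightarrow>
    ennreal (\<bar>ball_avg u x - ball_avg u x0\<bar> powr q) \<le> ennreal c * energy (\<epsilon> - n + (1 - \<epsilon>) * q) q w x"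
proof -
  obtain K where K: "K > 0" "\<And>x. (\<integral>\<^sup>+y. kernel x y * ennreal (d y powr (\<epsilon> - n)) \<partial>lborel) \<le> ennreal K"
    using kernel_mass[OF assms(1)] by blast
  define K' where "K' = c6 * (\<omega> * (4 * \<kappa>) powr n * K)"
  have K': "K' > 0" using K c6_pos \<omega>_pos \<kappa> by (simp add: K'_def)
  define e where "e = \<epsilon> - n + (1 - \<epsilon>) * q"
  show thesis
  proof (rule that[of "2 * (2 * K') powr (q - 1) * c6"])
    show "0 < 2 * (2 * K') powr (q - 1) * c6" using K' c6_pos by simp
    fix u w x assume uw: "controlled u w" and x: "x \<in> G"
    note [measurable] = controlledD(2,3)[OF uw]
    note w = controlledD(4)[OF uw]
    have "ennreal (\<bar>ball_avg u x - ball_avg u x0\<bar> powr q) \<le> ennreal (2 * (2 * K') powr (q - 1)) * (ennreal c6 * energy e q w x)"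
    proof (rule powr_le_of_linearised[OF _ K'])
      fix t0 :: real assume t0: "0 < t0"
      have pt: "ennreal (d y powr (1 - 2 * n)) * (nb y t * ennreal (w t)) \<le>
          ennreal (t0 * d y powr (\<epsilon> - 2 * n)) * nb y t + ennreal (t0 powr (1 - q)) * (nb y t * ennreal (d y powr (e - n) * w t powr q))" for y t
      proof (cases "nb y t = 0")
        case False
        note s = nb_support[OF False]
        have dy: "d y > 0" using d_pos s by auto
        have "d y powr (1 - 2 * n) * w t = d y powr (\<epsilon> - 2 * n) * (d y powr (1 - \<epsilon>) * w t)"
          by (simp add: mult.assoc[symmetric] powr_add[symmetric])
        also have "\<dots> \<le> d y powr (\<epsilon> - 2 * n) * (t0 + t0 powr (1 - q) * (d y powr (1 - \<epsilon>) * w t) powr q)"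
          using w t0 assms by (intro mult_left_mono le_add_powr) auto
        also have "\<dots> = t0 * d y powr (\<epsilon> - 2 * n) + t0 powr (1 - q) * (d y powr (e - n) * w t powr q)"
        proof -
          have "d y powr (e - n) = d y powr (\<epsilon> - 2 * n) * d y powr ((1 - \<epsilon>) * q)"
            by (simp add: powr_add[symmetric] e_def algebra_simps)
          then show ?thesis by (simp add: powr_mult powr_powr algebra_simps)
        qed
        finally have "ennreal (d y powr (1 - 2 * n) * w t) \<le> ennreal (t0 * d y powr (\<epsilon> - 2 * n) + t0 powr (1 - q) * (d y powr (e - n) * w t powr q))"
          by (rule ennreal_leI)
        then show ?thesis using s(6) w t0 by (simp add: ennreal_mult)
      qed simp
      have inner: "ennreal (d y powr (1 - 2 * n)) * (\<integral>\<^sup>+t. nb y t * ennreal (w t) \<partial>lborel) \<le>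
          ennreal (t0 * (\<omega> * (4 * \<kappa>) powr n)) * ennreal (d y powr (\<epsilon> - n)) +
          ennreal (t0 powr (1 - q)) * (\<integral>\<^sup>+t. nb y t * ennreal (d y powr (e - n) * w t powr q) \<partial>lborel)" if y: "y \<in> G" for y
      proof -
        have "ennreal (d y powr (1 - 2 * n)) * (\<integral>\<^sup>+t. nb y t * ennreal (w t) \<partial>lborel) =
          (\<integral>\<^sup>+t. ennreal (d y powr (1 - 2 * n)) * (nb y t * ennreal (w t)) \<partial>lborel)"
          by (rule nn_integral_cmult[symmetric]) measurable
        also have "\<dots> \<le> (\<integral>\<^sup>+t. ennreal (t0 * d y powr (\<epsilon> - 2 * n)) * nb y t + ennreal (t0 powr (1 - q)) * (nb y t * ennreal (d y powr (e - n) * w t powr q)) \<partial>lborel)"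
          by (intro nn_integral_mono pt)
        also have "\<dots> = ennreal (t0 * d y powr (\<epsilon> - 2 * n)) * (\<integral>\<^sup>+t. nb y t \<partial>lborel) +
          ennreal (t0 powr (1 - q)) * (\<integral>\<^sup>+t. nb y t * ennreal (d y powr (e - n) * w t powr q) \<partial>lborel)"
          by (rule nn_integral_linear) measurable
        also have "ennreal (t0 * d y powr (\<epsilon> - 2 * n)) * (\<integral>\<^sup>+t. nb y t \<partial>lborel) = ennreal (t0 * (\<omega> * (4 * \<kappa>) powr n)) * ennreal (d y powr (\<epsilon> - n))"
        proof -
          have "d y powr (\<epsilon> - n) = d y powr (\<epsilon> - 2 * n) * d y powr n" by (simp add: powr_add[symmetric])
          then show ?thesis unfolding nb_mass[OF y] using t0 \<omega>_pos by (simp add: ennreal_mult[symmetric] mult_ac)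
        qed
        finally show ?thesis .
      qed
      have "ennreal \<bar>ball_avg u x - ball_avg u x0\<bar> \<le>
        ennreal c6 * (\<integral>\<^sup>+y. kernel x y * (ennreal (d y powr (1 - 2 * n)) * (\<integral>\<^sup>+t. nb y t * ennreal (w t) \<partial>lborel)) \<partial>lborel)"
        by (rule ball_avg_chain[OF uw x])
      also have "\<dots> \<le> ennreal c6 * (\<integral>\<^sup>+y. ennreal (t0 * (\<omega> * (4 * \<kappa>) powr n)) * (kernel x y * ennreal (d y powr (\<epsilon> - n))) +
          ennreal (t0 powr (1 - q)) * (kernel x y * (\<integral>\<^sup>+t. nb y t * ennreal (d y powr (e - n) * w t powr q) \<partial>lborel)) \<partial>lborel)"
      proof (intro mult_left_mono nn_integral_mono)
        fix y
        show "kernel x y * (ennreal (d y powr (1 - 2 * n)) * (\<integral>\<^sup>+t. nb y t * ennreal (w t) \<partial>lborel)) \<le>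
          ennreal (t0 * (\<omega> * (4 * \<kappa>) powr n)) * (kernel x y * ennreal (d y powr (\<epsilon> - n))) +
          ennreal (t0 powr (1 - q)) * (kernel x y * (\<integral>\<^sup>+t. nb y t * ennreal (d y powr (e - n) * w t powr q) \<partial>lborel))"
        proof (cases "kernel x y = 0")
          case False
          from mult_left_mono[OF inner[OF kernel_support(2)[OF False]], of "kernel x y"]
          show ?thesis by (simp add: distrib_left mult_ac)
        qed simp
      qed simp
      also have "\<dots> = ennreal c6 * (ennreal (t0 * (\<omega> * (4 * \<kappa>) powr n)) * (\<integral>\<^sup>+y. kernel x y * ennreal (d y powr (\<epsilon> - n)) \<partial>lborel) +
          ennreal (t0 powr (1 - q)) * energy e q w x)"
        unfolding energy_def by (rule arg_cong[where f = "\<lambda>X. ennreal c6 * X"], rule nn_integral_linear) measurable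
      also have "\<dots> \<le> ennreal c6 * (ennreal (t0 * (\<omega> * (4 * \<kappa>) powr n)) * ennreal K + ennreal (t0 powr (1 - q)) * energy e q w x)"
        by (intro mult_left_mono add_mono K order_refl) auto
      also have "\<dots> = ennreal (t0 * K') + ennreal (t0 powr (1 - q)) * (ennreal c6 * energy e q w x)"
      proof -
        have "ennreal (t0 * K') = ennreal c6 * (ennreal (t0 * (\<omega> * (4 * \<kappa>) powr n)) * ennreal K)"
          using t0 K c6_pos \<omega>_pos by (simp add: K'_def ennreal_mult[symmetric] mult_ac)
        then show ?thesis by (simp add: distrib_left mult_ac)
      qed
      finally show "ennreal \<bar>ball_avg u x - ball_avg u x0\<bar> \<le> ennreal (t0 * K') + ennreal (t0 powr (1 - q)) * (ennreal c6 * energy e q w x)" .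
    qed simp
    then show "ennreal (\<bar>ball_avg u x - ball_avg u x0\<bar> powr q) \<le> ennreal (2 * (2 * K') powr (q - 1) * c6) * energy (\<epsilon> - n + (1 - \<epsilon>) * q) q w x"
      using c6_pos K' by (simp add: ennreal_mult e_def mult.assoc)
  qed
qed

lemma S0_nonneg: "S0 \<ge> 0" using \<omega>_pos by (simp add: S0_def)

lemma c7_nonneg: "c7 \<ge> 0" using \<omega>_pos by (simp add: c7_def)

text \<open>The exponent \<open>- (b * n)\<close> is chosen so that integrating over
  \<open>x\<close> first, which yields the shadow volume, leaves exactly
  \<open>d y powr (- n)\<close>; \<open>nb_mass'\<close> then disposes of \<open>y\<close>.\<close>

lemma energy_gradient_part:
  assumes [measurable]: "w \<in> borel_measurable borel"
  shows "(\<integral>\<^sup>+x. energy (- (b * n)) p w x \<partial>lborel) \<le> ennreal (S0 * c7) * (\<integral>\<^sup>+t. indicator G t * ennreal (w t powr p) \<partial>lborel)"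
proof -
  define J where "J y = (\<integral>\<^sup>+t. nb y t * ennreal (d y powr (- (b * n) - n) * w t powr p) \<partial>lborel)" for y
  have [measurable]: "J \<in> borel_measurable borel" unfolding J_def by measurable
  have "(\<integral>\<^sup>+x. energy (- (b * n)) p w x \<partial>lborel) = (\<integral>\<^sup>+x. (\<integral>\<^sup>+y. kernel x y * J y \<partial>lborel) \<partial>lborel)"
    by (simp add: energy_def J_def)
  also have "\<dots> = (\<integral>\<^sup>+y. (\<integral>\<^sup>+x. kernel x y * J y \<partial>lborel) \<partial>lborel)"
    by (rule lborel_pair.Fubini'[symmetric]) measurable
  also have "\<dots> = (\<integral>\<^sup>+y. (\<integral>\<^sup>+x. kernel x y \<partial>lborel) * J y \<partial>lborel)"
    by (intro nn_integral_cong nn_integral_multc) measurable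
  also have "\<dots> \<le> (\<integral>\<^sup>+y. (\<integral>\<^sup>+t. ennreal S0 * (nb y t * ennreal (d y powr (- n)) * ennreal (w t powr p)) \<partial>lborel) \<partial>lborel)"
  proof (intro nn_integral_mono)
    fix y
    show "(\<integral>\<^sup>+x. kernel x y \<partial>lborel) * J y \<le> (\<integral>\<^sup>+t. ennreal S0 * (nb y t * ennreal (d y powr (- n)) * ennreal (w t powr p)) \<partial>lborel)"
    proof (cases "y \<in> G")
      case True
      have dy: "d y > 0" using d_pos[OF True] .
      have "(\<integral>\<^sup>+x. kernel x y \<partial>lborel) * J y \<le> ennreal (S0 * d y powr (b * n)) * J y"
        by (intro mult_right_mono kernel_shadow True) auto
      also have "\<dots> = (\<integral>\<^sup>+t. ennreal (S0 * d y powr (b * n)) * (nb y t * ennreal (d y powr (- (b * n) - n) * w t powr p)) \<partial>lborel)"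
        unfolding J_def by (rule nn_integral_cmult[symmetric]) measurable
      also have "\<dots> = (\<integral>\<^sup>+t. ennreal S0 * (nb y t * ennreal (d y powr (- n)) * ennreal (w t powr p)) \<partial>lborel)"
      proof (intro nn_integral_cong)
        fix t
        have "d y powr (- n) = d y powr (b * n) * d y powr (- (b * n) - n)" by (simp add: powr_add[symmetric])
        then show "ennreal (S0 * d y powr (b * n)) * (nb y t * ennreal (d y powr (- (b * n) - n) * w t powr p)) =
          ennreal S0 * (nb y t * ennreal (d y powr (- n)) * ennreal (w t powr p))"
          using S0_nonneg by (simp add: ennreal_mult mult_ac)
      qed
      finally show ?thesis .
    next
      case False
      then have "J y = 0" unfolding J_def nb_def by simp
      then show ?thesis by simp
    qed
  qed
  also have "\<dots> = (\<integral>\<^sup>+t. (\<integral>\<^sup>+y. ennreal S0 * (nb y t * ennreal (d y powr (- n)) * ennreal (w t powr p)) \<partial>lborel) \<partial>lborel)"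
    by (rule lborel_pair.Fubini'[symmetric]) measurable
  also have "\<dots> = (\<integral>\<^sup>+t. ennreal S0 * ((\<integral>\<^sup>+y. nb y t * ennreal (d y powr (- n)) \<partial>lborel) * ennreal (w t powr p)) \<partial>lborel)"
    by (intro nn_integral_cong) (simp add: nn_integral_cmult nn_integral_multc)
  also have "\<dots> \<le> (\<integral>\<^sup>+t. ennreal S0 * ((ennreal c7 * indicator G t) * ennreal (w t powr p)) \<partial>lborel)"
    by (intro nn_integral_mono mult_left_mono mult_right_mono nb_mass') auto
  also have "\<dots> = (\<integral>\<^sup>+t. ennreal (S0 * c7) * (indicator G t * ennreal (w t powr p)) \<partial>lborel)"
    using S0_nonneg c7_nonneg by (simp add: ennreal_mult mult_ac)
  also have "\<dots> = ennreal (S0 * c7) * (\<integral>\<^sup>+t. indicator G t * ennreal (w t powr p) \<partial>lborel)"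
    by (rule nn_integral_cmult) measurable
  finally show ?thesis .
qed

text \<open>With \<open>\<epsilon> = E + n + b * s\<close>, the power \<open>d y powr E\<close>
  equals \<open>(d y powr b) powr (- s) * d y powr (\<epsilon> - n)\<close>. The first factor is at
  most a multiple of \<open>d x powr (- s)\<close> by \<open>kernel_support\<close>, the second has
  bounded mass along chains.\<close>

lemma energy_constant_part:
  assumes "0 \<le> s" "0 < E + n + b * s"
    and fin: "(\<integral>\<^sup>+x\<in>G. ennreal (d x powr (- s)) \<partial>lborel) < \<infinity>"
  shows "(\<integral>\<^sup>+x. energy E 0 (\<lambda>_. 1) x \<partial>lborel) < \<infinity>"
proof -
  define \<epsilon> where "\<epsilon> = E + n + b * s"
  have \<epsilon>: "\<epsilon> > 0" using assms by (simp add: \<epsilon>_def)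
  obtain K where K: "K > 0" "\<And>x. (\<integral>\<^sup>+y. kernel x y * ennreal (d y powr (\<epsilon> - n)) \<partial>lborel) \<le> ennreal K"
    using kernel_mass[OF \<epsilon>] by blast
  define c where "c = \<omega> * (4 * \<kappa>) powr n"
  have c: "c \<ge> 0" using \<omega>_pos by (simp add: c_def)
  define c3 where "c3 = 2 * C2 * 2 powr b + D0 powr (1 - b)"
  have c3: "c3 > 0" using C2_pos by (auto simp: c3_def intro!: add_pos_nonneg)
  have "energy E 0 (\<lambda>_. 1) x \<le> ennreal (c * c3 powr s * K) * (indicator G x * ennreal (d x powr (- s)))" for x
  proof -
    have "energy E 0 (\<lambda>_. 1) x \<le> (\<integral>\<^sup>+y. ennreal (c * c3 powr s) * (indicator G x * ennreal (d x powr (- s))) * (kernel x y * ennreal (d y powr (\<epsilon> - n))) \<partial>lborel)"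
      unfolding energy_def
    proof (intro nn_integral_mono)
      fix y
      show "kernel x y * (\<integral>\<^sup>+t. nb y t * ennreal (d y powr (E - n) * 1 powr 0) \<partial>lborel) \<le>
        ennreal (c * c3 powr s) * (indicator G x * ennreal (d x powr (- s))) * (kernel x y * ennreal (d y powr (\<epsilon> - n)))"
      proof (cases "kernel x y = 0")
        case False
        note ks = kernel_support[OF False, folded c3_def]
        have dx: "d x > 0" and dy: "d y > 0" using d_pos ks by auto
        have "(\<integral>\<^sup>+t. nb y t * ennreal (d y powr (E - n) * 1 powr 0) \<partial>lborel) = ennreal (c * d y powr n) * ennreal (d y powr (E - n))"
          by (simp add: nn_integral_multc nb_mass[OF ks(2)] c_def)
        also have "\<dots> = ennreal (c * (d y powr n * d y powr (E - n)))"
          using c by (simp add: ennreal_mult[symmetric] mult_ac)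
        also have "d y powr n * d y powr (E - n) = (d y powr b) powr (- s) * d y powr (\<epsilon> - n)"
          by (simp add: powr_powr powr_add[symmetric] \<epsilon>_def algebra_simps)
        also have "ennreal (c * ((d y powr b) powr (- s) * d y powr (\<epsilon> - n))) \<le> ennreal (c * ((d x / c3) powr (- s) * d y powr (\<epsilon> - n)))"
          using ks(4) c3 dx c assms(1) by (intro ennreal_leI mult_left_mono mult_right_mono powr_mono2') (auto simp: field_simps)
        also have "c * ((d x / c3) powr (- s) * d y powr (\<epsilon> - n)) = (c * c3 powr s) * d x powr (- s) * d y powr (\<epsilon> - n)"
          using c3 dx by (simp add: powr_divide powr_minus field_simps)
        finally have "(\<integral>\<^sup>+t. nb y t * ennreal (d y powr (E - n) * 1 powr 0) \<partial>lborel) \<le>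
          ennreal (c * c3 powr s) * ennreal (d x powr (- s)) * ennreal (d y powr (\<epsilon> - n))"
          using c by (simp add: ennreal_mult)
        from mult_left_mono[OF this, of "kernel x y"] show ?thesis using ks(1) by (simp add: mult_ac)
      qed simp
    qed
    also have "\<dots> = ennreal (c * c3 powr s) * (indicator G x * ennreal (d x powr (- s))) * (\<integral>\<^sup>+y. kernel x y * ennreal (d y powr (\<epsilon> - n)) \<partial>lborel)"
      by (rule nn_integral_cmult) measurable
    also have "\<dots> \<le> ennreal (c * c3 powr s) * (indicator G x * ennreal (d x powr (- s))) * ennreal K"
      by (intro mult_left_mono K) auto
    also have "\<dots> = ennreal (c * c3 powr s * K) * (indicator G x * ennreal (d x powr (- s)))"
      using c K by (simp add: ennreal_mult mult_ac)
    finally show ?thesis .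
  qed
  then have "(\<integral>\<^sup>+x. energy E 0 (\<lambda>_. 1) x \<partial>lborel) \<le> (\<integral>\<^sup>+x. ennreal (c * c3 powr s * K) * (indicator G x * ennreal (d x powr (- s))) \<partial>lborel)"
    by (intro nn_integral_mono)
  also have "\<dots> = ennreal (c * c3 powr s * K) * (\<integral>\<^sup>+x\<in>G. ennreal (d x powr (- s)) \<partial>lborel)"
    by (subst nn_integral_cmult) (auto simp: mult.commute)
  also have "\<dots> < \<infinity>" using fin by (simp add: ennreal_mult_less_top)
  finally show ?thesis .
qed

text \<open>Young's inequality \<open>powr_product_split\<close> with \<open>B = b * n\<close>, the
  weight that \<open>energy_gradient_part\<close> can absorb.\<close>

lemma energy_split:
  assumes [measurable]: "w \<in> borel_measurable borel" and w: "\<And>x. 0 \<le> w x" and "0 < q" "q < p"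
  shows "energy e q w x \<le> energy (- (b * n)) p w x + energy ((b * n * q + e * p) / (p - q)) 0 (\<lambda>_. 1) x"
proof -
  define E where "E = (b * n * q + e * p) / (p - q)"
  have pt: "nb y t * ennreal (d y powr (e - n) * w t powr q) \<le>
    nb y t * ennreal (d y powr (- (b * n) - n) * w t powr p) + nb y t * ennreal (d y powr (E - n) * 1 powr 0)" for y t
  proof (cases "nb y t = 0")
    case False
    note s = nb_support[OF False]
    have dy: "d y > 0" using d_pos s by auto
    have pw: "d y powr (a - n) = d y powr (- n) * d y powr a" for a by (simp add: powr_add[symmetric])
    have "d y powr (e - n) * w t powr q = d y powr (- n) * (d y powr e * w t powr q)"
      by (simp add: pw mult_ac)
    also have "\<dots> \<le> d y powr (- n) * (d y powr (- (b * n)) * w t powr p + d y powr E)"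
      unfolding E_def using dy w assms by (intro mult_left_mono powr_product_split) auto
    also have "\<dots> = d y powr (- (b * n) - n) * w t powr p + d y powr (E - n) * 1 powr 0"
      by (simp add: pw algebra_simps)
    finally show ?thesis using s(6) w by (simp add: ennreal_leI flip: ennreal_plus)
  qed simp
  have "energy e q w x \<le> (\<integral>\<^sup>+y. kernel x y * (\<integral>\<^sup>+t. nb y t * ennreal (d y powr (- (b * n) - n) * w t powr p) \<partial>lborel) +
     kernel x y * (\<integral>\<^sup>+t. nb y t * ennreal (d y powr (E - n) * 1 powr 0) \<partial>lborel) \<partial>lborel)"
    unfolding energy_def
  proof (intro nn_integral_mono)
    fix y
    have "(\<integral>\<^sup>+t. nb y t * ennreal (d y powr (e - n) * w t powr q) \<partial>lborel) \<le>
      (\<integral>\<^sup>+t. nb y t * ennreal (d y powr (- (b * n) - n) * w t powr p) + nb y t * ennreal (d y powr (E - n) * 1 powr 0) \<partial>lborel)"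
      by (intro nn_integral_mono pt)
    also have "\<dots> = (\<integral>\<^sup>+t. nb y t * ennreal (d y powr (- (b * n) - n) * w t powr p) \<partial>lborel) + (\<integral>\<^sup>+t. nb y t * ennreal (d y powr (E - n) * 1 powr 0) \<partial>lborel)"
      by (rule nn_integral_add) measurable
    finally show "kernel x y * (\<integral>\<^sup>+t. nb y t * ennreal (d y powr (e - n) * w t powr q) \<partial>lborel) \<le>
      kernel x y * (\<integral>\<^sup>+t. nb y t * ennreal (d y powr (- (b * n) - n) * w t powr p) \<partial>lborel) +
      kernel x y * (\<integral>\<^sup>+t. nb y t * ennreal (d y powr (E - n) * 1 powr 0) \<partial>lborel)"
      unfolding distrib_left[symmetric] by (rule mult_left_mono) simp
  qed
  also have "\<dots> = energy (- (b * n)) p w x + energy E 0 (\<lambda>_. 1) x"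
    unfolding energy_def by (rule nn_integral_add) measurable
  finally show ?thesis by (simp add: E_def)
qed

text \<open>Compare \<open>x\<close> with the average over its own ball along segments starting at
  \<open>x\<close>. After the linearised Jensen step the integral is rewritten through the
  intermediate point \<open>z\<close>, where the boundary distance is comparable to that at
  \<open>x\<close>; integrating over \<open>h\<close> then contributes the volume of a ball of
  radius \<open>2 * \<kappa> * d z\<close>.\<close>

lemma local_oscillation_powr:
  assumes "1 \<le> q"
  obtains c where "c > 0" "\<And>u w. controlled u w \<Longrightarrow>
    (\<integral>\<^sup>+x. indicator G x * ennreal (\<bar>u x - ball_avg u x\<bar> powr q) \<partial>lborel) \<le>
      ennreal c * (\<integral>\<^sup>+z. indicator G z * ennreal (d z powr q * w z powr q) \<partial>lborel)"
proof -
  \<comment> \<open>This is \<open>2 * (2 * r) powr (q - 1) * (r / m)\<close> for the radius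
    \<open>r = \<kappa> * d x\<close> and the ball volume \<open>m\<close>, with
    \<open>d x powr (q - n)\<close> split off.\<close>
  define c where "c = 2 * (2 * \<kappa>) powr (q - 1) * \<kappa> / (\<omega> * \<kappa> powr n)"
  have c: "c > 0" using \<kappa> \<omega>_pos by (simp add: c_def)
  define c' where "c' = c * 2 powr \<bar>q - n\<bar>"
  have c': "c' > 0" using c by (simp add: c'_def)
  show thesis
  proof (rule that[of "c' * (\<omega> * (2 * \<kappa>) powr n)"])
    show "0 < c' * (\<omega> * (2 * \<kappa>) powr n)" using c' \<omega>_pos \<kappa> by simp
    fix u w assume uw: "controlled u w"
    note [measurable] = controlledD(2,3)[OF uw]
    note w = controlledD(4)[OF uw]
    \<comment> \<open>The conditions refer to \<open>h\<close> and \<open>z\<close> but not to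
      \<open>x\<close>, so that \<open>nn_integral_segments\<close> applies.\<close>
    define J :: "'a \<Rightarrow> 'a \<Rightarrow> ennreal" where
      "J h z = (if z \<in> G \<and> norm h < 2 * \<kappa> * d z then ennreal (c' * d z powr (q - n) * w z powr q) else 0)" for h z
    have [measurable]: "case_prod J \<in> borel_measurable (borel \<Otimes>\<^sub>M borel)" unfolding J_def by measurable
    have pointwise: "indicator G x * ennreal (\<bar>u x - ball_avg u x\<bar> powr q) \<le>
        (\<integral>\<^sup>+h. (\<integral>\<^sup>+t. indicator {0..1::real} t * J h (x + t *\<^sub>R h) \<partial>lborel) \<partial>lborel)"
      if ae: "AE h in lborel. x \<in> G \<and> norm h < d x \<longrightarrow>
        ennreal \<bar>u (x + h) - u x\<bar> \<le> (\<integral>\<^sup>+t\<in>{0..1}. ennreal (norm h * w (x + t *\<^sub>R h)) \<partial>lborel)" for x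
    proof (cases "x \<in> G")
      case x: True
      have dx: "d x > 0" using d_pos[OF x] .
      define r where "r = \<kappa> * d x"
      have r: "r > 0" "r < d x" using \<kappa> dx by (auto simp: r_def)
      define m where "m = \<omega> * r powr n"
      have m: "m > 0" using \<omega>_pos r by (simp add: m_def)
      define B where "B = ball (0 :: 'a) r"
      have [measurable]: "B \<in> sets borel" by (simp add: B_def)
      have mB: "emeasure lborel B = ennreal m" unfolding B_def m_def using r by (intro emeasure_ball_powr) auto
      define I where "I = (\<integral>\<^sup>+h. indicator B h * (\<integral>\<^sup>+t. indicator {0..1::real} t * ennreal (w (x + t *\<^sub>R h) powr q) \<partial>lborel) \<partial>lborel)"
      have base: "ennreal m * ennreal \<bar>u x - ball_avg u x\<bar> \<le>
         (\<integral>\<^sup>+h. indicator B h * (\<integral>\<^sup>+t. indicator {0..1::real} t * (ennreal r * ennreal (w (x + t *\<^sub>R h))) \<partial>lborel) \<partial>lborel)"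
      proof -
        have "ennreal m * ennreal \<bar>u x - ball_avg u x\<bar> \<le> (\<integral>\<^sup>+y. indicator (ball x r) y * ennreal \<bar>u y - u x\<bar> \<partial>lborel)"
          using ball_avg_diff_le[OF controlledD(1)[OF uw] x, of "u x"] by (simp add: m_def r_def abs_minus_commute)
        also have "\<dots> = (\<integral>\<^sup>+h. indicator (ball x r) (h + x) * ennreal \<bar>u (h + x) - u x\<bar> \<partial>lborel)"
          by (rule nn_integral_lborel_translate[symmetric]) measurable
        also have "\<dots> \<le> (\<integral>\<^sup>+h. indicator B h * (\<integral>\<^sup>+t. indicator {0..1::real} t * (ennreal r * ennreal (w (x + t *\<^sub>R h))) \<partial>lborel) \<partial>lborel)"
        proof (rule nn_integral_mono_AE)
          show "AE h in lborel. indicator (ball x r) (h + x) * ennreal \<bar>u (h + x) - u x\<bar> \<le>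
            indicator B h * (\<integral>\<^sup>+t. indicator {0..1::real} t * (ennreal r * ennreal (w (x + t *\<^sub>R h))) \<partial>lborel)"
            using ae
          proof eventually_elim
            case (elim h)
            show ?case
            proof (cases "h + x \<in> ball x r")
              case True
              then have h: "norm h < r" by (simp add: dist_norm)
              then have "ennreal \<bar>u (x + h) - u x\<bar> \<le> (\<integral>\<^sup>+t\<in>{0..1}. ennreal (norm h * w (x + t *\<^sub>R h)) \<partial>lborel)"
                using elim x r by simp
              also have "\<dots> \<le> (\<integral>\<^sup>+t. indicator {0..1::real} t * (ennreal r * ennreal (w (x + t *\<^sub>R h))) \<partial>lborel)"
              proof (rule nn_integral_mono)
                fix t :: real
                have "ennreal (norm h * w (x + t *\<^sub>R h)) \<le> ennreal (r * w (x + t *\<^sub>R h))"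
                  using h w by (intro ennreal_leI mult_right_mono) auto
                also have "\<dots> = ennreal r * ennreal (w (x + t *\<^sub>R h))"
                  using w r by (intro ennreal_mult) auto
                finally show "ennreal (norm h * w (x + t *\<^sub>R h)) * indicator {0..1} t \<le>
                  indicator {0..1} t * (ennreal r * ennreal (w (x + t *\<^sub>R h)))"
                  by (simp split: split_indicator)
              qed
              finally show ?thesis using True h by (simp add: B_def add.commute)
            qed simp
          qed
        qed
        finally show ?thesis .
      qed
      have "ennreal (\<bar>u x - ball_avg u x\<bar> powr q) \<le> ennreal (2 * (2 * r) powr (q - 1)) * (ennreal (r / m) * I)"
      \<comment> \<open>The mass is \<open>r\<close>: the bound \<open>norm h < r\<close> is
        averaged over the ball and the unit interval.\<close>
      proof (rule powr_le_of_linearised[OF _ r(1)])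
        fix t0 :: real assume t0: "0 < t0"
        note base
        also have "(\<integral>\<^sup>+h. indicator B h * (\<integral>\<^sup>+t. indicator {0..1::real} t * (ennreal r * ennreal (w (x + t *\<^sub>R h))) \<partial>lborel) \<partial>lborel) \<le>
          (\<integral>\<^sup>+h. indicator B h * (\<integral>\<^sup>+t. ennreal (r * t0) * indicator {0..1::real} t +
             ennreal (r * t0 powr (1 - q)) * (indicator {0..1::real} t * ennreal (w (x + t *\<^sub>R h) powr q)) \<partial>lborel) \<partial>lborel)"
        proof (intro nn_integral_mono mult_left_mono)
          fix h :: 'a and t :: real
          have "r * w (x + t *\<^sub>R h) \<le> r * (t0 + t0 powr (1 - q) * w (x + t *\<^sub>R h) powr q)"
            using r t0 w assms by (intro mult_left_mono le_add_powr) auto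
          then have "ennreal (r * w (x + t *\<^sub>R h)) \<le> ennreal (r * t0 + r * t0 powr (1 - q) * w (x + t *\<^sub>R h) powr q)"
            by (intro ennreal_leI) (simp add: algebra_simps)
          then show "indicator {0..1::real} t * (ennreal r * ennreal (w (x + t *\<^sub>R h))) \<le> ennreal (r * t0) * indicator {0..1::real} t +
             ennreal (r * t0 powr (1 - q)) * (indicator {0..1::real} t * ennreal (w (x + t *\<^sub>R h) powr q))"
            using r t0 w by (cases "t \<in> {0..1}") (simp_all add: ennreal_mult)
        qed simp
        also have "\<dots> = (\<integral>\<^sup>+h. ennreal (r * t0) * indicator B h +
             ennreal (r * t0 powr (1 - q)) * (indicator B h * (\<integral>\<^sup>+t. indicator {0..1::real} t * ennreal (w (x + t *\<^sub>R h) powr q) \<partial>lborel)) \<partial>lborel)"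
        proof (intro nn_integral_cong)
          fix h :: 'a
          have "(\<integral>\<^sup>+t. ennreal (r * t0) * indicator {0..1::real} t +
             ennreal (r * t0 powr (1 - q)) * (indicator {0..1::real} t * ennreal (w (x + t *\<^sub>R h) powr q)) \<partial>lborel) =
             (\<integral>\<^sup>+t. ennreal (r * t0) * indicator {0..1::real} t \<partial>lborel) +
             (\<integral>\<^sup>+t. ennreal (r * t0 powr (1 - q)) * (indicator {0..1::real} t * ennreal (w (x + t *\<^sub>R h) powr q)) \<partial>lborel)"
            by (rule nn_integral_add) measurable
          also have "(\<integral>\<^sup>+t. ennreal (r * t0) * indicator {0..1::real} t \<partial>lborel) = ennreal (r * t0)"
            by (subst nn_integral_cmult_indicator) auto
          also have "(\<integral>\<^sup>+t. ennreal (r * t0 powr (1 - q)) * (indicator {0..1::real} t * ennreal (w (x + t *\<^sub>R h) powr q)) \<partial>lborel) =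
             ennreal (r * t0 powr (1 - q)) * (\<integral>\<^sup>+t. indicator {0..1::real} t * ennreal (w (x + t *\<^sub>R h) powr q) \<partial>lborel)"
            by (rule nn_integral_cmult) measurable
          finally have "(\<integral>\<^sup>+t. ennreal (r * t0) * indicator {0..1::real} t +
             ennreal (r * t0 powr (1 - q)) * (indicator {0..1::real} t * ennreal (w (x + t *\<^sub>R h) powr q)) \<partial>lborel) =
             ennreal (r * t0) + ennreal (r * t0 powr (1 - q)) * (\<integral>\<^sup>+t. indicator {0..1::real} t * ennreal (w (x + t *\<^sub>R h) powr q) \<partial>lborel)" .
          then show "indicator B h * (\<integral>\<^sup>+t. ennreal (r * t0) * indicator {0..1::real} t +
             ennreal (r * t0 powr (1 - q)) * (indicator {0..1::real} t * ennreal (w (x + t *\<^sub>R h) powr q)) \<partial>lborel) =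
             ennreal (r * t0) * indicator B h +
             ennreal (r * t0 powr (1 - q)) * (indicator B h * (\<integral>\<^sup>+t. indicator {0..1::real} t * ennreal (w (x + t *\<^sub>R h) powr q) \<partial>lborel))"
            by (simp only: distrib_left mult_ac)
        qed
        also have "\<dots> = ennreal (r * t0) * ennreal m + ennreal (r * t0 powr (1 - q)) * I"
        proof -
          have "(\<integral>\<^sup>+h. ennreal (r * t0) * indicator B h \<partial>lborel) = ennreal (r * t0) * ennreal m"
            unfolding mB[symmetric] by (rule nn_integral_cmult_indicator) measurable
          moreover have "(\<integral>\<^sup>+h. ennreal (r * t0 powr (1 - q)) * (indicator B h * (\<integral>\<^sup>+t. indicator {0..1::real} t * ennreal (w (x + t *\<^sub>R h) powr q) \<partial>lborel)) \<partial>lborel)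
            = ennreal (r * t0 powr (1 - q)) * I"
            unfolding I_def by (rule nn_integral_cmult) measurable
          moreover have "(\<integral>\<^sup>+h. ennreal (r * t0) * indicator B h +
             ennreal (r * t0 powr (1 - q)) * (indicator B h * (\<integral>\<^sup>+t. indicator {0..1::real} t * ennreal (w (x + t *\<^sub>R h) powr q) \<partial>lborel)) \<partial>lborel) =
             (\<integral>\<^sup>+h. ennreal (r * t0) * indicator B h \<partial>lborel) +
             (\<integral>\<^sup>+h. ennreal (r * t0 powr (1 - q)) * (indicator B h * (\<integral>\<^sup>+t. indicator {0..1::real} t * ennreal (w (x + t *\<^sub>R h) powr q) \<partial>lborel)) \<partial>lborel)"
            by (rule nn_integral_add) measurable
          ultimately show ?thesis by (simp only:)
        qed
        also have "\<dots> = ennreal 1 * (ennreal (r * t0) * ennreal m + ennreal (r * t0 powr (1 - q)) * I)" by simp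
        finally have "ennreal \<bar>u x - ball_avg u x\<bar> \<le> ennreal (1 / m) * (ennreal (r * t0) * ennreal m + ennreal (r * t0 powr (1 - q)) * I)"
          using m by (intro ennreal_le_divide_const) auto
        also have "\<dots> = ennreal (t0 * r) + ennreal (t0 powr (1 - q)) * (ennreal (r / m) * I)"
        proof -
          have "ennreal (1 / m) * (ennreal (r * t0) * ennreal m) = ennreal (t0 * r)"
            using m r t0 by (simp add: ennreal_mult[symmetric])
          moreover have "ennreal (1 / m) * ennreal (r * t0 powr (1 - q)) = ennreal (t0 powr (1 - q)) * ennreal (r / m)"
            using m r t0 by (simp add: ennreal_mult[symmetric])
          ultimately show ?thesis by (simp only: distrib_left mult.assoc[symmetric])
        qed
        finally show "ennreal \<bar>u x - ball_avg u x\<bar> \<le> ennreal (t0 * r) + ennreal (t0 powr (1 - q)) * (ennreal (r / m) * I)" .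
      qed simp
      also have "\<dots> = ennreal (c * d x powr (q - n)) * I"
      proof -
        have "2 * (2 * r) powr (q - 1) * (r / m) = c * d x powr (q - n)"
        proof -
          have e: "2 * r = (2 * \<kappa>) * d x" by (simp add: r_def)
          have "d x powr (q - n) = d x powr (q - 1) * d x / d x powr n" using dx by (simp add: powr_diff)
          then show ?thesis unfolding m_def e unfolding r_def powr_mult c_def by (simp add: mult_ac)
        qed
        moreover have "ennreal (2 * (2 * r) powr (q - 1) * (r / m)) = ennreal (2 * (2 * r) powr (q - 1)) * ennreal (r / m)"
          using m r by (intro ennreal_mult) auto
        ultimately show ?thesis by (simp only: mult.assoc)
      qed
      also have "\<dots> = (\<integral>\<^sup>+h. (\<integral>\<^sup>+t. ennreal (c * d x powr (q - n)) * (indicator B h * (indicator {0..1::real} t * ennreal (w (x + t *\<^sub>R h) powr q))) \<partial>lborel) \<partial>lborel)"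
      proof -
        define k where "k = ennreal (c * d x powr (q - n))"
        have "(\<integral>\<^sup>+t. k * (indicator B h * (indicator {0..1::real} t * ennreal (w (x + t *\<^sub>R h) powr q))) \<partial>lborel) =
          k * (indicator B h * (\<integral>\<^sup>+t. indicator {0..1::real} t * ennreal (w (x + t *\<^sub>R h) powr q) \<partial>lborel))" for h
          by (subst nn_integral_cmult, measurable) (subst nn_integral_cmult; measurable)
        moreover have "(\<integral>\<^sup>+h. k * (indicator B h * (\<integral>\<^sup>+t. indicator {0..1::real} t * ennreal (w (x + t *\<^sub>R h) powr q) \<partial>lborel)) \<partial>lborel) = k * I"
          unfolding I_def by (rule nn_integral_cmult) measurable
        ultimately show ?thesis by (simp only: k_def)
      qed
      also have "\<dots> \<le> (\<integral>\<^sup>+h. (\<integral>\<^sup>+t. indicator {0..1::real} t * J h (x + t *\<^sub>R h) \<partial>lborel) \<partial>lborel)"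
      proof (intro nn_integral_mono)
        fix h :: 'a and t :: real
        show "ennreal (c * d x powr (q - n)) * (indicator B h * (indicator {0..1::real} t * ennreal (w (x + t *\<^sub>R h) powr q))) \<le>
          indicator {0..1::real} t * J h (x + t *\<^sub>R h)"
        proof (cases "h \<in> B \<and> t \<in> {0..1}")
          case True
          define z where "z = x + t *\<^sub>R h"
          have h: "norm h < r" and t: "0 \<le> t" "t \<le> 1" using True by (auto simp: B_def)
          have "dist x z = t * norm h" using t by (simp add: z_def dist_norm)
          also have "\<dots> \<le> norm h" using t by (simp add: mult_left_le_one_le)
          finally have "dist x z \<le> \<kappa> * d x" using h by (simp add: r_def)
          from near[OF x this] \<kappa> have nr: "z \<in> G" "d x \<le> 2 * d z" "d z \<le> 2 * d x" by auto
          have dz: "d z > 0" using d_pos[OF nr(1)] .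
          have "\<kappa> * d x \<le> \<kappa> * (2 * d z)" using \<kappa> nr by (intro mult_left_mono) auto
          then have hz: "norm h < 2 * \<kappa> * d z" using h by (simp add: r_def)
          have "d x powr (q - n) \<le> 2 powr \<bar>q - n\<bar> * d z powr (q - n)"
            by (rule powr_comparable[OF dz nr(3,2)])
          then have "c * d x powr (q - n) * w z powr q \<le> c * (2 powr \<bar>q - n\<bar> * d z powr (q - n)) * w z powr q"
            using c by (intro mult_right_mono mult_left_mono) auto
          then have "ennreal (c * d x powr (q - n)) * ennreal (w z powr q) \<le> ennreal (c' * d z powr (q - n) * w z powr q)"
            using c by (simp add: ennreal_mult[symmetric] c'_def mult.assoc ennreal_leI)
          then show ?thesis using True nr hz by (simp add: J_def z_def)
        qed auto
      qed
      finally show ?thesis using x by simp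
    qed simp
    have "(\<integral>\<^sup>+x. indicator G x * ennreal (\<bar>u x - ball_avg u x\<bar> powr q) \<partial>lborel) \<le>
       (\<integral>\<^sup>+x. (\<integral>\<^sup>+h. (\<integral>\<^sup>+t. indicator {0..1::real} t * J h (x + t *\<^sub>R h) \<partial>lborel) \<partial>lborel) \<partial>lborel)"
      by (rule nn_integral_mono_AE, rule AE_mp[OF controlledD(5)[OF uw]]) (use pointwise in auto)
    also have "\<dots> = (\<integral>\<^sup>+h. (\<integral>\<^sup>+z. J h z \<partial>lborel) \<partial>lborel)"
      by (rule nn_integral_segments) measurable
    also have "\<dots> = (\<integral>\<^sup>+z. (\<integral>\<^sup>+h. J h z \<partial>lborel) \<partial>lborel)"
      by (rule lborel_pair.Fubini'[symmetric]) measurable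
    also have "\<dots> = (\<integral>\<^sup>+z. ennreal (c' * (\<omega> * (2 * \<kappa>) powr n)) * (indicator G z * ennreal (d z powr q * w z powr q)) \<partial>lborel)"
    proof (intro nn_integral_cong)
      fix z
      show "(\<integral>\<^sup>+h. J h z \<partial>lborel) = ennreal (c' * (\<omega> * (2 * \<kappa>) powr n)) * (indicator G z * ennreal (d z powr q * w z powr q))"
      proof (cases "z \<in> G")
        case True
        have dz: "d z > 0" using d_pos[OF True] .
        have "(\<integral>\<^sup>+h. J h z \<partial>lborel) = (\<integral>\<^sup>+h. ennreal (c' * d z powr (q - n) * w z powr q) * indicator (ball (0::'a) (2 * \<kappa> * d z)) h \<partial>lborel)"
          using True by (intro nn_integral_cong) (auto simp: J_def split: split_indicator)
        also have "\<dots> = ennreal (c' * d z powr (q - n) * w z powr q) * ennreal (\<omega> * (2 * \<kappa> * d z) powr n)"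
          using \<kappa> dz by (subst nn_integral_cmult_indicator) (auto simp: emeasure_ball_powr)
        also have "\<dots> = ennreal (c' * d z powr (q - n) * w z powr q * (\<omega> * (2 * \<kappa> * d z) powr n))"
          using c' \<omega>_pos by (intro ennreal_mult[symmetric]) auto
        also have "c' * d z powr (q - n) * w z powr q * (\<omega> * (2 * \<kappa> * d z) powr n) = c' * (\<omega> * (2 * \<kappa>) powr n) * (d z powr q * w z powr q)"
          unfolding powr_mult[of "2 * \<kappa>"] using dz by (simp add: powr_diff)
        finally show ?thesis using True c' \<omega>_pos by (simp add: ennreal_mult)
      qed (simp add: J_def)
    qed
    also have "\<dots> = ennreal (c' * (\<omega> * (2 * \<kappa>) powr n)) * (\<integral>\<^sup>+z. indicator G z * ennreal (d z powr q * w z powr q) \<partial>lborel)"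
      by (rule nn_integral_cmult) measurable
    finally show "(\<integral>\<^sup>+x. indicator G x * ennreal (\<bar>u x - ball_avg u x\<bar> powr q) \<partial>lborel) \<le>
      ennreal (c' * (\<omega> * (2 * \<kappa>) powr n)) * (\<integral>\<^sup>+z. indicator G z * ennreal (d z powr q * w z powr q) \<partial>lborel)" .
  qed
qed

lemma ball_avg_measurable: 
  assumes [measurable]: "u \<in> borel_measurable borel"
  shows "ball_avg u \<in> borel_measurable borel"
proof -
  \<comment> \<open>In this form the integrand is visibly measurable in the pair
    \<open>(x, y)\<close>, although the ball moves with \<open>x\<close>.\<close>
  have "(\<lambda>x. \<integral>y. (if dist x y < \<kappa> * d x then 1 else 0) * u y \<partial>lborel) \<in> borel_measurable borel"
    by measurable
  moreover have "(\<lambda>x. \<integral>y. (if dist x y < \<kappa> * d x then 1 else 0) * u y \<partial>lborel) = (\<lambda>x. \<integral>y. indicator (ball x (\<kappa> * d x)) y * u y \<partial>lborel)"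
    by (intro ext Bochner_Integration.integral_cong) (auto split: split_indicator)
  ultimately have [measurable]: "(\<lambda>x. \<integral>y. indicator (ball x (\<kappa> * d x)) y * u y \<partial>lborel) \<in> borel_measurable borel"
    by (simp only:)
  show ?thesis unfolding ball_avg_def by measurable
qed

text \<open>Add the local oscillation and the chain estimate for the averages. The constant depends
  on neither \<open>u\<close> nor \<open>w\<close>, which permits scaling afterwards; the summand 1
  carries the error term of Young's inequality and the region where \<open>w\<close> is
  small.\<close>

lemma oscillation_estimate:
  assumes "1 \<le> q" "q < p" "0 \<le> s" "0 < \<epsilon>"
    and "0 < (b * n * q + (\<epsilon> - n + (1 - \<epsilon>) * q) * p) / (p - q) + n + b * s"
    and fin: "(\<integral>\<^sup>+x\<in>G. ennreal (d x powr (- s)) \<partial>lborel) < \<infinity>"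
  obtains c where "c > 0" "\<And>u w. controlled u w \<Longrightarrow>
    (\<integral>\<^sup>+x. indicator G x * ennreal (\<bar>u x - ball_avg u x0\<bar> powr q) \<partial>lborel) \<le>
      ennreal c * (1 + (\<integral>\<^sup>+x. indicator G x * ennreal (w x powr p) \<partial>lborel))"
proof -
  define e where "e = \<epsilon> - n + (1 - \<epsilon>) * q"
  define E where "E = (b * n * q + e * p) / (p - q)"
  obtain c1 where c1: "c1 > 0" "\<And>u w x. controlled u w \<Longrightarrow> x \<in> G \<Longrightarrow>
    ennreal (\<bar>ball_avg u x - ball_avg u x0\<bar> powr q) \<le> ennreal c1 * energy e q w x"
    using ball_avg_powr_le_energy[OF assms(4,1)] unfolding e_def by blast
  obtain c2 where c2: "c2 > 0" "\<And>u w. controlled u w \<Longrightarrow>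
    (\<integral>\<^sup>+x. indicator G x * ennreal (\<bar>u x - ball_avg u x\<bar> powr q) \<partial>lborel) \<le>
      ennreal c2 * (\<integral>\<^sup>+z. indicator G z * ennreal (d z powr q * w z powr q) \<partial>lborel)"
    using local_oscillation_powr[OF assms(1)] by blast
  have "(\<integral>\<^sup>+x. energy E 0 (\<lambda>_. 1) x \<partial>lborel) < \<infinity>"
    using assms(5) unfolding E_def e_def by (intro energy_constant_part[OF assms(3) _ fin]) auto
  then obtain c3 where c3: "c3 \<ge> 0" "(\<integral>\<^sup>+x. energy E 0 (\<lambda>_. 1) x \<partial>lborel) = ennreal c3"
    by (metis ennreal_cases infinity_ennreal_def less_irrefl)
  define \<mu> where "\<mu> = measure lborel G"
  have \<mu>: "emeasure lborel G = ennreal \<mu>" "\<mu> \<ge> 0"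
    using emeasure_bounded_finite[OF bounded_G] by (auto simp: \<mu>_def emeasure_eq_ennreal_measure)
  define M where "M = 2 powr q * (c2 * D0 powr q * (\<mu> + 1) + c1 * (S0 * c7 + c3)) + 1"
  have "0 \<le> 2 powr q * (c2 * D0 powr q * (\<mu> + 1) + c1 * (S0 * c7 + c3))"
    using c1(1) c2(1) c3(1) \<mu>(2) S0_nonneg c7_nonneg by (intro mult_nonneg_nonneg add_nonneg_nonneg) auto
  then have M: "M > 0" by (simp add: M_def)
  show thesis
  proof (rule that[OF M])
    fix u w assume uw: "controlled u w"
    note [measurable] = controlledD(2,3)[OF uw] ball_avg_measurable[OF controlledD(2)[OF uw]]
    note w = controlledD(4)[OF uw]
    define W where "W = (\<integral>\<^sup>+x. indicator G x * ennreal (w x powr p) \<partial>lborel)"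
    have 1: "(\<integral>\<^sup>+x. indicator G x * ennreal (\<bar>u x - ball_avg u x\<bar> powr q) \<partial>lborel) \<le> ennreal (c2 * D0 powr q * (\<mu> + 1)) * (1 + W)"
    proof -
      have "(\<integral>\<^sup>+z. indicator G z * ennreal (d z powr q * w z powr q) \<partial>lborel) \<le>
        (\<integral>\<^sup>+z. ennreal (D0 powr q) * indicator G z + ennreal (D0 powr q) * (indicator G z * ennreal (w z powr p)) \<partial>lborel)"
      proof (intro nn_integral_mono)
        fix z
        show "indicator G z * ennreal (d z powr q * w z powr q) \<le> ennreal (D0 powr q) * indicator G z + ennreal (D0 powr q) * (indicator G z * ennreal (w z powr p))"
        proof (cases "z \<in> G")
          case True
          have "w z powr q \<le> 1 + w z powr p"
          proof (cases "w z \<le> 1")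
            case True
            then have "w z powr q \<le> 1" using w assms(1) by (intro powr_le1) auto
            then show ?thesis by (simp add: add_increasing2)
          next
            case False
            then have "w z powr q \<le> w z powr p" using assms by (intro powr_mono) auto
            then show ?thesis by simp
          qed
          then have "d z powr q * w z powr q \<le> D0 powr q * (1 + w z powr p)"
            using d_le[OF True] d_pos[OF True] assms by (intro mult_mono powr_mono2) auto
          then have "ennreal (d z powr q * w z powr q) \<le> ennreal (D0 powr q + D0 powr q * w z powr p)"
            by (intro ennreal_leI) (simp add: algebra_simps)
          then show ?thesis using True by (simp add: ennreal_mult)
        qed simp
      qed
      also have "\<dots> = ennreal (D0 powr q) * ennreal \<mu> + ennreal (D0 powr q) * W"
      proof -
        have "(\<integral>\<^sup>+z. indicator G z \<partial>lborel) = ennreal \<mu>" unfolding \<mu>(1)[symmetric] by (rule nn_integral_indicator) measurable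
        moreover have "(\<integral>\<^sup>+z. ennreal (D0 powr q) * indicator G z + ennreal (D0 powr q) * (indicator G z * ennreal (w z powr p)) \<partial>lborel) =
          ennreal (D0 powr q) * (\<integral>\<^sup>+z. indicator G z \<partial>lborel) + ennreal (D0 powr q) * W"
          unfolding W_def by (rule nn_integral_linear) measurable
        ultimately show ?thesis by (simp only:)
      qed
      also have "\<dots> \<le> ennreal (D0 powr q * (\<mu> + 1)) * (1 + W)"
        using \<mu>(2) by (simp add: ennreal_mult distrib_left distrib_right add_increasing2 add_left_mono)
      finally have "ennreal c2 * (\<integral>\<^sup>+z. indicator G z * ennreal (d z powr q * w z powr q) \<partial>lborel) \<le> ennreal c2 * (ennreal (D0 powr q * (\<mu> + 1)) * (1 + W))"
        by (intro mult_left_mono) auto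
      with c2(2)[OF uw] have "(\<integral>\<^sup>+x. indicator G x * ennreal (\<bar>u x - ball_avg u x\<bar> powr q) \<partial>lborel) \<le> ennreal c2 * (ennreal (D0 powr q * (\<mu> + 1)) * (1 + W))"
        by (rule order_trans)
      also have "ennreal c2 * (ennreal (D0 powr q * (\<mu> + 1)) * (1 + W)) = ennreal (c2 * D0 powr q * (\<mu> + 1)) * (1 + W)"
        using c2 \<mu> by (simp add: mult.assoc[symmetric] ennreal_mult[symmetric])
      finally show ?thesis .
    qed
    have 2: "(\<integral>\<^sup>+x. indicator G x * ennreal (\<bar>ball_avg u x - ball_avg u x0\<bar> powr q) \<partial>lborel) \<le> ennreal (c1 * (S0 * c7 + c3)) * (1 + W)"
    proof -
      have "(\<integral>\<^sup>+x. indicator G x * ennreal (\<bar>ball_avg u x - ball_avg u x0\<bar> powr q) \<partial>lborel) \<le>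
        (\<integral>\<^sup>+x. ennreal c1 * (energy (- (b * n)) p w x + energy E 0 (\<lambda>_. 1) x) \<partial>lborel)"
      proof (intro nn_integral_mono)
        fix x
        show "indicator G x * ennreal (\<bar>ball_avg u x - ball_avg u x0\<bar> powr q) \<le> ennreal c1 * (energy (- (b * n)) p w x + energy E 0 (\<lambda>_. 1) x)"
        proof (cases "x \<in> G")
          case True
          have "ennreal (\<bar>ball_avg u x - ball_avg u x0\<bar> powr q) \<le> ennreal c1 * energy e q w x" by (rule c1(2)[OF uw True])
          also have "\<dots> \<le> ennreal c1 * (energy (- (b * n)) p w x + energy E 0 (\<lambda>_. 1) x)"
            unfolding E_def using assms w by (intro mult_left_mono energy_split) auto
          finally show ?thesis using True by simp
        qed simp
      qed
      also have "\<dots> = ennreal c1 * ((\<integral>\<^sup>+x. energy (- (b * n)) p w x \<partial>lborel) + ennreal c3)"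
        unfolding c3(2)[symmetric] distrib_left by (rule nn_integral_linear) measurable
      also have "\<dots> \<le> ennreal c1 * (ennreal (S0 * c7) * W + ennreal c3)"
        unfolding W_def by (intro mult_left_mono add_right_mono energy_gradient_part) auto
      also have "\<dots> \<le> ennreal c1 * (ennreal (S0 * c7 + c3) * (1 + W))"
        using S0_nonneg c7_nonneg c3
        by (intro mult_left_mono) (auto simp: distrib_left distrib_right add_increasing add_increasing2 add.commute intro!: add_mono)
      also have "\<dots> = ennreal (c1 * (S0 * c7 + c3)) * (1 + W)"
        using c1 c3 S0_nonneg c7_nonneg by (simp only: ennreal_mult mult.assoc add_nonneg_nonneg mult_nonneg_nonneg less_imp_le)
      finally show ?thesis .
    qed
    have "(\<integral>\<^sup>+x. indicator G x * ennreal (\<bar>u x - ball_avg u x0\<bar> powr q) \<partial>lborel) \<le>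
      (\<integral>\<^sup>+x. ennreal (2 powr q) * (indicator G x * ennreal (\<bar>u x - ball_avg u x\<bar> powr q)) + ennreal (2 powr q) * (indicator G x * ennreal (\<bar>ball_avg u x - ball_avg u x0\<bar> powr q)) \<partial>lborel)"
    proof (intro nn_integral_mono)
      fix x
      have "\<bar>u x - ball_avg u x0\<bar> powr q \<le> 2 powr q * (\<bar>u x - ball_avg u x\<bar> powr q + \<bar>ball_avg u x - ball_avg u x0\<bar> powr q)"
        using assms by (intro powr_abs_add_le) auto
      then have "ennreal (\<bar>u x - ball_avg u x0\<bar> powr q) \<le> ennreal (2 powr q * \<bar>u x - ball_avg u x\<bar> powr q + 2 powr q * \<bar>ball_avg u x - ball_avg u x0\<bar> powr q)"
        by (intro ennreal_leI) (simp only: distrib_left)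
      also have "\<dots> = ennreal (2 powr q) * ennreal (\<bar>u x - ball_avg u x\<bar> powr q) + ennreal (2 powr q) * ennreal (\<bar>ball_avg u x - ball_avg u x0\<bar> powr q)"
      proof -
        have "ennreal (2 powr q * r powr q) = ennreal (2 powr q) * ennreal (r powr q)" for r
          by (rule ennreal_mult) simp_all
        then show ?thesis by (subst ennreal_plus) simp_all
      qed
      finally show "indicator G x * ennreal (\<bar>u x - ball_avg u x0\<bar> powr q) \<le> ennreal (2 powr q) * (indicator G x * ennreal (\<bar>u x - ball_avg u x\<bar> powr q)) + ennreal (2 powr q) * (indicator G x * ennreal (\<bar>ball_avg u x - ball_avg u x0\<bar> powr q))"
        by (simp split: split_indicator)
    qed
    also have "\<dots> = ennreal (2 powr q) * ((\<integral>\<^sup>+x. indicator G x * ennreal (\<bar>u x - ball_avg u x\<bar> powr q) \<partial>lborel) + (\<integral>\<^sup>+x. indicator G x * ennreal (\<bar>ball_avg u x - ball_avg u x0\<bar> powr q) \<partial>lborel))"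
      unfolding distrib_left[of "ennreal (2 powr q)"] by (rule nn_integral_linear) measurable
    also have "\<dots> \<le> ennreal (2 powr q) * (ennreal (c2 * D0 powr q * (\<mu> + 1)) * (1 + W) + ennreal (c1 * (S0 * c7 + c3)) * (1 + W))"
      by (intro mult_left_mono add_mono 1 2) auto
    also have "\<dots> = ennreal (2 powr q * (c2 * D0 powr q * (\<mu> + 1) + c1 * (S0 * c7 + c3))) * (1 + W)"
    proof -
      have "ennreal (2 powr q * (c2 * D0 powr q * (\<mu> + 1) + c1 * (S0 * c7 + c3))) = ennreal (2 powr q) * (ennreal (c2 * D0 powr q * (\<mu> + 1)) + ennreal (c1 * (S0 * c7 + c3)))"
        using c1 c2 c3 \<mu> S0_nonneg c7_nonneg by (subst ennreal_plus[symmetric]) (auto intro!: ennreal_mult simp del: ennreal_plus)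
      then show ?thesis by (metis distrib_right mult.assoc)
    qed
    also have "\<dots> \<le> ennreal M * (1 + W)" by (intro mult_right_mono ennreal_leI) (auto simp: M_def)
    finally show "(\<integral>\<^sup>+x. indicator G x * ennreal (\<bar>u x - ball_avg u x0\<bar> powr q) \<partial>lborel) \<le> ennreal M * (1 + (\<integral>\<^sup>+x. indicator G x * ennreal (w x powr p) \<partial>lborel))"
      by (simp add: W_def)
  qed
qed

end

section \<open>Weakly differentiable functions\<close>

context chain_domain
begin

text \<open>\<open>weak_difference\<close> gives a null set of \<open>x\<close> for each
  \<open>h\<close>. The set of good pairs is measurable, so Fubini turns this into a null set of
  \<open>h\<close> for almost every \<open>x\<close>.\<close>

lemma controlled_of_weak_gradient:
  fixes v :: "'a \<Rightarrow> 'a"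
  assumes u: "integrable lborel u" and v: "integrable lborel v"
    and weak: "\<And>\<psi> i. test_function G \<psi> \<Longrightarrow> i \<in> Basis \<Longrightarrow>
      (\<integral>x. u x * frechet_derivative \<psi> (at x) i \<partial>lborel) = - (\<integral>x. (v x \<bullet> i) * \<psi> x \<partial>lborel)"
  shows "controlled u (\<lambda>x. norm (v x))"
proof -
  note [measurable] = borel_measurable_integrable[OF u] borel_measurable_integrable[OF v]
  define P where "P h x \<longleftrightarrow> (x \<in> G \<and> norm h < d x \<longrightarrow>
      ennreal \<bar>u (x + h) - u x\<bar> \<le> (\<integral>\<^sup>+t\<in>{0..1}. ennreal (norm h * norm (v (x + t *\<^sub>R h))) \<partial>lborel))" for h x
  have "AE x in lborel. P h x" for h
  proof -
    have open_U: "open ({x. norm h < d x} \<inter> G)"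
      using open_G by (intro open_Int open_Collect_less d_continuous continuous_intros)
    have "AE x in lborel. x \<in> {x. norm h < d x} \<inter> G \<longrightarrow>
      ennreal \<bar>u (x + h) - u x\<bar> \<le> (\<integral>\<^sup>+t\<in>{0..1}. ennreal (norm h * norm (v (x + t *\<^sub>R h))) \<partial>lborel)"
    proof (rule weak_difference[where G = G, OF u v _ open_U])
      show "(\<integral>x. u x * frechet_derivative \<psi> (at x) i \<partial>lborel) = - (\<integral>x. (v x \<bullet> i) * \<psi> x \<partial>lborel)"
        if "test_function G \<psi>" "i \<in> Basis" for \<psi> i using weak[OF that] .
      fix y t assume y: "y \<in> {x. norm h < d x} \<inter> G" and t: "t \<in> {0..1::real}"
      have "dist y (y + t *\<^sub>R h) = t * norm h" using t by (simp add: dist_norm)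
      also have "\<dots> \<le> norm h" using t by (simp add: mult_left_le_one_le)
      finally show "y + t *\<^sub>R h \<in> G" using y ball_subset[of y] by auto
    qed
    then show ?thesis by (auto simp: P_def)
  qed
  then have "AE h in lborel. AE x in lborel. P h x" by simp
  moreover have "{z \<in> space (lborel \<Otimes>\<^sub>M lborel). P (fst z) (snd z)} \<in> sets (lborel \<Otimes>\<^sub>M lborel)"
    unfolding P_def by measurable
  ultimately have "AE x in lborel. AE h in lborel. P h x"
    by (subst (asm) lborel_pair.AE_commute) auto
  then show ?thesis using u unfolding controlled_def P_def by auto
qed

end

section \<open>Borel representatives of Lebesgue measurable functions\<close>

lemma set_integral_representative:
  fixes u u0 :: "'a::euclidean_space \<Rightarrow> 'b::euclidean_space" and F :: "'b \<Rightarrow> real"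
  assumes m: "set_borel_measurable lebesgue G u" and [measurable]: "G \<in> sets borel"
    and [measurable]: "u0 \<in> borel_measurable borel" "F \<in> borel_measurable borel"
    and F: "\<And>y. 0 \<le> F y" and ae: "AE x in lborel. x \<in> G \<longrightarrow> u0 x = u x"
  shows "(LINT x:G|lebesgue. F (u x)) = enn2real (\<integral>\<^sup>+x. indicator G x * ennreal (F (u0 x)) \<partial>lborel)"
proof -
  have "(\<lambda>x. F (indicator G x *\<^sub>R u x)) \<in> borel_measurable lebesgue"
    using m assms(4) unfolding set_borel_measurable_def by (rule measurable_compose)
  moreover have "G \<in> sets lebesgue" by simp
  ultimately have "(\<lambda>x. indicator G x *\<^sub>R F (indicator G x *\<^sub>R u x)) \<in> borel_measurable lebesgue"
    by (intro borel_measurable_scaleR borel_measurable_indicator)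
  moreover have "(\<lambda>x. indicator G x *\<^sub>R F (indicator G x *\<^sub>R u x)) = (\<lambda>x. indicator G x *\<^sub>R F (u x))"
    by (auto simp: fun_eq_iff split: split_indicator)
  ultimately have 1: "(\<lambda>x. indicator G x *\<^sub>R F (u x)) \<in> borel_measurable lebesgue" by (simp only:)
  have 2: "(\<lambda>x. indicator G x *\<^sub>R F (u0 x)) \<in> borel_measurable lborel" by measurable
  have "(LINT x:G|lebesgue. F (u x)) = (LINT x|lebesgue. indicator G x *\<^sub>R F (u0 x))"
    unfolding set_lebesgue_integral_def
  proof (rule integral_cong_AE[OF 1])
    show "AE x in lebesgue. indicator G x *\<^sub>R F (u x) = indicator G x *\<^sub>R F (u0 x)"
      using AE_completion[OF ae] by eventually_elim (auto split: split_indicator)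
  qed (use 2 in \<open>auto intro: measurable_completion\<close>)
  also have "\<dots> = (LINT x|lborel. indicator G x *\<^sub>R F (u0 x))"
    by (rule integral_completion[OF 2])
  \<comment> \<open>Valid also when the integral is infinite: both sides are then 0.\<close>
  also have "\<dots> = enn2real (\<integral>\<^sup>+x. ennreal (indicator G x *\<^sub>R F (u0 x)) \<partial>lborel)"
    using F by (intro integral_eq_nn_integral 2) auto
  also have "(\<integral>\<^sup>+x. ennreal (indicator G x *\<^sub>R F (u0 x)) \<partial>lborel) = (\<integral>\<^sup>+x. indicator G x * ennreal (F (u0 x)) \<partial>lborel)"
    by (intro nn_integral_cong) (auto split: split_indicator)
  finally show ?thesis .
qed

text \<open>Borel representatives are chosen coordinatewise for the extension of \<open>u\<close> by
  0. That extension is integrable because \<open>norm (u x) \<le> 1 + norm (u x) powr p\<close> and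
  \<open>G\<close> has finite measure.\<close>

lemma Lp_on_representative:
  fixes u :: "'a::euclidean_space \<Rightarrow> 'b::euclidean_space"
  assumes u: "u \<in> Lp_on p G" and "1 \<le> p" "open G" "bounded G"
  obtains u0 where "integrable lborel u0" "AE x in lborel. u0 x = indicator G x *\<^sub>R u x"
    "(\<integral>\<^sup>+x. indicator G x * ennreal (norm (u0 x) powr p) \<partial>lborel) < \<infinity>"
proof -
  have [measurable]: "G \<in> sets borel" using assms by auto
  define g where "g = (\<lambda>x. indicator G x *\<^sub>R u x)"
  have [measurable]: "g \<in> borel_measurable lebesgue"
    using u by (simp add: Lp_on_def set_borel_measurable_def g_def)
  have "\<exists>h\<in>borel_measurable lborel. AE x in lborel. g x \<bullet> i = h x" for i
    by (rule completion_ex_borel_measurable_real) measurable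
  then obtain h where h: "\<And>i. h i \<in> borel_measurable lborel" "\<And>i. AE x in lborel. g x \<bullet> i = h i x" by metis
  note [measurable] = h(1)[simplified]
  define u0 where "u0 x = (\<Sum>i\<in>Basis. h i x *\<^sub>R i)" for x
  have [measurable]: "u0 \<in> borel_measurable borel" unfolding u0_def by measurable
  have "AE x in lborel. \<forall>i\<in>Basis. g x \<bullet> i = h i x" using h(2) by (subst AE_finite_all) auto
  then have ae: "AE x in lborel. u0 x = g x"
  proof eventually_elim
    case (elim x)
    then have "u0 x = (\<Sum>i\<in>Basis. (g x \<bullet> i) *\<^sub>R i)" unfolding u0_def by (intro sum.cong) auto
    then show ?case by (simp only: euclidean_representation)
  qed
  have ip: "integrable lebesgue (\<lambda>x. indicator G x *\<^sub>R (norm (u x) powr p))"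
    using u by (simp add: Lp_on_def set_integrable_def)
  have ind: "integrable lebesgue (\<lambda>x. indicator G x :: real)"
    using emeasure_bounded_finite[OF assms(4)] by (subst integrable_indicator_iff) (auto simp: top.not_eq_extremum)
  have "integrable lebesgue g"
  proof (rule Bochner_Integration.integrable_bound[OF Bochner_Integration.integrable_add[OF ind ip]])
    show "AE x in lebesgue. norm (g x) \<le> norm (indicator G x + indicator G x *\<^sub>R norm (u x) powr p)"
    proof (rule AE_I2)
      fix x
      have "norm (u x) \<le> 1 + norm (u x) powr p"
      proof (cases "norm (u x) \<le> 1")
        case False
        then have "norm (u x) powr 1 \<le> norm (u x) powr p" using assms(2) by (intro powr_mono) auto
        then show ?thesis using False by simp
      qed (simp add: add_increasing2)
      then show "norm (g x) \<le> norm (indicator G x + indicator G x *\<^sub>R norm (u x) powr p)"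
        by (simp add: g_def split: split_indicator)
    qed
  qed measurable
  moreover have "u0 \<in> borel_measurable lebesgue" by (rule measurable_completion) measurable
  ultimately have "integrable lebesgue u0"
    using AE_completion[OF ae] by (subst integrable_cong_AE[where g = g]) auto
  then have 1: "integrable lborel u0" by (subst (asm) integrable_completion) auto
  have "(\<integral>\<^sup>+x. indicator G x * ennreal (norm (u0 x) powr p) \<partial>lborel) = (\<integral>\<^sup>+x. indicator G x * ennreal (norm (u0 x) powr p) \<partial>lebesgue)"
    by (rule nn_integral_completion[symmetric])
  also have "\<dots> = (\<integral>\<^sup>+x. ennreal (norm (indicator G x *\<^sub>R (norm (u x) powr p))) \<partial>lebesgue)"
    using AE_completion[OF ae] by (intro nn_integral_cong_AE, eventually_elim) (auto simp: g_def split: split_indicator)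
  also have "\<dots> < \<infinity>" using ip by (simp add: integrable_iff_bounded)
  finally show thesis using that[OF 1 ae[unfolded g_def]] by simp
qed

lemma weak_gradient_on_representatives:
  assumes wg: "weak_gradient_on G u v" and G: "G \<in> sets borel"
    and mu: "set_borel_measurable lebesgue G u" and mv: "set_borel_measurable lebesgue G v"
    and u0: "u0 \<in> borel_measurable borel" "AE x in lborel. u0 x = indicator G x *\<^sub>R u x"
    and v0: "v0 \<in> borel_measurable borel" "AE x in lborel. v0 x = indicator G x *\<^sub>R v x"
    and \<psi>: "test_function G \<psi>" and i: "i \<in> Basis"
  shows "(\<integral>x. u0 x * frechet_derivative \<psi> (at x) i \<partial>lborel) = - (\<integral>x. (v0 x \<bullet> i) * \<psi> x \<partial>lborel)"
proof -
  note [measurable] = u0(1) v0(1) G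
  have [measurable]: "(\<lambda>x. indicator G x *\<^sub>R u x) \<in> borel_measurable lebesgue" "(\<lambda>x. indicator G x *\<^sub>R v x) \<in> borel_measurable lebesgue"
    using mu mv by (auto simp: set_borel_measurable_def)
  have "C_k (Suc 0) \<psi>" "C_k 0 \<psi>" using \<psi> unfolding test_function_def by blast+
  then have [measurable]: "(\<lambda>x. frechet_derivative \<psi> (at x) i) \<in> borel_measurable borel" "\<psi> \<in> borel_measurable borel"
    using i by (auto intro: borel_measurable_continuous_onI)
  have m1: "(\<lambda>x. u0 x * frechet_derivative \<psi> (at x) i) \<in> borel_measurable lborel"
    "(\<lambda>x. (v0 x \<bullet> i) * \<psi> x) \<in> borel_measurable lborel" by measurable
  have l[measurable]: "(\<lambda>x. frechet_derivative \<psi> (at x) i) \<in> borel_measurable lebesgue" "\<psi> \<in> borel_measurable lebesgue"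
    by (rule measurable_completion, measurable)+
  have "(LINT x:G|lebesgue. u x * frechet_derivative \<psi> (at x) i) = (LINT x|lebesgue. u0 x * frechet_derivative \<psi> (at x) i)"
    unfolding set_lebesgue_integral_def
  proof (rule integral_cong_AE)
    have "(\<lambda>x. (indicator G x *\<^sub>R u x) * frechet_derivative \<psi> (at x) i) \<in> borel_measurable lebesgue" by measurable
    then show "(\<lambda>x. indicator G x *\<^sub>R (u x * frechet_derivative \<psi> (at x) i)) \<in> borel_measurable lebesgue" by (simp add: mult.assoc)
    show "AE x in lebesgue. indicator G x *\<^sub>R (u x * frechet_derivative \<psi> (at x) i) = u0 x * frechet_derivative \<psi> (at x) i"
      using AE_completion[OF u0(2)] by eventually_elim simp
  qed (rule measurable_completion[OF m1(1)])
  also have "\<dots> = (\<integral>x. u0 x * frechet_derivative \<psi> (at x) i \<partial>lborel)" by (rule integral_completion[OF m1(1)])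
  finally have 1: "(LINT x:G|lebesgue. u x * frechet_derivative \<psi> (at x) i) = (\<integral>x. u0 x * frechet_derivative \<psi> (at x) i \<partial>lborel)" .
  have "(LINT x:G|lebesgue. (v x \<bullet> i) * \<psi> x) = (LINT x|lebesgue. (v0 x \<bullet> i) * \<psi> x)"
    unfolding set_lebesgue_integral_def
  proof (rule integral_cong_AE)
    have "(\<lambda>x. ((indicator G x *\<^sub>R v x) \<bullet> i) * \<psi> x) \<in> borel_measurable lebesgue" by measurable
    then show "(\<lambda>x. indicator G x *\<^sub>R ((v x \<bullet> i) * \<psi> x)) \<in> borel_measurable lebesgue" by (simp add: mult.assoc)
    show "AE x in lebesgue. indicator G x *\<^sub>R ((v x \<bullet> i) * \<psi> x) = (v0 x \<bullet> i) * \<psi> x"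
      using AE_completion[OF v0(2)] by eventually_elim simp
  qed (rule measurable_completion[OF m1(2)])
  also have "\<dots> = (\<integral>x. (v0 x \<bullet> i) * \<psi> x \<partial>lborel)" by (rule integral_completion[OF m1(2)])
  finally have 2: "(LINT x:G|lebesgue. (v x \<bullet> i) * \<psi> x) = (\<integral>x. (v0 x \<bullet> i) * \<psi> x \<partial>lborel)" .
  have "(LINT x:G|lebesgue. u x * frechet_derivative \<psi> (at x) i) = - (LINT x:G|lebesgue. (v x \<bullet> i) * \<psi> x)"
    using wg \<psi> i unfolding weak_gradient_on_def by blast
  then show ?thesis unfolding 1 2 .
qed

text \<open>The mean is optimal up to a constant: by linearised Jensen for the normalised measure on
  \<open>G\<close>, its distance to any \<open>a\<close> is bounded by the oscillation about
  \<open>a\<close>. This allows passing from a ball average at \<open>x0\<close> to the mean over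
  \<open>G\<close>.\<close>

lemma mean_oscillation_le:
  fixes u :: "'a::euclidean_space \<Rightarrow> real"
  assumes u: "integrable lborel u" and [measurable]: "G \<in> sets borel"
    and \<mu>: "emeasure lborel G = ennreal \<mu>" "0 < \<mu>" and q: "1 \<le> q"
  shows "(\<integral>\<^sup>+x. indicator G x * ennreal (\<bar>u x - (\<integral>y. indicator G y * u y \<partial>lborel) / \<mu>\<bar> powr q) \<partial>lborel) \<le>
    ennreal (2 powr q * (1 + 2 powr q)) * (\<integral>\<^sup>+x. indicator G x * ennreal (\<bar>u x - a\<bar> powr q) \<partial>lborel)"
proof -
  note [measurable] = borel_measurable_integrable[OF u]
  define A where "A = (\<integral>y. indicator G y * u y \<partial>lborel) / \<mu>"
  define Y where "Y = (\<integral>\<^sup>+x. indicator G x * ennreal (\<bar>u x - a\<bar> powr q) \<partial>lborel)"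
  have mG: "(\<integral>\<^sup>+x. indicator G x \<partial>lborel) = ennreal \<mu>" using \<mu>(1) by (subst nn_integral_indicator) auto
  have "ennreal (\<bar>A - a\<bar> powr q) \<le> ennreal (2 * (2 * 1) powr (q - 1)) * (ennreal (1 / \<mu>) * Y)"
  proof (rule powr_le_of_linearised)
    fix t :: real assume t: "0 < t"
    have "ennreal \<mu> * ennreal \<bar>A - a\<bar> \<le> (\<integral>\<^sup>+x. indicator G x * ennreal \<bar>u x - a\<bar> \<partial>lborel)"
      unfolding A_def by (rule average_diff_le[OF u _ \<mu>]) measurable
    also have "\<dots> \<le> (\<integral>\<^sup>+x. ennreal t * indicator G x + ennreal (t powr (1 - q)) * (indicator G x * ennreal (\<bar>u x - a\<bar> powr q)) \<partial>lborel)"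
    proof (intro nn_integral_mono)
      fix x
      have "ennreal \<bar>u x - a\<bar> \<le> ennreal (t + t powr (1 - q) * \<bar>u x - a\<bar> powr q)"
        using t q by (intro ennreal_leI le_add_powr) auto
      also have "\<dots> = ennreal t + ennreal (t powr (1 - q)) * ennreal (\<bar>u x - a\<bar> powr q)"
        using t by (simp add: ennreal_mult)
      finally show "indicator G x * ennreal \<bar>u x - a\<bar> \<le> ennreal t * indicator G x + ennreal (t powr (1 - q)) * (indicator G x * ennreal (\<bar>u x - a\<bar> powr q))"
        by (cases "x \<in> G") simp_all
    qed
    also have "\<dots> = ennreal t * ennreal \<mu> + ennreal (t powr (1 - q)) * Y"
      unfolding Y_def mG[symmetric] by (rule nn_integral_linear) measurable
    also have "\<dots> = ennreal 1 * (ennreal t * ennreal \<mu> + ennreal (t powr (1 - q)) * Y)" by simp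
    finally have "ennreal \<bar>A - a\<bar> \<le> ennreal (1 / \<mu>) * (ennreal t * ennreal \<mu> + ennreal (t powr (1 - q)) * Y)"
      by (intro ennreal_le_divide_const \<mu>) auto
    also have "\<dots> = ennreal (t * 1) + ennreal (t powr (1 - q)) * (ennreal (1 / \<mu>) * Y)"
    proof -
      have "ennreal (1 / \<mu>) * (ennreal t * ennreal \<mu>) = ennreal (t * 1)"
        using t \<mu> by (simp add: ennreal_mult[symmetric])
      then show ?thesis by (simp only: distrib_left) (simp only: mult.left_commute)
    qed
    finally show "ennreal \<bar>A - a\<bar> \<le> ennreal (t * 1) + ennreal (t powr (1 - q)) * (ennreal (1 / \<mu>) * Y)" .
  qed auto
  also have "2 * (2 * 1) powr (q - 1) = 2 powr q" by (simp add: powr_diff)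
  finally have mean: "ennreal (\<bar>a - A\<bar> powr q) \<le> ennreal (2 powr q) * (ennreal (1 / \<mu>) * Y)"
    by (simp add: abs_minus_commute)
  have "(\<integral>\<^sup>+x. indicator G x * ennreal (\<bar>u x - A\<bar> powr q) \<partial>lborel) \<le>
    (\<integral>\<^sup>+x. ennreal (2 powr q) * (indicator G x * ennreal (\<bar>u x - a\<bar> powr q)) + (ennreal (2 powr q) * ennreal (\<bar>a - A\<bar> powr q)) * indicator G x \<partial>lborel)"
  proof (intro nn_integral_mono)
    fix x
    have "ennreal (\<bar>u x - A\<bar> powr q) \<le> ennreal (2 powr q * (\<bar>u x - a\<bar> powr q + \<bar>a - A\<bar> powr q))"
      using q by (intro ennreal_leI powr_abs_add_le) auto
    also have "\<dots> = ennreal (2 powr q) * ennreal (\<bar>u x - a\<bar> powr q) + ennreal (2 powr q) * ennreal (\<bar>a - A\<bar> powr q)"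
      by (subst ennreal_mult) (simp_all add: distrib_left)
    finally show "indicator G x * ennreal (\<bar>u x - A\<bar> powr q) \<le> ennreal (2 powr q) * (indicator G x * ennreal (\<bar>u x - a\<bar> powr q)) + (ennreal (2 powr q) * ennreal (\<bar>a - A\<bar> powr q)) * indicator G x"
      by (cases "x \<in> G") simp_all
  qed
  also have "\<dots> = ennreal (2 powr q) * Y + (ennreal (2 powr q) * ennreal (\<bar>a - A\<bar> powr q)) * ennreal \<mu>"
    unfolding Y_def mG[symmetric] by (rule nn_integral_linear) measurable
  also have "\<dots> \<le> ennreal (2 powr q) * Y + (ennreal (2 powr q) * (ennreal (2 powr q) * (ennreal (1 / \<mu>) * Y))) * ennreal \<mu>"
    by (intro add_left_mono mult_left_mono mult_right_mono mean) auto
  also have "\<dots> = ennreal (2 powr q * (1 + 2 powr q)) * Y"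
  proof -
    have "ennreal (1 / \<mu>) * ennreal \<mu> = 1" using \<mu> by (simp add: ennreal_mult[symmetric])
    then have "(ennreal (2 powr q) * (ennreal (2 powr q) * (ennreal (1 / \<mu>) * Y))) * ennreal \<mu> = ennreal (2 powr q) * (ennreal (2 powr q) * Y)"
      by (metis (no_types, opaque_lifting) mult.assoc mult.commute mult.right_neutral)
    moreover have "ennreal (2 powr q * (1 + 2 powr q)) = ennreal (2 powr q) * (1 + ennreal (2 powr q))"
      by (simp add: ennreal_mult)
    ultimately show ?thesis by (simp add: distrib_left distrib_right mult.assoc)
  qed
  finally show ?thesis by (simp add: A_def Y_def)
qed

text \<open>An inequality that is additive in the gradient energy becomes homogeneous, since it may be
  applied to all multiples of the function.\<close>

lemma homogeneous_of_scaled: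
  fixes p q c W :: real and X :: ennreal
  assumes "0 < q" "0 < p" "0 \<le> c" "0 \<le> W"
    and le: "\<And>t. 0 < t \<Longrightarrow> ennreal (t powr q) * X \<le> ennreal (c * (1 + t powr p * W))"
  shows "enn2real X powr (1 / q) \<le> (2 * c) powr (1 / q) * W powr (1 / p)"
proof -
  have "X < \<infinity>" using le[of 1] by (auto simp: less_top[symmetric] top_unique)
  then obtain x where x: "X = ennreal x" "0 \<le> x" by (cases X) auto
  have le': "t powr q * x \<le> c * (1 + t powr p * W)" if "0 < t" for t
    using le[OF that] x assms that by (simp add: ennreal_mult[symmetric] ennreal_le_iff)
  have "x \<le> 2 * c * W powr (q / p)"
  proof (cases "W = 0")
    case True
    have inv: "(y powr (1 / q)) powr q = y" if "0 < y" for y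
      using that assms(1) by (simp add: powr_powr)
    have "x = 0"
    proof (rule ccontr)
      assume "x \<noteq> 0"
      then have x': "x > 0" using x by simp
      \<comment> \<open>This \<open>t\<close> makes \<open>t powr q * x\<close> equal to
        \<open>c + 1\<close>, above the bound \<open>c\<close> that remains when
        \<open>W = 0\<close>.\<close>
      have t: "((c + 1) / x) powr (1 / q) > 0" using x' assms by simp
      have "(((c + 1) / x) powr (1 / q)) powr q = (c + 1) / x"
        using inv[of "(c + 1) / x"] x' assms(3) by simp
      then have "(((c + 1) / x) powr (1 / q)) powr q * x = c + 1" using x' by simp
      then show False using le'[OF t] True by simp
    qed
    then show ?thesis using assms by simp
  next
    case False
    then have W: "W > 0" using assms by simp
    \<comment> \<open>Normalises the energy: \<open>t powr p * W = 1\<close>.\<close>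
    define t where "t = W powr (- (1 / p))"
    have t: "t > 0" using W by (simp add: t_def)
    have "t powr p = W powr (- 1)" using assms(2) by (simp add: t_def powr_powr)
    then have "t powr p * W = 1" using W by (simp add: powr_minus)
    then have "t powr q * x \<le> 2 * c" using le'[OF t] by simp
    moreover have "t powr q = W powr (- (q / p))" by (simp add: t_def powr_powr)
    then have "t powr q = inverse (W powr (q / p))" by (simp only: powr_minus)
    ultimately show ?thesis using W by (simp add: field_simps)
  qed
  then have "x powr (1 / q) \<le> (2 * c * W powr (q / p)) powr (1 / q)"
    using x assms by (intro powr_mono2) auto
  also have "\<dots> = (2 * c) powr (1 / q) * W powr (1 / p)"
    using assms by (simp add: powr_mult powr_powr)
  finally show ?thesis using x by simp
qed

context chain_domain
begin

lemma supports_Poincare_of_parameters: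
  assumes "1 \<le> q" "q < p" "0 \<le> s" "0 < \<epsilon>"
    and "0 < (b * n * q + (\<epsilon> - n + (1 - \<epsilon>) * q) * p) / (p - q) + n + b * s"
    and "(\<integral>\<^sup>+x\<in>G. ennreal (d x powr (- s)) \<partial>lborel) < \<infinity>"
  shows "supports_Poincare q p G"
proof -
  obtain c where c: "c > 0" "\<And>u w. controlled u w \<Longrightarrow>
    (\<integral>\<^sup>+x. indicator G x * ennreal (\<bar>u x - ball_avg u x0\<bar> powr q) \<partial>lborel) \<le>
      ennreal c * (1 + (\<integral>\<^sup>+x. indicator G x * ennreal (w x powr p) \<partial>lborel))"
    using oscillation_estimate[OF assms] by blast
  define \<mu> where "\<mu> = measure lborel G"
  have \<mu>: "emeasure lborel G = ennreal \<mu>"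
    using emeasure_bounded_finite[OF bounded_G] by (auto simp: \<mu>_def emeasure_eq_ennreal_measure)
  have "0 < emeasure lborel (ball x0 (d x0))"
    using d_pos[OF x0] \<omega>_pos by (subst emeasure_ball_powr) auto
  also have "\<dots> \<le> emeasure lborel G" by (intro emeasure_mono ball_subset x0) auto
  finally have \<mu>_pos: "\<mu> > 0" by (simp add: \<mu>)
  have \<mu>': "measure lebesgue G = \<mu>" by (simp add: \<mu>_def measure_completion)
  define K where "K = 2 powr q * (1 + 2 powr q)"
  have K: "K > 0" by (simp add: K_def add_pos_pos)
  show ?thesis
    unfolding supports_Poincare_def
  proof (intro exI[of _ "(2 * (K * c)) powr (1 / q)"] ballI impI)
    fix u v assume u: "u \<in> sobolev_W1 p G" and v: "v \<in> Lp_on p G" and wg: "weak_gradient_on G u v"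
    have p: "1 \<le> p" using assms by simp
    have uL: "u \<in> Lp_on p G" using u by (simp add: sobolev_W1_def)
    have mu: "set_borel_measurable lebesgue G u" and mv: "set_borel_measurable lebesgue G v"
      using uL v by (auto simp: Lp_on_def)
    obtain u0 where u0: "integrable lborel u0" "AE x in lborel. u0 x = indicator G x *\<^sub>R u x"
      using Lp_on_representative[OF uL p open_G bounded_G] by blast
    obtain v0 where v0: "integrable lborel v0" "AE x in lborel. v0 x = indicator G x *\<^sub>R v x"
      "(\<integral>\<^sup>+x. indicator G x * ennreal (norm (v0 x) powr p) \<partial>lborel) < \<infinity>"
      using Lp_on_representative[OF v p open_G bounded_G] by blast
    note [measurable] = borel_measurable_integrable[OF u0(1)] borel_measurable_integrable[OF v0(1)]
    have u0b: "u0 \<in> borel_measurable borel" and v0b: "v0 \<in> borel_measurable borel" by measurable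
    have weak: "(\<integral>x. u0 x * frechet_derivative \<psi> (at x) i \<partial>lborel) = - (\<integral>x. (v0 x \<bullet> i) * \<psi> x \<partial>lborel)"
      if "test_function G \<psi>" "i \<in> Basis" for \<psi> i
      by (rule weak_gradient_on_representatives[OF wg G_measurable mu mv u0b u0(2) v0b v0(2) that])
    have ctrl: "controlled (\<lambda>x. t * u0 x) (\<lambda>x. norm (t *\<^sub>R v0 x))" for t
    proof (rule controlled_of_weak_gradient)
      show "integrable lborel (\<lambda>x. t * u0 x)" "integrable lborel (\<lambda>x. t *\<^sub>R v0 x)" using u0 v0 by auto
      fix \<psi> i assume "test_function G \<psi>" "i \<in> (Basis :: 'a set)"
      from weak[OF this] show "(\<integral>x. t * u0 x * frechet_derivative \<psi> (at x) i \<partial>lborel) = - (\<integral>x. (t *\<^sub>R v0 x \<bullet> i) * \<psi> x \<partial>lborel)"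
        by (simp add: mult.assoc)
    qed
    define W where "W = enn2real (\<integral>\<^sup>+x. indicator G x * ennreal (norm (v0 x) powr p) \<partial>lborel)"
    have W: "(\<integral>\<^sup>+x. indicator G x * ennreal (norm (v0 x) powr p) \<partial>lborel) = ennreal W" "W \<ge> 0"
      using v0(3) by (auto simp: W_def less_top)
    define A where "A = (\<integral>y. indicator G y * u0 y \<partial>lborel) / \<mu>"
    define X where "X = (\<integral>\<^sup>+x. indicator G x * ennreal (\<bar>u0 x - A\<bar> powr q) \<partial>lborel)"
    have scaled: "ennreal (t powr q) * X \<le> ennreal ((K * c) * (1 + t powr p * W))" if t: "0 < t" for t
    proof -
      \<comment> \<open>The constant for the scaled function varies with \<open>t\<close>;
        \<open>a / t\<close> is still admissible since \<open>mean_oscillation_le\<close> accepts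
        every constant.\<close>
      define a where "a = ball_avg (\<lambda>x. t * u0 x) x0"
      have "ennreal (t powr q) * X \<le> ennreal (t powr q) * (ennreal K * (\<integral>\<^sup>+x. indicator G x * ennreal (\<bar>u0 x - a / t\<bar> powr q) \<partial>lborel))"
        unfolding X_def A_def K_def by (intro mult_left_mono mean_oscillation_le u0 \<mu> \<mu>_pos assms) auto
      also have "\<dots> = ennreal K * (ennreal (t powr q) * (\<integral>\<^sup>+x. indicator G x * ennreal (\<bar>u0 x - a / t\<bar> powr q) \<partial>lborel))"
        by (rule mult.left_commute)
      also have "ennreal (t powr q) * (\<integral>\<^sup>+x. indicator G x * ennreal (\<bar>u0 x - a / t\<bar> powr q) \<partial>lborel) =
         (\<integral>\<^sup>+x. ennreal (t powr q) * (indicator G x * ennreal (\<bar>u0 x - a / t\<bar> powr q)) \<partial>lborel)"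
        by (rule nn_integral_cmult[symmetric]) measurable
      also have "\<dots> = (\<integral>\<^sup>+x. indicator G x * ennreal (\<bar>t * u0 x - a\<bar> powr q) \<partial>lborel)"
      proof (intro nn_integral_cong)
        fix x
        have "t * u0 x - a = t * (u0 x - a / t)" using t by (simp add: algebra_simps)
        then have "\<bar>t * u0 x - a\<bar> powr q = t powr q * \<bar>u0 x - a / t\<bar> powr q"
          using t by (simp add: abs_mult powr_mult)
        then show "ennreal (t powr q) * (indicator G x * ennreal (\<bar>u0 x - a / t\<bar> powr q)) = indicator G x * ennreal (\<bar>t * u0 x - a\<bar> powr q)"
          by (simp add: ennreal_mult mult.left_commute)
      qed
      also have "\<dots> \<le> ennreal c * (1 + (\<integral>\<^sup>+x. indicator G x * ennreal (norm (t *\<^sub>R v0 x) powr p) \<partial>lborel))"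
        unfolding a_def by (rule c(2)[OF ctrl])
      also have "(\<integral>\<^sup>+x. indicator G x * ennreal (norm (t *\<^sub>R v0 x) powr p) \<partial>lborel) =
        (\<integral>\<^sup>+x. ennreal (t powr p) * (indicator G x * ennreal (norm (v0 x) powr p)) \<partial>lborel)"
        using t by (intro nn_integral_cong) (simp add: powr_mult ennreal_mult mult.left_commute)
      also have "\<dots> = ennreal (t powr p) * ennreal W"
        unfolding W(1)[symmetric] by (rule nn_integral_cmult) measurable
      also have "ennreal c * (1 + ennreal (t powr p) * ennreal W) = ennreal (c * (1 + t powr p * W))"
        using c W by (simp add: ennreal_mult)
      also have "ennreal K * ennreal (c * (1 + t powr p * W)) = ennreal (K * c * (1 + t powr p * W))"
        using K c W by (simp add: ennreal_mult[symmetric] mult.assoc)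
      finally show ?thesis by (simp add: mult_left_mono)
    qed
    have avg: "integral_average G u = A"
    proof -
      have "(LINT x:G|lebesgue. u x) = (LINT x|lebesgue. indicator G x *\<^sub>R u0 x)"
        unfolding set_lebesgue_integral_def
      proof (rule integral_cong_AE)
        show "(\<lambda>x. indicator G x *\<^sub>R u x) \<in> borel_measurable lebesgue" using mu by (simp add: set_borel_measurable_def)
        show "(\<lambda>x. indicator G x *\<^sub>R u0 x) \<in> borel_measurable lebesgue" by (rule measurable_completion) measurable
        show "AE x in lebesgue. indicator G x *\<^sub>R u x = indicator G x *\<^sub>R u0 x"
          using AE_completion[OF u0(2)] by eventually_elim (simp split: split_indicator)
      qed
      also have "\<dots> = (\<integral>y. indicator G y * u0 y \<partial>lborel)" by (subst integral_completion) auto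
      finally show ?thesis by (simp add: integral_average_def A_def \<mu>')
    qed
    have "AE x in lborel. x \<in> G \<longrightarrow> u0 x = u x" using u0(2) by eventually_elim simp
    then have XE: "(LINT x:G|lebesgue. \<bar>u x - integral_average G u\<bar> powr q) = enn2real X"
      unfolding avg X_def by (intro set_integral_representative[OF mu, of u0 "\<lambda>y. \<bar>y - A\<bar> powr q"]) auto
    have "AE x in lborel. x \<in> G \<longrightarrow> v0 x = v x" using v0(2) by eventually_elim simp
    then have "(LINT x:G|lebesgue. norm (v x) powr p) = enn2real (\<integral>\<^sup>+x. indicator G x * ennreal (norm (v0 x) powr p) \<partial>lborel)"
      by (intro set_integral_representative[OF mv, of v0 "\<lambda>y. norm y powr p"]) auto
    then have WE: "(LINT x:G|lebesgue. norm (v x) powr p) = W" by (simp add: W_def)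
    show "(LINT x:G|lebesgue. \<bar>u x - integral_average G u\<bar> powr q) powr (1 / q)
      \<le> (2 * (K * c)) powr (1 / q) * (LINT x:G|lebesgue. norm (v x) powr p) powr (1 / p)"
      unfolding XE WE using assms K c W by (intro homogeneous_of_scaled scaled) auto
  qed
qed

end

section \<open>Boundary distance, choice of exponents, and assembly\<close>

lemma infdist_frontier:
  fixes G :: "'a::euclidean_space set"
  assumes "open G" "bounded G" "G \<noteq> {}"
  shows "frontier G \<noteq> {}" and "x \<in> G \<Longrightarrow> 0 < infdist x (frontier G)"
    and "x \<in> G \<Longrightarrow> ball x (infdist x (frontier G)) \<subseteq> G"
    and "\<exists>D0. \<forall>x\<in>G. infdist x (frontier G) \<le> D0"
proof -
  have "G \<noteq> UNIV" using assms(2) not_bounded_UNIV by auto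
  then show ne: "frontier G \<noteq> {}" using assms(3) by (simp add: frontier_eq_empty)
  show "0 < infdist x (frontier G)" if "x \<in> G"
  proof (rule infdist_pos_not_in_closed)
    show "x \<notin> frontier G" using that assms(1) by (simp add: frontier_def interior_open)
  qed (use ne in auto)
  show "ball x (infdist x (frontier G)) \<subseteq> G" if x: "x \<in> G"
  proof (rule ccontr)
    assume n: "\<not> ball x (infdist x (frontier G)) \<subseteq> G"
    then have "0 < infdist x (frontier G)" by (metis ball_empty empty_subsetI not_le)
    then have "x \<in> ball x (infdist x (frontier G))" by simp
    then have "ball x (infdist x (frontier G)) \<inter> G \<noteq> {}" using x by blast
    moreover have "ball x (infdist x (frontier G)) - G \<noteq> {}" using n by blast
    \<comment> \<open>A ball is connected, so if it left \<open>G\<close> it would meet the frontier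
      closer to \<open>x\<close> than its distance permits.\<close>
    ultimately have "ball x (infdist x (frontier G)) \<inter> frontier G \<noteq> {}"
      by (intro connected_Int_frontier) auto
    then obtain y where "y \<in> frontier G" "dist x y < infdist x (frontier G)" by auto
    then show False using infdist_le[of y "frontier G" x] by simp
  qed
  obtain y where y: "y \<in> frontier G" using ne by auto
  obtain e where e: "\<forall>x\<in>G. dist y x \<le> e" using assms(2) bounded_any_center by blast
  show "\<exists>D0. \<forall>x\<in>G. infdist x (frontier G) \<le> D0"
    using infdist_le[OF y] e by (intro exI[of _ e]) (metis dist_commute order_trans)
qed

text \<open>At \<open>\<eta> = 0\<close> the quantity \<open>\<phi>\<close> is
  \<open>p * (q + b * (n - lam)) - q * (n - lam * b)\<close> divided by \<open>p - q\<close>,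
  positive by the assumption on \<open>p\<close>. By continuity it stays positive when
  \<open>b\<close>, \<open>s\<close> and the Jensen weight all give up the same small
  \<eta>.\<close>

lemma exists_exponents:
  fixes n \<beta> b lam p q :: real
  assumes "0 < b" "lam < n" "1 \<le> q" "q < p" "0 < n" "0 \<le> lam"
    and "p > q * (n - lam * b) / (q + b * (n - lam))"
  obtains b' s \<epsilon> where "0 < b'" "b' < b" "0 \<le> s" "s < n - lam" "0 < \<epsilon>"
    "0 < (b' * n * q + (\<epsilon> - n + (1 - \<epsilon>) * q) * p) / (p - q) + n + b' * s"
proof -
  define \<phi> where "\<phi> \<eta> = ((b - \<eta>) * n * q + (\<eta> - n + (1 - \<eta>) * q) * p) / (p - q) + n + (b - \<eta>) * (n - lam - \<eta>)" for \<eta>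
  have den: "q + b * (n - lam) > 0" using assms by (intro add_pos_pos mult_pos_pos) auto
  have "\<phi> 0 > 0"
  proof -
    have "q * (n - lam * b) < p * (q + b * (n - lam))" using assms(7) den by (simp add: field_simps)
    then have "0 < (p * (q + b * (n - lam)) - q * (n - lam * b)) / (p - q)" using assms by simp
    also have "\<dots> = \<phi> 0" using assms by (simp add: \<phi>_def field_simps)
    finally show ?thesis .
  qed
  have "((\<lambda>\<eta>. \<phi> \<eta>) \<longlongrightarrow> ((b - 0) * n * q + (0 - n + (1 - 0) * q) * p) / (p - q) + n + (b - 0) * (n - lam - 0)) (at_right 0)"
    unfolding \<phi>_def using assms by (intro tendsto_intros) auto
  then have "(\<phi> \<longlongrightarrow> \<phi> 0) (at_right 0)" unfolding \<phi>_def[abs_def] by simp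
  then have "eventually (\<lambda>\<eta>. 0 < \<phi> \<eta>) (at_right 0)" using \<open>\<phi> 0 > 0\<close> by (rule order_tendstoD)
  moreover have "eventually (\<lambda>\<eta>::real. 0 < \<eta> \<and> \<eta> < min b (n - lam)) (at_right 0)"
    using assms by (auto simp: eventually_at_right_field intro!: exI[of _ "min b (n - lam)"])
  ultimately have "eventually (\<lambda>\<eta>. 0 < \<phi> \<eta> \<and> 0 < \<eta> \<and> \<eta> < min b (n - lam)) (at_right 0)"
    by eventually_elim auto
  then obtain \<eta> where \<eta>: "0 < \<phi> \<eta>" "0 < \<eta>" "\<eta> < min b (n - lam)"
    using eventually_happens'[OF trivial_limit_at_right_real] by blast
  show thesis
    by (rule that[of "b - \<eta>" "n - lam - \<eta>" \<eta>]) (use \<eta> in \<open>auto simp: \<phi>_def\<close>)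
qed

theorem theorem3p1:
  fixes G :: "(real ^ 'n) set" and n \<beta> b lam p q :: real
  defines "n \<equiv> real (CARD('n))" and "b \<equiv> 2 * \<beta> / (1 + \<beta>)"
  assumes "CARD('n) \<ge> 2"
    and "open G" and "connected G" and "bounded G"
    and "0 < \<beta>" and "\<beta> \<le> 1"
    and "quasihyperbolic_boundary_condition \<beta> G"
    and "n - 1 \<le> lam" and "lam < n"
    and "upper_minkowski_dim (frontier G) \<le> ennreal lam"
    and "1 \<le> q" and "q < p"
    and "p > q * (n - lam * b) / (q + b * (n - lam))"
  shows "supports_Poincare q p G"
proof -
  have n: "n = real DIM(real ^ 'n)" by (simp add: n_def)
  have n2: "n \<ge> 2" using assms(3) by (simp add: n_def)
  have lam: "0 \<le> lam" using n2 \<open>n - 1 \<le> lam\<close> by simp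
  have b: "0 < b" "b \<le> 1" using \<open>0 < \<beta>\<close> \<open>\<beta> \<le> 1\<close> by (auto simp: b_def)
  \<comment> \<open>The boundary condition provides a base point in \<open>G\<close>.\<close>
  have "G \<noteq> {}" using \<open>quasihyperbolic_boundary_condition \<beta> G\<close>
    by (auto simp: quasihyperbolic_boundary_condition_def)
  note fr = infdist_frontier[OF \<open>open G\<close> \<open>bounded G\<close> this]
  obtain D0 where D0: "\<And>x. x \<in> G \<Longrightarrow> infdist x (frontier G) \<le> D0" using fr(4) by blast
  obtain b' s \<epsilon> where par: "0 < b'" "b' < b" "0 \<le> s" "s < n - lam" "0 < \<epsilon>"
    "0 < (b' * n * q + (\<epsilon> - n + (1 - \<epsilon>) * q) * p) / (p - q) + n + b' * s"
    using exists_exponents[of b lam n q p] b lam n2 assms by auto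
  obtain \<kappa> x0 C0 \<sigma> C f N where chain: "0 < \<kappa>" "\<kappa> < 1/20" "x0 \<in> G" "0 < C0" "0 < \<sigma>" "0 < C"
    "\<And>z. z \<in> G \<Longrightarrow> f z 0 = z" "\<And>z. z \<in> G \<Longrightarrow> f z (N z) = x0"
    "\<And>z i. z \<in> G \<Longrightarrow> i \<le> N z \<Longrightarrow> f z i \<in> G"
    "\<And>z i. z \<in> G \<Longrightarrow> i < N z \<Longrightarrow> dist (f z i) (f z (Suc i)) \<le> \<kappa> * infdist (f z i) (frontier G)"
    "\<And>z i. z \<in> G \<Longrightarrow> i \<le> N z \<Longrightarrow> infdist (f z i) (frontier G) \<le> C0 * exp (- \<sigma> * real (N z - i))"
    "\<And>z i j. z \<in> G \<Longrightarrow> i < j \<Longrightarrow> j \<le> N z \<Longrightarrow> dist (f z i) (f z j) \<le> \<kappa> * infdist (f z i) (frontier G) \<Longrightarrow> j = Suc i"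
    "\<And>z i. z \<in> G \<Longrightarrow> i \<le> N z \<Longrightarrow> dist z (f z i) \<le> C * infdist (f z i) (frontier G) powr b'"
  \<comment> \<open>The chains are built for \<open>b'\<close>, since the displacement bound is
    available only strictly below the limiting exponent \<open>b\<close>.\<close>
  proof (rule chain_family[of \<beta> G D0 b'], goal_cases)
    case (8 \<kappa> x0 C0 \<sigma> C f N)
    show ?case by (rule that; fact 8)
  qed (use \<open>quasihyperbolic_boundary_condition \<beta> G\<close> fr(2) D0 \<open>0 < \<beta>\<close> \<open>\<beta> \<le> 1\<close> par(1) par(2)[unfolded b_def] in blast)+
  interpret chain_domain G "\<lambda>x. infdist x (frontier G)" \<kappa> C0 \<sigma> C b' D0 n "unit_ball_vol n" x0 f N
    by unfold_locales (rule infdist_Lipschitz | (use n chain par b fr(2,3) D0 \<open>open G\<close> \<open>bounded G\<close> in \<open>auto; fail\<close>))+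
  have "(\<integral>\<^sup>+x\<in>G. ennreal (infdist x (frontier G) powr (- s)) \<partial>lborel) < \<infinity>"
    using assms par lam fr unfolding n by (intro nn_integral_infdist_powr_finite) auto
  then show ?thesis
    using \<open>1 \<le> q\<close> \<open>q < p\<close> par by (intro supports_Poincare_of_parameters) auto
qed

end
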